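(* Let $\phi:\mathbb R^d\to\mathbb R\cup\{\infty\}$ be a symmetric measurable pair potential satisfying the conditions (RP), (BB), (T) listed in the context, and let $\rho_{\max}>0$, $\beta>0$. Then there exist constants $\xi>0$, $\lambda_*>0$ and $\zeta\ge\xi$ such that for all $\lambda\ge\lambda_*$ and all $n\in\mathbb N_0$, $N\in\mathbb N$ with $n\le N\le\rho_{\max}(2\lambda)^d$ the canonical correlation functions satisfy $k_\lambda^{(n,N)}\le\xi^n$ on $\Lambda_\lambda^n$ and, for all $x_1,\dots,x_n\in\Lambda_\lambda$, $$k_\lambda^{(n,N)}(x_1,\dots,x_n)\le\zeta^n\inf_{1\le i\le n}e^{-\beta\sum_{j\ne i}\hat\phi_\lambda(x_i-x_j)}$$ (where $j$ ranges over $\{1,\dots,n\}\setminus\{i\}$). It follows also that, for $n\ge1$, $$k_\lambda^{(n,N)}(x_1,\dots,x_n)\le\zeta^n e^{-\frac{2\beta}{n}\sum_{\{i,j\}\subset\{1,\dots,n\}}\hat\phi_\lambda(x_i-x_j)}=\zeta^ne^{-\frac{2\beta}n\widetilde U_{\phi,\lambda}(\{x_1,\dots,x_n\})}.$$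
   Context: $|\cdot|$ is the maximum norm on $\mathbb R^d$; $\mathbb N_0=\mathbb N\cup\{0\}$; $\Lambda_\lambda:=(-\lambda,\lambda]^d$ for $\lambda>0$. Symmetric means $\phi(x)=\phi(-x)$. The infimum over the empty set is $+\infty$. Conditions on $\phi$: (BB) There is $M<\infty$ with $\phi(x)\ge -M$ for all $x\in\mathbb R^d$. (RP) There exist $R_1>0$ and a decreasing continuous function $\Phi:(0,\infty)\to[0,\infty)$ with $\lim_{t\to0}\Phi(t)t^d=\infty$ such that $\phi(x)\ge\Phi(|x|)$ for $|x|\le R_1$ (with $\Phi(0):=+\infty$, so $\phi(0)=+\infty$); furthermore $\phi$ is bounded from above on $\{x:\ r\le|x|<\infty\}$ for every $r>0$. (T) There exist $G,R_2<\infty$ and $\varepsilon>0$ such that $|\phi(x)|\le G|x|^{-d-\varepsilon}$ for $|x|\ge R_2$. Periodized potential: $\hat\phi_\lambda(y):=1_{(-2\lambda,2\lambda)^d}(y)\sum_{r\in\mathbb Z^d}\phi(y+2\lambda r)$. Periodic energy: $\widetilde U_{\phi,\lambda}(\{x_1,\dots,x_N\}):=\sum_{1\le i<j\le N}\sum_{r\in\mathbb Z^d}\phi(x_i-x_j+2\lambda r)$ for $x_1,\dots,x_N\in\Lambda_\lambda$. Partition function: $Z_\lambda^{N,\beta}:=\int_{\Lambda_\lambda^N}e^{-\beta\widetilde U_{\phi,\lambda}(\{x_1,\dots,x_N\})}dx_1\cdots dx_N$. Canonical correlation functions with periodic boundary: $$k_\lambda^{(n,N)}(x_1,\dots,x_n):=\frac{N!}{(N-n)!}\frac1{Z_\lambda^{N,\beta}}\int_{\Lambda_\lambda^{N-n}}e^{-\beta\widetilde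 U_{\phi,\lambda}(\{x_1,\dots,x_N\})}dx_{n+1}\cdots dx_N,$$ with $k_\lambda^{(0,N)}=1$ and no integration if $n=N$. *)

theory Defs
  imports "HOL-Analysis.Analysis"
begin

text \<open>
  Potentials take values in the real line with \<open>\<infinity>\<close> adjoined; they are rendered as
  \<^typ>\<open>ereal\<close>-valued functions that avoid \<open>-\<infinity>\<close>. The maximum norm on \<open>real ^ 'd\<close> is
  \<^const>\<open>infnorm\<close>, and the dimension \<open>d\<close> is \<open>CARD('d)\<close>.
  The half side length of the box is written \<open>L\<close>.
\<close>

definition lower_bounded_potential :: "(real ^ 'd \<Rightarrow> ereal) \<Rightarrow> bool" where
  "lower_bounded_potential \<phi> \<longleftrightarrow> (\<exists>M::real. \<forall>x. \<phi> x \<ge> ereal (- M))"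

text \<open>The conjunct \<open>\<phi> 0 = \<infinity>\<close> is the instance \<open>x = 0\<close> of \<open>\<phi> x \<ge> \<Phi> (infnorm x)\<close> with the
  convention \<open>\<Phi> 0 = \<infinity>\<close>. "Decreasing" is not required to be strict.\<close>

definition strongly_repulsive :: "(real ^ 'd \<Rightarrow> ereal) \<Rightarrow> bool" where
  "strongly_repulsive \<phi> \<longleftrightarrow>
    (\<exists>R\<^sub>1>0. \<exists>\<Phi> :: real \<Rightarrow> real.
       antimono_on {0<..} \<Phi> \<and> continuous_on {0<..} \<Phi> \<and> (\<forall>t>0. \<Phi> t \<ge> 0) \<and>
       filterlim (\<lambda>t. \<Phi> t * t ^ CARD('d)) at_top (at_right 0) \<and>
       \<phi> 0 = \<infinity> \<and>
       (\<forall>x. 0 < infnorm x \<and> infnorm x \<le> R\<^sub>1 \<longrightarrow> \<phi> x \<ge> ereal (\<Phi> (infnorm x)))) \<and>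
    (\<forall>r>0. \<exists>B::real. \<forall>x. r \<le> infnorm x \<longrightarrow> \<phi> x \<le> ereal B)"

text \<open>Requiring \<open>R\<^sub>2 > 0\<close> loses no generality and keeps \<open>0 powr a = 0\<close> out of the condition.\<close>

definition tempered :: "(real ^ 'd \<Rightarrow> ereal) \<Rightarrow> bool" where
  "tempered \<phi> \<longleftrightarrow>
    (\<exists>(G::real) (R\<^sub>2::real) (\<epsilon>::real). R\<^sub>2 > 0 \<and> \<epsilon> > 0 \<and>
       (\<forall>x. infnorm x \<ge> R\<^sub>2 \<longrightarrow>
          \<bar>\<phi> x\<bar> \<le> ereal (G * infnorm x powr (- real CARD('d) - \<epsilon>))))"

definition box_\<Lambda> :: "real \<Rightarrow> (real ^ 'd) set" where
  "box_\<Lambda> L = {x. \<forall>i. - L < x $ i \<and> x $ i \<le> L}"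

definition int_lattice :: "(real ^ 'd) set" where
  "int_lattice = {r. \<forall>i. r $ i \<in> \<int>}"

text \<open>
  The lattice sum is the unordered sum in \<^typ>\<open>ereal\<close>: the limit of the finite partial sums.
  If no term is \<open>-\<infinity>\<close> and some term is \<open>\<infinity>\<close>, its value is \<open>\<infinity>\<close>; if all terms are finite and
  absolutely summable (which temperedness ensures), it is the usual real sum.
\<close>

definition lattice_sum :: "(real ^ 'd \<Rightarrow> ereal) \<Rightarrow> real \<Rightarrow> real ^ 'd \<Rightarrow> ereal" where
  "lattice_sum \<phi> L y = (\<Sum>\<^sub>\<infinity>r\<in>int_lattice. \<phi> (y + (2 * L) *\<^sub>R r))"

definition periodized :: "(real ^ 'd \<Rightarrow> ereal) \<Rightarrow> real \<Rightarrow> real ^ 'd \<Rightarrow> ereal" where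
  "periodized \<phi> L y =
     indicator {z. \<forall>i. - (2 * L) < z $ i \<and> z $ i < 2 * L} y * lattice_sum \<phi> L y"

text \<open>Configurations of \<open>N\<close> particles are indexed by \<open>{1..N}\<close>; unordered pairs \<open>{i, j}\<close> are
  enumerated by \<open>i < j\<close>.\<close>

definition index_pairs :: "nat \<Rightarrow> (nat \<times> nat) set" where
  "index_pairs N = {(i, j). 1 \<le> i \<and> i < j \<and> j \<le> N}"

definition per_energy ::
    "(real ^ 'd \<Rightarrow> ereal) \<Rightarrow> real \<Rightarrow> nat \<Rightarrow> (nat \<Rightarrow> real ^ 'd) \<Rightarrow> ereal" where
  "per_energy \<phi> L N x = (\<Sum>(i, j)\<in>index_pairs N. lattice_sum \<phi> L (x i - x j))"

text \<open>The exponential with \<open>exp (-\<infinity>) = 0\<close> and \<open>exp \<infinity> = \<infinity>\<close>.\<close>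

definition exp_ext :: "ereal \<Rightarrow> ennreal" where
  "exp_ext u = (case u of ereal r \<Rightarrow> ennreal (exp r) | PInfty \<Rightarrow> \<infinity> | MInfty \<Rightarrow> 0)"

definition partition_fun :: "(real ^ 'd \<Rightarrow> ereal) \<Rightarrow> real \<Rightarrow> real \<Rightarrow> nat \<Rightarrow> ennreal" where
  "partition_fun \<phi> \<beta> L N =
     (\<integral>\<^sup>+x\<in>({1..N} \<rightarrow>\<^sub>E box_\<Lambda> L). exp_ext (ereal (- \<beta>) * per_energy \<phi> L N x)
        \<partial>(\<Pi>\<^sub>M i\<in>{1..N}. lborel))"

text \<open>Only the values \<open>x 1, \<dots>, x n\<close> matter. For \<open>n = N\<close> the product measure is the unit mass on the
  empty configuration, so there is no integration.\<close>

definition corr_fun ::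
    "(real ^ 'd \<Rightarrow> ereal) \<Rightarrow> real \<Rightarrow> real \<Rightarrow> nat \<Rightarrow> nat \<Rightarrow> (nat \<Rightarrow> real ^ 'd) \<Rightarrow> ennreal" where
  "corr_fun \<phi> \<beta> L n N x =
     (if n = 0 then 1 else
        ennreal (fact N / fact (N - n)) * (1 / partition_fun \<phi> \<beta> L N) *
        (\<integral>\<^sup>+y\<in>({n+1..N} \<rightarrow>\<^sub>E box_\<Lambda> L).
           exp_ext (ereal (- \<beta>) * per_energy \<phi> L N (\<lambda>i. if i \<le> n then x i else y i))
           \<partial>(\<Pi>\<^sub>M i\<in>{n+1..N}. lborel)))"

end

(*
  Cut the torus into cells of side about 1/m. By (RP), for large m the repulsion between two
  particles of one cell exceeds any multiple of m^d, and m^d is the order of the total attraction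
  exerted on a cell by one particle in every cell, by (T).

  Let n particles be fixed, one of them (the ghost) acting only through its attraction, and let
  w be a small power of 1 + distance to the fixed particles. In a configuration of the free
  particles call a cell q crowded if it contains more than 4 w(q) particles. Since w is
  submultiplicative and grows more slowly than the attraction decays, the uncrowded cells attract
  q with strength of order m^d w(q) at most, so taking out all particles of the crowded cells
  together with the fixed ones lowers the energy by at least c w(q) for each free particle taken
  out, up to an error of order n. As exp(-c w) has integral of order n over the torus, this bounds
  the Boltzmann integral by a sum over the sets S of removed particles of
  exp(O(n)) (C n)^|S| Z(N - n - |S|).

  Conversely a particle can be inserted in at least half of the volume at bounded cost, so
  Z(M + 1) >= c |Lambda| Z(M) as long as M <= rho_max |Lambda|. Reinserting the n + |S| removed
  particles turns the sum into zeta^n Z(N). Taking any x_i as the ghost gives the bound with the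
  infimum, and the last bound follows because a minimum is at most an average.
*)
theory Submission
  imports Defs
begin

section \<open>Counting pairs and removing crowded cells\<close>

text \<open>The obstacle is to lose a factor exponential in n only, not in N. With a constant
  threshold every removed particle would contribute an integral of order |\<Lambda>|, and the sum
  over S would be exponential in N. A weight growing away from the fixed particles leaves G = n * C
  * \<sigma> per removed particle against a gain \<open>ins * vol\<close> per reinsertion, so the
  sum over S is governed by (1 + G / (ins * vol))^N, which is exponential in n because N is at most
  \<rho> * vol. This dictates the exponents: attraction decays like P to the power - 1 - 2 \<eta>, w
  is P to the power \<eta>, and their product with exponent - 1 - \<eta> is still summable. Since P
  is a product of 1 + distance over the coordinates, the critical exponent is 1 in every dimension.
  The ghost decouples one particle. Of its pair factors those with a chosen set J of fixed particles
  are kept, the others are replaced by their upper bounds. J empty yields the uniform bound, J the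
  set of all other fixed particles the bound with the infimum, and the constant is the same.\<close>

definition pairs :: "nat set \<Rightarrow> (nat \<times> nat) set" where
  "pairs I = {(i, j). i \<in> I \<and> j \<in> I \<and> i < j}"

lemma index_pairs_eq: "index_pairs N = pairs {1..N}"
  by (auto simp: index_pairs_def pairs_def)

lemma finite_pairs [simp]: "finite I \<Longrightarrow> finite (pairs I)"
  by (rule finite_subset[of _ "I \<times> I"]) (auto simp: pairs_def)

lemma pairs_empty [simp]: "pairs {} = {}"
  by (simp add: pairs_def)

text \<open>A new index \<open>k\<close> may lie anywhere in the order, so its pairs are coded by
  \<open>min\<close> and \<open>max\<close>; for symmetric \<open>g\<close> this coding disappears
  from sums and products.\<close>

lemma pairs_insert:
  assumes "k \<notin> I"
  shows "pairs (insert k I) = pairs I \<union> (\<lambda>i. (min i k, max i k)) ` I"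
    and "pairs I \<inter> (\<lambda>i. (min i k, max i k)) ` I = {}"
    and "inj_on (\<lambda>i. (min i k, max i k)) I"
proof -
  have im: "(\<lambda>i. (min i k, max i k)) ` I =
      {(a, b). a \<in> I \<and> a < k \<and> b = k \<or> a = k \<and> b \<in> I \<and> k < b}" (is "?l = ?r")
  proof (intro equalityI subsetI)
    fix p assume "p \<in> ?l"
    then obtain i where "i \<in> I" "p = (min i k, max i k)" by blast
    moreover have "i < k \<or> k < i" using calculation assms by (cases i k rule: linorder_cases) auto
    ultimately show "p \<in> ?r" by auto
  next
    fix p assume "p \<in> ?r"
    then obtain a b where p: "p = (a, b)" "a \<in> I \<and> a < k \<and> b = k \<or> a = k \<and> b \<in> I \<and> k < b"
      by blast
    then show "p \<in> ?l"
      by (auto intro: image_eqI[where x=a] image_eqI[where x=b])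
  qed
  show "pairs (insert k I) = pairs I \<union> (\<lambda>i. (min i k, max i k)) ` I"
    and "pairs I \<inter> (\<lambda>i. (min i k, max i k)) ` I = {}"
    unfolding im using assms by (auto simp: pairs_def)
  show "inj_on (\<lambda>i. (min i k, max i k)) I"
    by (rule inj_onI) (metis max_def min_def prod.inject)
qed

lemma sum_pairs_insert:
  fixes g :: "nat \<Rightarrow> nat \<Rightarrow> 'b::comm_monoid_add"
  assumes "finite I" "k \<notin> I" and sym: "\<And>i j. g i j = g j i"
  shows "(\<Sum>(i, j)\<in>pairs (insert k I). g i j) = (\<Sum>(i, j)\<in>pairs I. g i j) + (\<Sum>i\<in>I. g k i)"
proof -
  have "(\<Sum>(i, j)\<in>(\<lambda>i. (min i k, max i k)) ` I. g i j) = (\<Sum>i\<in>I. g k i)"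
    using sym by (subst sum.reindex[OF pairs_insert(3)[OF assms(2)]])
      (auto simp: min_def max_def intro!: sum.cong)
  then show ?thesis
    using assms(1) by (simp add: pairs_insert[OF assms(2)] sum.union_disjoint)
qed

lemma prod_pairs_insert:
  fixes g :: "nat \<Rightarrow> nat \<Rightarrow> 'b::comm_monoid_mult"
  assumes "finite I" "k \<notin> I" and sym: "\<And>i j. g i j = g j i"
  shows "(\<Prod>(i, j)\<in>pairs (insert k I). g i j) = (\<Prod>(i, j)\<in>pairs I. g i j) * (\<Prod>i\<in>I. g k i)"
proof -
  have "(\<Prod>(i, j)\<in>(\<lambda>i. (min i k, max i k)) ` I. g i j) = (\<Prod>i\<in>I. g k i)"
    using sym by (subst prod.reindex[OF pairs_insert(3)[OF assms(2)]])
      (auto simp: min_def max_def intro!: prod.cong)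
  then show ?thesis
    using assms(1) by (simp add: pairs_insert[OF assms(2)] prod.union_disjoint)
qed

lemma sum_pairs_union:
  fixes g :: "nat \<Rightarrow> nat \<Rightarrow> 'b::comm_monoid_add"
  assumes "finite I" "finite J" "I \<inter> J = {}" and sym: "\<And>i j. g i j = g j i"
  shows "(\<Sum>(i, j)\<in>pairs (I \<union> J). g i j) =
    (\<Sum>(i, j)\<in>pairs I. g i j) + (\<Sum>(i, j)\<in>pairs J. g i j) + (\<Sum>i\<in>I. \<Sum>j\<in>J. g i j)"
  using assms(1,3)
proof (induction I rule: finite_induct)
  case (insert k I)
  then have "k \<notin> I \<union> J" "finite (I \<union> J)" "I \<inter> J = {}"
    using assms(2) by auto
  then show ?case
    using insert sym assms(2)
    by (simp add: sum_pairs_insert[where g=g] sum.union_disjoint ac_simps)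
qed simp

lemma sum_offdiag_eq_pairs:
  fixes g :: "nat \<Rightarrow> nat \<Rightarrow> 'b::comm_monoid_add"
  assumes "finite I" and sym: "\<And>i j. g i j = g j i"
  shows "(\<Sum>i\<in>I. \<Sum>j\<in>I - {i}. g i j) = (\<Sum>(i, j)\<in>pairs I. g i j) + (\<Sum>(i, j)\<in>pairs I. g i j)"
  using assms(1)
proof (induction I rule: finite_induct)
  case (insert k I)
  have "(\<Sum>j\<in>insert k I - {i}. g i j) = (\<Sum>j\<in>I - {i}. g i j) + g k i" if "i \<in> I" for i
  proof -
    have "insert k I - {i} = insert k (I - {i})" using that insert by auto
    then show ?thesis using insert sym by (simp add: add.commute)
  qed
  then have "(\<Sum>i\<in>I. \<Sum>j\<in>insert k I - {i}. g i j) =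
      (\<Sum>i\<in>I. \<Sum>j\<in>I - {i}. g i j) + (\<Sum>i\<in>I. g k i)"
    by (simp add: sum.distrib)
  moreover have "insert k I - {k} = I" using insert by auto
  ultimately show ?case
    using insert sym by (simp add: sum_pairs_insert[where g=g] ac_simps)
qed simp

text \<open>Particles in overcrowded cells can be removed at a profit: the threshold \<open>4 * w\<close> grows
  away from the cells with \<open>w = 1\<close>, slowly enough that the attraction exerted by all the
  cells below the threshold on a cell \<open>q\<close> is still at most \<open>4 * A * w q\<close>.\<close>

lemma crowded_cells_removal:
  fixes a :: "'c \<Rightarrow> 'c \<Rightarrow> real" and u :: "nat \<Rightarrow> nat \<Rightarrow> real"
  assumes fin: "finite K" "finite F" "finite Y" and disj: "F \<inter> Y = {}"
    and cK: "\<And>i. i \<in> F \<union> Y \<Longrightarrow> c i \<in> K" and q0: "q0 \<in> K"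
    and a0: "\<And>p q. 0 \<le> a p q" and asym: "\<And>p q. a p q = a q p"
    and sumA: "\<And>q. q \<in> K \<Longrightarrow> (\<Sum>p\<in>K. a q p) \<le> A"
    and sumw: "\<And>q. q \<in> K \<Longrightarrow> (\<Sum>p\<in>K. a q p * w p) \<le> A * w q"
    and w1: "\<And>q. q \<in> K \<Longrightarrow> 1 \<le> w q" and wq0: "w q0 = 1" and wF: "\<And>i. i \<in> F \<Longrightarrow> w (c i) = 1"
    and usym: "\<And>i j. u i j = u j i"
    and u1: "\<And>i j. i \<in> F \<union> Y \<Longrightarrow> j \<in> F \<union> Y \<Longrightarrow> i \<noteq> j \<Longrightarrow> - a (c i) (c j) \<le> u i j"
    and u2: "\<And>i j. i \<in> F \<union> Y \<Longrightarrow> j \<in> F \<union> Y \<Longrightarrow> i \<noteq> j \<Longrightarrow> c i = c j \<Longrightarrow> 16 * A \<le> u i j"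
  shows "\<exists>S\<subseteq>Y. (\<Sum>(i, j)\<in>pairs (Y - S). u i j) + 16 * A * (\<Sum>i\<in>S. w (c i))
      - 6 * A * (real (card F) + 1)
    \<le> (\<Sum>(i, j)\<in>pairs (F \<union> Y). u i j) - (\<Sum>i\<in>F \<union> Y. a q0 (c i))"
proof -
  define n where "n I q = real (card {i\<in>I. c i = q})" for I q
  \<comment> \<open>The count includes the fixed particles, and the criterion depends on the cell
    only. A crowded cell thus loses all its free particles at once, and its occupation by
    \<open>G\<close> is its full occupation.\<close>
  define S where "S = {i\<in>Y. n (F \<union> Y) (c i) > 4 * w (c i)}"
  define G where "G = F \<union> S"
  define R where "R = Y - S"
  have SY: "S \<subseteq> Y" by (auto simp: S_def)
  have finS: "finite S" "finite G" "finite R"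
    using fin SY finite_subset by (auto simp: G_def R_def)
  have GR: "F \<union> Y = G \<union> R" "G \<inter> R = {}" using SY disj by (auto simp: G_def R_def)
  have A0: "0 \<le> A" using sumA[OF q0] a0 by (meson order_trans sum_nonneg)
  have sum_cells: "(\<Sum>i\<in>I. h (c i)) = (\<Sum>q\<in>K. n I q * h q)" if "I \<subseteq> F \<union> Y" for I and h :: "'c \<Rightarrow> real"
  proof -
    have fI: "finite I" using that fin finite_subset by blast
    have "(\<Sum>i\<in>I. h (c i)) = (\<Sum>q\<in>K. \<Sum>i\<in>{i\<in>I. c i = q}. h (c i))"
      by (rule sum.group[symmetric]) (use that cK fI fin in auto)
    also have "\<dots> = (\<Sum>q\<in>K. n I q * h q)"
      by (intro sum.cong) (auto simp: n_def)
    finally show ?thesis .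
  qed
  have nR: "n R q \<le> 4 * w q" if q: "q \<in> K" for q
  proof (cases "\<exists>i\<in>R. c i = q")
    case True
    then obtain i where i: "i \<in> R" "c i = q" by auto
    then have "n (F \<union> Y) q \<le> 4 * w q" by (auto simp: R_def S_def)
    moreover have "n R q \<le> n (F \<union> Y) q"
      unfolding n_def of_nat_le_iff by (rule card_mono) (use fin in \<open>auto simp: R_def\<close>)
    ultimately show ?thesis by simp
  next
    case False
    then have "{i\<in>R. c i = q} = {}" by blast
    then have "n R q = 0" unfolding n_def by (metis card.empty of_nat_0)
    then show ?thesis using w1[OF q] by simp
  qed
  have cross: "(\<Sum>j\<in>R. a q (c j)) \<le> 4 * A * w q" if q: "q \<in> K" for q
  proof -
    have "(\<Sum>j\<in>R. a q (c j)) = (\<Sum>p\<in>K. n R p * a q p)"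
      by (rule sum_cells) (use GR in auto)
    also have "\<dots> \<le> (\<Sum>p\<in>K. 4 * (a q p * w p))"
    proof (intro sum_mono)
      fix p assume "p \<in> K"
      then show "n R p * a q p \<le> 4 * (a q p * w p)"
        using mult_right_mono[OF nR a0[of q p], of p] by (simp add: algebra_simps)
    qed
    also have "\<dots> \<le> 4 * A * w q"
      using sumw[OF q] by (simp add: sum_distrib_left[symmetric])
    finally show ?thesis .
  qed
  \<comment> \<open>Schur's test: by \<open>2 * s * t \<le> s^2 + t^2\<close> and the symmetry of
    \<open>a\<close>, the quadratic form of \<open>a\<close> in the occupation numbers is at most
    \<open>A\<close> times the sum of their squares, which is the sum of \<open>n G\<close> over the
    particles of \<open>G\<close>.\<close>
  have quad: "(\<Sum>i\<in>G. \<Sum>j\<in>G. a (c i) (c j)) \<le> (\<Sum>i\<in>G. A * n G (c i))"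
  proof -
    have GI: "G \<subseteq> F \<union> Y" using GR by auto
    have "(\<Sum>i\<in>G. \<Sum>j\<in>G. a (c i) (c j)) = (\<Sum>q\<in>K. n G q * (\<Sum>p\<in>K. n G p * a q p))"
      by (simp add: sum_cells[OF GI, of "\<lambda>p. a _ p"] sum_cells[OF GI, of "\<lambda>q. \<Sum>p\<in>K. n G p * a q p"])
    also have "\<dots> = (\<Sum>q\<in>K. \<Sum>p\<in>K. n G q * n G p * a q p)"
      by (simp add: sum_distrib_left mult.assoc)
    also have "\<dots> \<le> (\<Sum>q\<in>K. \<Sum>p\<in>K. (n G q * n G q * a q p) / 2 + (n G p * n G p * a p q) / 2)"
    proof (intro sum_mono)
      fix q p
      have "0 \<le> (n G q - n G p)\<^sup>2 * a q p" using a0 by simp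
      then show "n G q * n G p * a q p \<le> (n G q * n G q * a q p) / 2 + (n G p * n G p * a p q) / 2"
        using asym[of p q] by (simp add: algebra_simps power2_eq_square)
    qed
    also have "\<dots> = (\<Sum>q\<in>K. \<Sum>p\<in>K. (n G q * n G q * a q p) / 2)
        + (\<Sum>q\<in>K. \<Sum>p\<in>K. (n G p * n G p * a p q) / 2)"
      by (simp add: sum.distrib)
    also have "(\<Sum>q\<in>K. \<Sum>p\<in>K. (n G p * n G p * a p q) / 2) = (\<Sum>q\<in>K. \<Sum>p\<in>K. (n G q * n G q * a q p) / 2)"
      by (rule sum.swap)
    also have "(\<Sum>q\<in>K. \<Sum>p\<in>K. (n G q * n G q * a q p) / 2) + (\<Sum>q\<in>K. \<Sum>p\<in>K. (n G q * n G q * a q p) / 2)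
        = (\<Sum>q\<in>K. n G q * n G q * (\<Sum>p\<in>K. a q p))"
      by (simp add: sum_distrib_left sum.distrib[symmetric] mult_ac)
    also have "\<dots> \<le> (\<Sum>q\<in>K. n G q * n G q * A)"
      by (intro sum_mono mult_left_mono sumA) auto
    also have "\<dots> = (\<Sum>i\<in>G. A * n G (c i))"
      by (simp add: sum_cells[OF GI, of "\<lambda>q. A * n G q"] algebra_simps)
    finally show ?thesis .
  qed
  \<comment> \<open>Subtracting \<open>a\<close> also for the cell mates of \<open>i\<close> and for
    \<open>i\<close> itself weakens the bound, but produces exactly the double sum estimated in
    \<open>quad\<close>.\<close>
  have self: "16 * A * (n G (c i) - 1) - (\<Sum>j\<in>G. a (c i) (c j)) \<le> (\<Sum>j\<in>G - {i}. u i j)" if i: "i \<in> G" for i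
  proof -
    have "n G (c i) - 1 = real (card {j\<in>G - {i}. c j = c i})"
    proof -
      have "{j\<in>G. c j = c i} = insert i {j\<in>G - {i}. c j = c i}" using i by auto
      then have "card {j\<in>G. c j = c i} = Suc (card {j\<in>G - {i}. c j = c i})"
        using finS by simp
      then show ?thesis by (simp add: n_def)
    qed
    also have "\<dots> = (\<Sum>j\<in>G - {i}. if c j = c i then 1 else 0)"
      using finS by (simp add: sum.If_cases Int_def)
    finally have e: "n G (c i) - 1 = (\<Sum>j\<in>G - {i}. if c j = c i then 1 else 0)" .
    have "16 * A * (n G (c i) - 1) = (\<Sum>j\<in>G - {i}. if c j = c i then 16 * A else 0)"
      unfolding e sum_distrib_left by (intro sum.cong) auto
    then have "16 * A * (n G (c i) - 1) - (\<Sum>j\<in>G - {i}. a (c i) (c j)) =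
        (\<Sum>j\<in>G - {i}. (if c j = c i then 16 * A else 0) - a (c i) (c j))"
      by (simp add: sum_subtractf)
    also have "\<dots> \<le> (\<Sum>j\<in>G - {i}. u i j)"
    proof (intro sum_mono)
      fix j assume "j \<in> G - {i}"
      then show "(if c j = c i then 16 * A else 0) - a (c i) (c j) \<le> u i j"
        using u1[of i j] u2[of i j] i GR a0[of "c i" "c j"] by (auto split: if_splits)
    qed
    finally show ?thesis
      using i finS a0[of "c i" "c i"] by (simp add: sum.remove[of G i])
  qed
  have split: "(\<Sum>(i, j)\<in>pairs (F \<union> Y). u i j) =
      (\<Sum>(i, j)\<in>pairs G. u i j) + (\<Sum>(i, j)\<in>pairs R. u i j) + (\<Sum>i\<in>G. \<Sum>j\<in>R. u i j)"
    unfolding GR(1) using finS GR(2) usym by (intro sum_pairs_union) auto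
  have UG: "(\<Sum>i\<in>G. 8 * A * (n G (c i) - 1) - A * n G (c i) / 2) \<le> (\<Sum>(i, j)\<in>pairs G. u i j)"
  proof -
    have "(\<Sum>i\<in>G. 16 * A * (n G (c i) - 1)) - (\<Sum>i\<in>G. A * n G (c i))
        \<le> (\<Sum>i\<in>G. 16 * A * (n G (c i) - 1) - (\<Sum>j\<in>G. a (c i) (c j)))"
      using quad by (simp add: sum_subtractf)
    also have "\<dots> \<le> (\<Sum>i\<in>G. \<Sum>j\<in>G - {i}. u i j)"
      by (intro sum_mono self)
    also have "\<dots> = 2 * (\<Sum>(i, j)\<in>pairs G. u i j)"
      using sum_offdiag_eq_pairs[OF finS(2), of u] usym by simp
    also have "(\<Sum>i\<in>G. 16 * A * (n G (c i) - 1)) - (\<Sum>i\<in>G. A * n G (c i)) =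
        2 * (\<Sum>i\<in>G. 8 * A * (n G (c i) - 1) - A * n G (c i) / 2)"
      by (simp add: sum_subtractf[symmetric] sum_distrib_left algebra_simps)
    finally show ?thesis by simp
  qed
  have UGR: "(\<Sum>i\<in>G. - (4 * A * w (c i))) \<le> (\<Sum>i\<in>G. \<Sum>j\<in>R. u i j)"
  proof (rule sum_mono)
    fix i assume i: "i \<in> G"
    have "- (\<Sum>j\<in>R. a (c i) (c j)) \<le> (\<Sum>j\<in>R. u i j)"
      unfolding sum_negf[symmetric] using i GR by (intro sum_mono u1) auto
    moreover have "(\<Sum>j\<in>R. a (c i) (c j)) \<le> 4 * A * w (c i)"
      by (rule cross) (use i GR cK in auto)
    ultimately show "- (4 * A * w (c i)) \<le> (\<Sum>j\<in>R. u i j)" by linarith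
  qed
  \<comment> \<open>The pull of the ghost on the particles left in place is at most
    \<open>4 * A * w q0 = 4 * A\<close>, paid for by the \<open>+ 1\<close> in
    \<open>6 * A * (real (card F) + 1)\<close>; its pull on one particle of \<open>G\<close> is a
    single term of a row sum.\<close>
  have ghost: "(\<Sum>i\<in>F \<union> Y. a q0 (c i)) \<le> (\<Sum>i\<in>G. A) + 4 * A"
  proof -
    have "(\<Sum>i\<in>F \<union> Y. a q0 (c i)) = (\<Sum>i\<in>G. a q0 (c i)) + (\<Sum>i\<in>R. a q0 (c i))"
      unfolding GR(1) using finS GR(2) by (simp add: sum.union_disjoint)
    moreover have "(\<Sum>i\<in>R. a q0 (c i)) \<le> 4 * A" using cross[OF q0] wq0 by simp
    moreover have "(\<Sum>i\<in>G. a q0 (c i)) \<le> (\<Sum>i\<in>G. A)"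
    proof (rule sum_mono)
      fix i assume "i \<in> G"
      then have "a q0 (c i) \<le> (\<Sum>p\<in>K. a q0 p)"
        using a0 fin cK GR by (intro member_le_sum) auto
      then show "a q0 (c i) \<le> A" using sumA[OF q0] by simp
    qed
    ultimately show ?thesis by linarith
  qed
  \<comment> \<open>This fixes the constants 4, 16 and 6. In units of \<open>A\<close>, with
    occupation \<open>k\<close> and weight \<open>v\<close>, the right side is
    \<open>7.5 * k - 4 * v - 9\<close>. For a removed particle \<open>k > 4 * v\<close> and
    \<open>v \<ge> 1\<close> make it exceed \<open>26 * v - 9 \<ge> 16 * v\<close>; for a fixed one
    \<open>k \<ge> 1\<close> and \<open>v = 1\<close> leave at least \<open>- 5.5\<close>.\<close>
  have per: "(if i \<in> S then 16 * A * w (c i) else - 6 * A) \<le>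
      8 * A * (n G (c i) - 1) - A * n G (c i) / 2 - 4 * A * w (c i) - A" if i: "i \<in> G" for i
  proof -
    define k where "k = n G (c i)"
    define v where "v = w (c i)"
    have v1: "1 \<le> v" using w1 cK i GR by (auto simp: v_def)
    have "card {i} \<le> card {j\<in>G. c j = c i}" by (rule card_mono) (use i finS in auto)
    then have k1: "1 \<le> k" by (simp add: k_def n_def)
    show ?thesis
    proof (cases "i \<in> S")
      case True
      have "{j\<in>F \<union> Y. c j = c i} = {j\<in>G. c j = c i}"
        using True by (auto simp: G_def S_def)
      then have "n (F \<union> Y) (c i) = k" unfolding k_def n_def by (rule arg_cong)
      then have "4 * v < k" using True by (auto simp: S_def v_def)
      then have "0 \<le> 8 * (k - 1) - k / 2 - 4 * v - 1 - 16 * v"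
        using v1 by (simp add: field_simps)
      then have "0 \<le> A * (8 * (k - 1) - k / 2 - 4 * v - 1 - 16 * v)" using A0 by simp
      then show ?thesis using True by (simp add: k_def[symmetric] v_def[symmetric] algebra_simps)
    next
      case False
      then have "i \<in> F" using i by (simp add: G_def)
      then have "v = 1" using wF by (simp add: v_def)
      then have "0 \<le> 8 * (k - 1) - k / 2 - 4 * v - 1 + 6"
        using k1 by (simp add: field_simps)
      then have "0 \<le> A * (8 * (k - 1) - k / 2 - 4 * v - 1 + 6)" using A0 by simp
      then show ?thesis using False by (simp add: k_def[symmetric] v_def[symmetric] algebra_simps)
    qed
  qed
  have "(\<Sum>i\<in>G. if i \<in> S then 16 * A * w (c i) else - 6 * A) =
      16 * A * (\<Sum>i\<in>S. w (c i)) - 6 * A * real (card F)"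
  proof -
    have "F \<inter> S = {}" using SY disj by auto
    moreover have "(\<Sum>i\<in>F. if i \<in> S then 16 * A * w (c i) else - 6 * A) = (\<Sum>i\<in>F. - 6 * A)"
      using calculation by (intro sum.cong) auto
    ultimately show ?thesis
      unfolding G_def using fin finS by (simp add: sum.union_disjoint sum_distrib_left)
  qed
  moreover have "(\<Sum>i\<in>G. if i \<in> S then 16 * A * w (c i) else - 6 * A) \<le>
      (\<Sum>i\<in>G. 8 * A * (n G (c i) - 1) - A * n G (c i) / 2 - 4 * A * w (c i) - A)"
    by (intro sum_mono per)
  moreover have "\<dots> = (\<Sum>i\<in>G. 8 * A * (n G (c i) - 1) - A * n G (c i) / 2)
      + (\<Sum>i\<in>G. - (4 * A * w (c i))) - (\<Sum>i\<in>G. A)"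
    by (simp add: sum_subtractf sum_negf)
  ultimately have "16 * A * (\<Sum>i\<in>S. w (c i)) - 6 * A * (real (card F) + 1) + (\<Sum>(i, j)\<in>pairs R. u i j)
      \<le> (\<Sum>(i, j)\<in>pairs (F \<union> Y). u i j) - (\<Sum>i\<in>F \<union> Y. a q0 (c i))"
    using UG UGR ghost split A0 by (simp add: algebra_simps)
  then show ?thesis using SY unfolding R_def by (intro exI[of _ S]) (simp add: algebra_simps)
qed

section \<open>The gas in cells\<close>

lemma power_div_fact_le_exp:
  fixes x :: real
  assumes "0 \<le> x"
  shows "x ^ k / fact k \<le> exp x"
proof -
  have "(\<Sum>n\<in>{k}. x ^ n /\<^sub>R fact n) \<le> (\<Sum>n. x ^ n /\<^sub>R fact n)"
    using assms by (intro sum_le_suminf summable_exp_generic) auto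
  then show ?thesis by (simp add: exp_def field_simps)
qed

text \<open>Converts the energy gained by removing a particle of weight \<open>z powr \<eta>\<close>
  into a power that is summable over cells. For a natural number \<open>k\<close> at least
  \<open>(1 + \<eta>) / \<eta>\<close>, the term of order \<open>k\<close> of the exponential series
  already suffices.\<close>

lemma exp_neg_powr_bound:
  fixes b \<eta> :: real
  assumes "b > 0" "\<eta> > 0"
  obtains C where "C > 0" "\<And>z. 1 \<le> z \<Longrightarrow> exp (- b * z powr \<eta>) \<le> C * z powr (- 1 - \<eta>)"
proof -
  obtain k :: nat where k: "(1 + \<eta>) / \<eta> \<le> real k" using real_arch_simple by blast
  show thesis
  proof (rule that[of "fact k / b ^ k"])
    show "fact k / b ^ k > 0" using assms by simp
    fix z :: real assume z: "1 \<le> z"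
    have "(1 + \<eta>) \<le> \<eta> * real k" using k assms by (simp add: field_simps)
    then have "z powr (1 + \<eta>) \<le> z powr (\<eta> * real k)" using z by (simp add: powr_mono)
    also have "\<dots> = (z powr \<eta>) ^ k" using z by (simp add: powr_powr[symmetric] powr_realpow)
    finally have "b ^ k * z powr (1 + \<eta>) \<le> (b * z powr \<eta>) ^ k"
      using assms by (simp add: power_mult_distrib)
    also have "\<dots> \<le> fact k * exp (b * z powr \<eta>)"
    proof -
      have "(b * z powr \<eta>) ^ k / fact k \<le> exp (b * z powr \<eta>)"
        using assms by (intro power_div_fact_le_exp) simp
      then show ?thesis by (simp add: field_simps)
    qed
    finally have *: "b ^ k * z powr (1 + \<eta>) \<le> fact k * exp (b * z powr \<eta>)" .
    define X E where "X = z powr (1 + \<eta>)" and "E = exp (b * z powr \<eta>)"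
    have "z powr (- 1 - \<eta>) = 1 / X"
      unfolding X_def by (simp add: powr_minus_divide[symmetric])
    moreover have "exp (- b * z powr \<eta>) = 1 / E" by (simp add: E_def exp_minus field_simps)
    moreover have "1 / E \<le> fact k / b ^ k * (1 / X)"
    proof -
      have "0 < X" "0 < E" "b ^ k * X \<le> fact k * E"
        using * z by (auto simp: X_def E_def)
      then show ?thesis using assms by (simp add: field_simps)
    qed
    ultimately show "exp (- b * z powr \<eta>) \<le> fact k / b ^ k * z powr (- 1 - \<eta>)"
      by simp
  qed
qed

text \<open>\<open>f\<close> is the Boltzmann factor of a pair of particles, and \<open>P\<close> plays the role of
  \<open>1 + distance\<close> between cells (a submultiplicative quantity). \<open>B\<close> controls the attraction and
  \<open>B2\<close> the repulsion away from adjacent cells; \<open>f_same\<close> makes the repulsion inside a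
  cell dominate the attraction \<open>B * \<sigma>\<close> of a whole configuration with one particle per cell.\<close>

locale cell_gas = sigma_finite_measure M for M :: "'a measure" +
  fixes \<Lambda> :: "'a set" and cell :: "'a \<Rightarrow> 'c" and K :: "'c set" and P :: "'c \<Rightarrow> 'c \<Rightarrow> real"
    and near :: "'c \<Rightarrow> 'c \<Rightarrow> bool" and f :: "'a \<Rightarrow> 'a \<Rightarrow> real"
    and \<eta> \<sigma> v B B2 \<rho> C\<^sub>0 :: real
  assumes finK: "finite K" and \<Lambda>_sets [measurable]: "\<Lambda> \<in> sets M"
    and cell_in: "\<And>x. x \<in> \<Lambda> \<Longrightarrow> cell x \<in> K"
    and cell_sets: "\<And>q. q \<in> K \<Longrightarrow> {x\<in>\<Lambda>. cell x = q} \<in> sets M"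
    and cell_vol: "\<And>q. q \<in> K \<Longrightarrow> emeasure M {x\<in>\<Lambda>. cell x = q} = ennreal v"
    and v_pos: "0 < v" and v_le: "v \<le> 1"
    and pos: "0 < \<eta>" "0 < \<sigma>" "0 < B" "0 \<le> B2" "0 < \<rho>" "0 \<le> C\<^sub>0"
    and P_ge1: "\<And>p q. 1 \<le> P p q" and P_self: "\<And>q. P q q = 1" and P_sym: "\<And>p q. P p q = P q p"
    and P_tri: "\<And>p q r. p \<in> K \<Longrightarrow> q \<in> K \<Longrightarrow> r \<in> K \<Longrightarrow> P p r \<le> P p q * P q r"
    and P_sum: "\<And>q. q \<in> K \<Longrightarrow> (\<Sum>p\<in>K. P q p powr (- 1 - \<eta>)) \<le> \<sigma>"
    and f_meas: "(\<lambda>(x, y). f x y) \<in> borel_measurable (M \<Otimes>\<^sub>M M)"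
    and f_nonneg: "\<And>x y. 0 \<le> f x y" and f_sym: "\<And>x y. f x y = f y x"
    and f_upper: "\<And>x y. x \<in> \<Lambda> \<Longrightarrow> y \<in> \<Lambda> \<Longrightarrow>
      f x y \<le> exp (B * P (cell x) (cell y) powr (- 1 - 2 * \<eta>))"
    and f_same: "\<And>x y. x \<in> \<Lambda> \<Longrightarrow> y \<in> \<Lambda> \<Longrightarrow> cell x = cell y \<Longrightarrow> f x y \<le> exp (- 16 * B * \<sigma>)"
    and f_lower: "\<And>x y. x \<in> \<Lambda> \<Longrightarrow> y \<in> \<Lambda> \<Longrightarrow> \<not> near (cell x) (cell y) \<Longrightarrow>
      exp (- B2 * P (cell x) (cell y) powr (- 1 - 2 * \<eta>)) \<le> f x y"
    and near_card: "\<And>p. p \<in> K \<Longrightarrow> real (card {q\<in>K. near q p}) \<le> C\<^sub>0"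
    and near_sparse: "4 * C\<^sub>0 * \<rho> * v \<le> 1"
begin

section \<open>Boltzmann factors, weights and the removal estimate\<close>

definition attr :: "'c \<Rightarrow> 'c \<Rightarrow> real" where
  "attr p q = B * P p q powr (- 1 - 2 * \<eta>)"

definition boltz :: "nat set \<Rightarrow> (nat \<Rightarrow> 'a) \<Rightarrow> real" where
  "boltz I x = (\<Prod>(i, j)\<in>pairs I. f (x i) (x j))"

text \<open>A product of indicators instead of the indicator of a product set: it splits along
  disjoint index sets and ignores values outside \<open>I\<close>.\<close>

definition in\<Lambda> :: "nat set \<Rightarrow> (nat \<Rightarrow> 'a) \<Rightarrow> ennreal" where
  "in\<Lambda> I x = (\<Prod>i\<in>I. indicator \<Lambda> (x i))"

text \<open>Indexed by label sets rather than particle numbers, so that particles can be removed and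
  reinserted under their own labels.\<close>

definition Zf :: "nat set \<Rightarrow> ennreal" where
  "Zf I = (\<integral>\<^sup>+x. in\<Lambda> I x * ennreal (boltz I x) \<partial>Pi\<^sub>M I (\<lambda>_. M))"

text \<open>The weight w of the overview: \<open>P\<close> to the nearest cell of \<open>X\<close>,
  raised to the power \<open>\<eta>\<close>. \<open>X\<close> will consist of the cells of the fixed
  particles and of the ghost.\<close>

definition weight :: "'c set \<Rightarrow> 'c \<Rightarrow> real" where
  "weight X q = Min ((\<lambda>p. P q p powr \<eta>) ` X)"

definition vol :: real where "vol = v * real (card K)"

lemma boltz_nonneg: "0 \<le> boltz I x"
  unfolding boltz_def by (intro prod_nonneg) (auto simp: f_nonneg)

lemma boltz_insert:
  assumes "finite I" "k \<notin> I"
  shows "boltz (insert k I) x = boltz I x * (\<Prod>i\<in>I. f (x k) (x i))"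
  unfolding boltz_def
  by (rule prod_pairs_insert[where g="\<lambda>i j. f (x i) (x j)"]) (use assms f_sym in auto)

lemma boltz_cong: "(\<And>i. i \<in> I \<Longrightarrow> x i = y i) \<Longrightarrow> boltz I x = boltz I y"
  unfolding boltz_def by (intro prod.cong) (auto simp: pairs_def)

lemma in\<Lambda>_eq: "finite I \<Longrightarrow> in\<Lambda> I x = (if \<forall>i\<in>I. x i \<in> \<Lambda> then 1 else 0)"
  unfolding in\<Lambda>_def by (induction I rule: finite_induct) (auto simp: indicator_def)

lemma boltz_measurable [measurable]: "boltz I \<in> borel_measurable (Pi\<^sub>M I (\<lambda>_. M))"
  unfolding boltz_def
proof (intro borel_measurable_prod)
  fix p assume "p \<in> pairs I"
  then obtain i j where [simp]: "p = (i, j)" and [measurable]: "i \<in> I" "j \<in> I"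
    by (auto simp: pairs_def)
  have "(\<lambda>x. (x i, x j)) \<in> Pi\<^sub>M I (\<lambda>_. M) \<rightarrow>\<^sub>M M \<Otimes>\<^sub>M M" by measurable
  from measurable_compose[OF this f_meas]
  show "(\<lambda>x. case p of (i, j) \<Rightarrow> f (x i) (x j)) \<in> borel_measurable (Pi\<^sub>M I (\<lambda>_. M))"
    by simp
qed

lemma in\<Lambda>_measurable [measurable]: "in\<Lambda> I \<in> borel_measurable (Pi\<^sub>M I (\<lambda>_. M))"
  unfolding in\<Lambda>_def by measurable

lemma nn_integral_cells:
  fixes h :: "'c \<Rightarrow> ennreal"
  shows "(\<integral>\<^sup>+y. indicator \<Lambda> y * h (cell y) \<partial>M) = (\<Sum>q\<in>K. h q * ennreal v)"
proof -
  have "indicator \<Lambda> y * h (cell y) = (\<Sum>q\<in>K. h q * indicator {x\<in>\<Lambda>. cell x = q} y)" for y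
  proof (cases "y \<in> \<Lambda>")
    case True
    then have "(\<Sum>q\<in>K. h q * indicator {x\<in>\<Lambda>. cell x = q} y) = (\<Sum>q\<in>K. if cell y = q then h q else 0)"
      by (intro sum.cong) (auto simp: indicator_def)
    then show ?thesis using True cell_in[OF True] finK by simp
  qed simp
  then have "(\<integral>\<^sup>+y. indicator \<Lambda> y * h (cell y) \<partial>M) =
      (\<integral>\<^sup>+y. (\<Sum>q\<in>K. h q * indicator {x\<in>\<Lambda>. cell x = q} y) \<partial>M)" by simp
  also have "\<dots> = (\<Sum>q\<in>K. \<integral>\<^sup>+y. h q * indicator {x\<in>\<Lambda>. cell x = q} y \<partial>M)"
    using cell_sets by (intro nn_integral_sum) auto
  also have "\<dots> = (\<Sum>q\<in>K. h q * ennreal v)"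
    using cell_sets cell_vol by (intro sum.cong) (auto simp: nn_integral_cmult_indicator)
  finally show ?thesis .
qed

lemma P_powr_mono: "P p q powr (- 1 - 2 * \<eta>) \<le> P p q powr (- 1 - \<eta>)"
  using P_ge1[of p q] pos by (intro powr_mono) auto

lemma attr_nonneg: "0 \<le> attr p q"
  using pos by (simp add: attr_def)

lemma sum_attr_le: "q \<in> K \<Longrightarrow> (\<Sum>p\<in>K. attr q p) \<le> B * \<sigma>"
  unfolding attr_def sum_distrib_left[symmetric]
  using pos order_trans[OF sum_mono[OF P_powr_mono] P_sum] by (intro mult_left_mono) auto

text \<open>Submultiplicativity of \<open>P\<close> passes to the minimum: the cell of
  \<open>X\<close> nearest to \<open>p\<close> serves as a competitor for \<open>q\<close>.\<close>

lemma weight_props: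
  assumes X: "finite X" "X \<noteq> {}" "X \<subseteq> K"
  shows "1 \<le> weight X q" and "q \<in> X \<Longrightarrow> weight X q = 1"
    and "p \<in> K \<Longrightarrow> q \<in> K \<Longrightarrow> weight X q \<le> P p q powr \<eta> * weight X p"
    and "\<exists>p\<in>X. weight X q = P q p powr \<eta>"
proof -
  show ge: "1 \<le> weight X q" for q
    unfolding weight_def using X P_ge1 pos by (auto simp: ge_one_powr_ge_zero)
  show ex: "\<exists>p\<in>X. weight X q = P q p powr \<eta>" for q
  proof -
    have "weight X q \<in> (\<lambda>p. P q p powr \<eta>) ` X"
      unfolding weight_def using X by (intro Min_in) auto
    then show ?thesis by auto
  qed
  have le: "weight X q \<le> P q r powr \<eta>" if "r \<in> X" for q r
    unfolding weight_def using X that by (intro Min_le) auto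
  show "weight X q = 1" if "q \<in> X"
    using le[OF that, of q] ge[of q] P_self by simp
  show "weight X q \<le> P p q powr \<eta> * weight X p" if "p \<in> K" "q \<in> K"
  proof -
    obtain r where r: "r \<in> X" "weight X p = P p r powr \<eta>" using ex by blast
    have "P q r \<le> P q p * P p r" using P_tri that r X by blast
    then have "P q r powr \<eta> \<le> (P q p * P p r) powr \<eta>"
      using pos P_ge1[of q r] by (intro powr_mono2) auto
    also have "\<dots> = P p q powr \<eta> * weight X p"
      using P_ge1[of q p] P_ge1[of p r] r by (simp add: powr_mult P_sym[of q p])
    finally show ?thesis using le[OF r(1), of q] by linarith
  qed
qed

text \<open>Comparing the weights of \<open>p\<close> and \<open>q\<close> costs one factor
  \<open>P q p powr \<eta>\<close>, and the remaining exponent \<open>- 1 - \<eta>\<close> is the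
  one controlled by \<open>P_sum\<close>. This is why attraction is assumed to decay with the extra
  \<open>2 * \<eta>\<close>.\<close>

lemma sum_attr_weight_le:
  assumes X: "finite X" "X \<noteq> {}" "X \<subseteq> K" and q: "q \<in> K"
  shows "(\<Sum>p\<in>K. attr q p * weight X p) \<le> B * \<sigma> * weight X q"
proof -
  have "(\<Sum>p\<in>K. attr q p * weight X p) \<le> (\<Sum>p\<in>K. B * weight X q * P q p powr (- 1 - \<eta>))"
  proof (rule sum_mono)
    fix p assume p: "p \<in> K"
    have "attr q p * weight X p \<le> attr q p * (P q p powr \<eta> * weight X q)"
      using weight_props(3)[OF X q p] attr_nonneg by (intro mult_left_mono) auto
    also have "\<dots> = B * weight X q * (P q p powr (- 1 - 2 * \<eta>) * P q p powr \<eta>)"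
      by (simp add: attr_def)
    also have "P q p powr (- 1 - 2 * \<eta>) * P q p powr \<eta> = P q p powr (- 1 - \<eta>)"
      unfolding powr_add[symmetric] by (rule arg_cong) simp
    finally show "attr q p * weight X p \<le> B * weight X q * P q p powr (- 1 - \<eta>)" .
  qed
  also have "\<dots> = B * weight X q * (\<Sum>p\<in>K. P q p powr (- 1 - \<eta>))"
    by (simp add: sum_distrib_left)
  also have "\<dots> \<le> B * weight X q * \<sigma>"
    using P_sum[OF q] pos weight_props(1)[OF X, of q] by (intro mult_left_mono) auto
  finally show ?thesis by (simp add: ac_simps)
qed

text \<open>The set \<open>S\<close> of removed particles depends on the configuration, so it is summed over.\<close>

lemma boltz_removal:
  assumes fin: "finite F" "finite Y" and disj: "F \<inter> Y = {}"
    and x: "\<And>i. i \<in> F \<union> Y \<Longrightarrow> x i \<in> \<Lambda>" and q0: "q0 \<in> K"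
  defines "X \<equiv> insert q0 ((\<lambda>i. cell (x i)) ` F)"
  shows "boltz (F \<union> Y) x * exp (\<Sum>i\<in>F \<union> Y. attr q0 (cell (x i))) \<le>
    exp (6 * (B * \<sigma>) * (real (card F) + 1)) *
      (\<Sum>S\<in>Pow Y. (\<Prod>i\<in>S. exp (- (16 * (B * \<sigma>)) * weight X (cell (x i)))) * boltz (Y - S) x)"
    (is "?L \<le> ?E * (\<Sum>S\<in>Pow Y. ?T S)")
\<comment> \<open>If a pair factor vanishes, the left side is 0. Otherwise all pair factors of
  distinct particles are positive, and their negative logarithms are genuine pair energies.\<close>
proof (cases "boltz (F \<union> Y) x = 0")
  case True
  have "0 \<le> ?E * (\<Sum>S\<in>Pow Y. ?T S)"
    by (intro mult_nonneg_nonneg sum_nonneg prod_nonneg) (auto simp: boltz_nonneg)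
  then show ?thesis using True by simp
next
  case False
  have X: "finite X" "X \<noteq> {}" "X \<subseteq> K" "q0 \<in> X" "\<And>i. i \<in> F \<Longrightarrow> cell (x i) \<in> X"
    using fin q0 x cell_in by (auto simp: X_def)
  define u where "u i j = - ln (f (x i) (x j))" for i j
  have finp: "finite (pairs (F \<union> Y))" using fin by simp
  have fpos: "0 < f (x i) (x j)" if "i \<in> F \<union> Y" "j \<in> F \<union> Y" "i \<noteq> j" for i j
  proof -
    have *: "f (x i) (x j) \<noteq> 0" if "(i, j) \<in> pairs (F \<union> Y)" for i j
      using False that finp unfolding boltz_def by auto
    have "f (x i) (x j) \<noteq> 0"
    proof (cases "i < j")
      case True then show ?thesis using * that by (auto simp: pairs_def)
    next
      case False
      then have "(j, i) \<in> pairs (F \<union> Y)" using that by (auto simp: pairs_def)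
      then show ?thesis using *[of j i] f_sym[of "x i" "x j"] by simp
    qed
    then show ?thesis using f_nonneg[of "x i" "x j"] by simp
  qed
  have exp_u: "boltz I x = exp (- (\<Sum>(i, j)\<in>pairs I. u i j))" if "I \<subseteq> F \<union> Y" for I
  proof -
    have "finite I" using that fin finite_subset by blast
    then have "exp (- (\<Sum>(i, j)\<in>pairs I. u i j)) = (\<Prod>(i, j)\<in>pairs I. exp (- u i j))"
      by (simp add: sum_negf[symmetric] exp_sum case_prod_unfold)
    also have "\<dots> = boltz I x"
      unfolding boltz_def using that
      by (intro prod.cong) (auto simp: u_def pairs_def intro!: exp_ln fpos)
    finally show ?thesis by simp
  qed
  have "\<exists>S\<subseteq>Y. (\<Sum>(i, j)\<in>pairs (Y - S). u i j) + 16 * (B * \<sigma>) * (\<Sum>i\<in>S. weight X (cell (x i)))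
      - 6 * (B * \<sigma>) * (real (card F) + 1)
    \<le> (\<Sum>(i, j)\<in>pairs (F \<union> Y). u i j) - (\<Sum>i\<in>F \<union> Y. attr q0 (cell (x i)))"
  proof (rule crowded_cells_removal[where K=K and c="\<lambda>i. cell (x i)"])
    show "- attr (cell (x i)) (cell (x j)) \<le> u i j" if "i \<in> F \<union> Y" "j \<in> F \<union> Y" "i \<noteq> j" for i j
    proof -
      have "ln (f (x i) (x j)) \<le> ln (exp (attr (cell (x i)) (cell (x j))))"
        using f_upper[of "x i" "x j"] x that fpos[OF that] unfolding attr_def
        by (subst ln_le_cancel_iff) auto
      then show ?thesis by (simp add: u_def)
    qed
    show "16 * (B * \<sigma>) \<le> u i j"
      if "i \<in> F \<union> Y" "j \<in> F \<union> Y" "i \<noteq> j" "cell (x i) = cell (x j)" for i j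
    proof -
      have "ln (f (x i) (x j)) \<le> ln (exp (- 16 * B * \<sigma>))"
        using f_same[of "x i" "x j"] x that fpos[OF that(1-3)]
        by (subst ln_le_cancel_iff) auto
      then show ?thesis by (simp add: u_def)
    qed
    show "cell (x i) \<in> K" if "i \<in> F \<union> Y" for i using x cell_in that by blast
    show "attr p q = attr q p" for p q by (simp add: attr_def P_sym[of p q])
    show "u i j = u j i" for i j by (simp add: u_def f_sym[of "x i" "x j"])
  qed (rule finK fin disj q0 attr_nonneg sum_attr_le sum_attr_weight_le[OF X(1-3)]
      weight_props(1,2)[OF X(1-3)] X(4,5) | assumption)+
  then obtain S where S: "S \<subseteq> Y" and le: "(\<Sum>(i, j)\<in>pairs (Y - S). u i j)
      + 16 * (B * \<sigma>) * (\<Sum>i\<in>S. weight X (cell (x i))) - 6 * (B * \<sigma>) * (real (card F) + 1)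
    \<le> (\<Sum>(i, j)\<in>pairs (F \<union> Y). u i j) - (\<Sum>i\<in>F \<union> Y. attr q0 (cell (x i)))"
    by blast
  have finS: "finite S" using S fin finite_subset by blast
  have "?L = exp (- ((\<Sum>(i, j)\<in>pairs (F \<union> Y). u i j) - (\<Sum>i\<in>F \<union> Y. attr q0 (cell (x i)))))"
    by (simp add: exp_u exp_add[symmetric] del: exp_add)
  also have "\<dots> \<le> exp (- ((\<Sum>(i, j)\<in>pairs (Y - S). u i j)
      + 16 * (B * \<sigma>) * (\<Sum>i\<in>S. weight X (cell (x i))) - 6 * (B * \<sigma>) * (real (card F) + 1)))"
    using le by simp
  also have "\<dots> = exp (6 * (B * \<sigma>) * (real (card F) + 1)
      + (- (16 * (B * \<sigma>)) * (\<Sum>i\<in>S. weight X (cell (x i)))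
      + - (\<Sum>(i, j)\<in>pairs (Y - S). u i j)))"
    by (rule arg_cong[where f=exp]) (simp add: algebra_simps)
  also have "\<dots> = ?E * ?T S"
  proof -
    have "boltz (Y - S) x = exp (- (\<Sum>(i, j)\<in>pairs (Y - S). u i j))"
      by (rule exp_u) auto
    then show ?thesis unfolding exp_add
      using finS by (simp add: exp_sum[symmetric] sum_distrib_left del: exp_add)
  qed
  also have "\<dots> \<le> ?E * (\<Sum>S\<in>Pow Y. ?T S)"
    using S fin by (intro mult_left_mono member_le_sum)
      (auto intro!: mult_nonneg_nonneg prod_nonneg boltz_nonneg)
  finally show ?thesis .
qed

end

section \<open>Inserting particles at bounded cost\<close>

context cell_gas
begin

text \<open>The fraction of the volume gained per inserted particle: \<open>1 / 2\<close> is the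
  share of usable cells, and \<open>4 * \<sigma> * \<rho>\<close> is four times a bound on the mean
  of the potential over all cells.\<close>

definition ins :: real where "ins = exp (- 4 * B2 * \<sigma> * \<rho>) / 2"

lemma ins_pos: "0 < ins" by (simp add: ins_def)

text \<open>In at least half of the cells a further particle feels only a bounded potential:
  few cells are adjacent to a particle, and the sum over all cells of the potential felt there
  is of the order of the number of particles.\<close>

lemma insertion_integral:
  assumes I: "finite I" and x: "\<And>i. i \<in> I \<Longrightarrow> x i \<in> \<Lambda>" and card: "real (card I) \<le> \<rho> * vol"
  shows "ennreal (ins * vol) \<le> (\<integral>\<^sup>+y. indicator \<Lambda> y * ennreal (\<Prod>i\<in>I. f y (x i)) \<partial>M)"
proof -
  define T where "T = 4 * \<rho> * \<sigma>"
  define V where "V q = (\<Sum>i\<in>I. P q (cell (x i)) powr (- 1 - 2 * \<eta>))" for q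
  define Bad1 where "Bad1 = (\<Union>i\<in>I. {q\<in>K. near q (cell (x i))})"
  define Bad2 where "Bad2 = {q\<in>K. T < V q}"
  define Good where "Good = K - (Bad1 \<union> Bad2)"
  have fin: "finite Bad1" "finite Bad2" "finite Good"
    using I finK by (auto simp: Bad1_def Bad2_def Good_def)
  have T0: "0 < T" using pos by (simp add: T_def)
  have V0: "0 \<le> V q" for q unfolding V_def by (intro sum_nonneg) auto
  have "real (card Bad1) \<le> (\<Sum>i\<in>I. real (card {q\<in>K. near q (cell (x i))}))"
    unfolding Bad1_def of_nat_sum[symmetric] of_nat_le_iff using I by (rule card_UN_le)
  also have "\<dots> \<le> (\<Sum>i\<in>I. C\<^sub>0)" by (intro sum_mono near_card cell_in x)
  also have "\<dots> \<le> \<rho> * vol * C\<^sub>0" using card pos by (simp add: mult_right_mono)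
  also have "\<dots> \<le> real (card K) / 4"
    using mult_right_mono[OF near_sparse, of "real (card K)"] by (simp add: vol_def algebra_simps)
  finally have b1: "real (card Bad1) \<le> real (card K) / 4" .
  \<comment> \<open>Markov's inequality: the sum of \<open>V\<close> over all cells is at most
    \<open>\<sigma>\<close> per particle, hence at most \<open>T * real (card K) / 4\<close> since
    \<open>vol \<le> real (card K)\<close>. At most a quarter of the cells can exceed
    \<open>T\<close>.\<close>
  have "T * real (card Bad2) \<le> (\<Sum>q\<in>Bad2. V q)"
    using sum_mono[of Bad2 "\<lambda>_. T" V] by (auto simp: Bad2_def mult.commute)
  also have "\<dots> \<le> (\<Sum>q\<in>K. V q)"
    using finK V0 by (intro sum_mono2) (auto simp: Bad2_def)
  also have "\<dots> = (\<Sum>i\<in>I. \<Sum>q\<in>K. P q (cell (x i)) powr (- 1 - 2 * \<eta>))"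
    unfolding V_def by (rule sum.swap)
  also have "\<dots> \<le> (\<Sum>i\<in>I. \<sigma>)"
  proof (rule sum_mono)
    fix i assume "i \<in> I"
    then have "(\<Sum>q\<in>K. P (cell (x i)) q powr (- 1 - \<eta>)) \<le> \<sigma>" by (intro P_sum cell_in x)
    moreover have "(\<Sum>q\<in>K. P (cell (x i)) q powr (- 1 - 2 * \<eta>)) \<le> (\<Sum>q\<in>K. P (cell (x i)) q powr (- 1 - \<eta>))"
      by (intro sum_mono P_powr_mono)
    ultimately show "(\<Sum>q\<in>K. P q (cell (x i)) powr (- 1 - 2 * \<eta>)) \<le> \<sigma>"
      by (simp add: P_sym[of _ "cell (x i)"])
  qed
  also have "\<dots> \<le> \<rho> * vol * \<sigma>" using card pos by (simp add: mult_right_mono)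
  also have "\<dots> \<le> \<rho> * (1 * real (card K)) * \<sigma>"
    unfolding vol_def using pos v_le by (intro mult_right_mono mult_left_mono) auto
  also have "\<dots> = T * (real (card K) / 4)" by (simp add: T_def)
  finally have b2: "real (card Bad2) \<le> real (card K) / 4" using T0 by simp
  have "card K \<le> card (Good \<union> (Bad1 \<union> Bad2))"
    using fin by (intro card_mono) (auto simp: Good_def)
  also have "\<dots> \<le> card Good + card (Bad1 \<union> Bad2)" by (rule card_Un_le)
  also have "\<dots> \<le> card Good + (card Bad1 + card Bad2)" by (simp add: card_Un_le)
  finally have good: "real (card K) / 2 \<le> real (card Good)" using b1 b2 by linarith
  have lower: "exp (- B2 * T) * indicator Good (cell y) \<le> (\<Prod>i\<in>I. f y (x i))" if y: "y \<in> \<Lambda>" for y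
  proof (cases "cell y \<in> Good")
    case True
    then have VT: "V (cell y) \<le> T" by (auto simp: Good_def Bad2_def)
    have "exp (- B2 * T) \<le> exp (- B2 * V (cell y))"
      using pos VT by (simp add: mult_left_mono)
    also have "\<dots> = (\<Prod>i\<in>I. exp (- B2 * P (cell y) (cell (x i)) powr (- 1 - 2 * \<eta>)))"
      unfolding V_def sum_distrib_left using I by (simp add: exp_sum)
    also have "\<dots> \<le> (\<Prod>i\<in>I. f y (x i))"
      using True y x by (intro prod_mono conjI f_lower) (auto simp: Good_def Bad1_def)
    finally show ?thesis using True by simp
  next
    case False
    then show ?thesis by (simp add: prod_nonneg f_nonneg)
  qed
  have "ins * vol \<le> real (card Good) * (exp (- B2 * T) * v)"
  proof -
    have "ins * vol = (real (card K) / 2) * (exp (- B2 * T) * v)"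
      by (simp add: ins_def vol_def T_def algebra_simps)
    also have "\<dots> \<le> real (card Good) * (exp (- B2 * T) * v)"
      using good v_pos by (intro mult_right_mono) auto
    finally show ?thesis .
  qed
  then have "ennreal (ins * vol) \<le> ennreal (\<Sum>q\<in>K. exp (- B2 * T) * indicator Good q * v)"
  proof (rule ennreal_leI[OF order_trans])
    have KG: "K \<inter> Good = Good" by (auto simp: Good_def)
    have "(\<Sum>q\<in>K. exp (- B2 * T) * indicator Good q * v) = (\<Sum>q\<in>K. if q \<in> Good then exp (- B2 * T) * v else 0)"
      by (intro sum.cong) auto
    also have "\<dots> = real (card Good) * (exp (- B2 * T) * v)"
      using finK KG by (simp add: sum.If_cases)
    finally show "real (card Good) * (exp (- B2 * T) * v) \<le>
      (\<Sum>q\<in>K. exp (- B2 * T) * indicator Good q * v)" by simp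
  qed
  also have "\<dots> = (\<Sum>q\<in>K. ennreal (exp (- B2 * T) * indicator Good q) * ennreal v)"
    using v_pos by (subst sum_ennreal[symmetric]) (auto simp: ennreal_mult')
  also have "\<dots> = (\<integral>\<^sup>+y. indicator \<Lambda> y * ennreal (exp (- B2 * T) * indicator Good (cell y)) \<partial>M)"
    by (rule nn_integral_cells[symmetric])
  also have "\<dots> \<le> (\<integral>\<^sup>+y. indicator \<Lambda> y * ennreal (\<Prod>i\<in>I. f y (x i)) \<partial>M)"
  proof (rule nn_integral_mono)
    fix y
    show "indicator \<Lambda> y * ennreal (exp (- B2 * T) * indicator Good (cell y)) \<le>
        indicator \<Lambda> y * ennreal (\<Prod>i\<in>I. f y (x i))"
    proof (cases "y \<in> \<Lambda>")
      case True
      then show ?thesis by (intro mult_left_mono ennreal_leI lower) auto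
    qed simp
  qed
  finally show ?thesis .
qed

lemma vol_pos: "q \<in> K \<Longrightarrow> 0 < vol"
  using v_pos finK by (auto simp: vol_def card_gt_0_iff intro!: mult_pos_pos)

lemma vol_nonneg: "0 \<le> vol" using v_pos by (simp add: vol_def)

lemma product_sigma_finite_M: "product_sigma_finite (\<lambda>_::nat. M)"
  by unfold_locales

text \<open>Tonelli in the new coordinate: the pair factors of the new particle split off, and their
  integral is at least \<open>ins * vol\<close> for every configuration of the others inside
  \<open>\<Lambda>\<close>.\<close>

lemma Zf_insert:
  assumes I: "finite I" "j \<notin> I" and card: "real (card I) \<le> \<rho> * vol"
  shows "ennreal (ins * vol) * Zf I \<le> Zf (insert j I)"
proof -
  interpret product_sigma_finite "\<lambda>_::nat. M" by (rule product_sigma_finite_M)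
  have "ennreal (ins * vol) * Zf I =
      (\<integral>\<^sup>+x. ennreal (ins * vol) * (in\<Lambda> I x * ennreal (boltz I x)) \<partial>Pi\<^sub>M I (\<lambda>_. M))"
    unfolding Zf_def by (rule nn_integral_cmult[symmetric]) measurable
  also have "\<dots> \<le> (\<integral>\<^sup>+x. (\<integral>\<^sup>+y. in\<Lambda> (insert j I) (x(j := y)) *
      ennreal (boltz (insert j I) (x(j := y))) \<partial>M) \<partial>Pi\<^sub>M I (\<lambda>_. M))"
  proof (rule nn_integral_mono)
    fix x assume x: "x \<in> space (Pi\<^sub>M I (\<lambda>_. M))"
    have upd: "in\<Lambda> (insert j I) (x(j := y)) * ennreal (boltz (insert j I) (x(j := y))) =
        in\<Lambda> I x * ennreal (boltz I x) * (indicator \<Lambda> y * ennreal (\<Prod>i\<in>I. f y (x i)))" for y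
    proof -
      have "boltz (insert j I) (x(j := y)) = boltz I x * (\<Prod>i\<in>I. f y (x i))"
        using I by (subst boltz_insert) (auto intro!: arg_cong2[where f="(*)"] boltz_cong prod.cong)
      moreover have "in\<Lambda> (insert j I) (x(j := y)) = indicator \<Lambda> y * in\<Lambda> I x"
        using I unfolding in\<Lambda>_def by (auto intro!: arg_cong2[where f="(*)"] prod.cong)
      ultimately show ?thesis
        by (simp add: ennreal_mult prod_nonneg boltz_nonneg f_nonneg ac_simps)
    qed
    show "ennreal (ins * vol) * (in\<Lambda> I x * ennreal (boltz I x)) \<le>
      (\<integral>\<^sup>+y. in\<Lambda> (insert j I) (x(j := y)) * ennreal (boltz (insert j I) (x(j := y))) \<partial>M)"
    proof (cases "\<forall>i\<in>I. x i \<in> \<Lambda>")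
      case True
      have [measurable]: "(\<lambda>y. f y (x i)) \<in> borel_measurable M" if "i \<in> I" for i
      proof -
        have "x i \<in> space M" using x that by (auto simp: space_PiM)
        then have "(\<lambda>y. (y, x i)) \<in> M \<rightarrow>\<^sub>M M \<Otimes>\<^sub>M M" by simp
        from measurable_compose[OF this f_meas] show ?thesis by simp
      qed
      have "in\<Lambda> I x * ennreal (boltz I x) * ennreal (ins * vol) \<le> in\<Lambda> I x * ennreal (boltz I x) *
          (\<integral>\<^sup>+y. indicator \<Lambda> y * ennreal (\<Prod>i\<in>I. f y (x i)) \<partial>M)"
        using True by (intro mult_left_mono insertion_integral I card) auto
      also have "\<dots> = (\<integral>\<^sup>+y. in\<Lambda> I x * ennreal (boltz I x) *
          (indicator \<Lambda> y * ennreal (\<Prod>i\<in>I. f y (x i))) \<partial>M)"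
        by (rule nn_integral_cmult[symmetric]) measurable
      finally show ?thesis by (simp add: upd ac_simps)
    next
      case False
      then have "in\<Lambda> I x = 0" using I by (simp add: in\<Lambda>_eq)
      then show ?thesis by simp
    qed
  qed
  also have "\<dots> = Zf (insert j I)"
    unfolding Zf_def using I by (intro product_nn_integral_insert[symmetric]) measurable
  finally show ?thesis .
qed

lemma Zf_union:
  assumes "finite J" "finite I" "I \<inter> J = {}" "real (card I + card J) \<le> \<rho> * vol"
  shows "ennreal ((ins * vol) ^ card J) * Zf I \<le> Zf (I \<union> J)"
  using assms
proof (induction J rule: finite_induct)
  case (insert j J)
  have c: "card (I \<union> J) = card I + card J" using insert by (intro card_Un_disjoint) auto
  have "ennreal ((ins * vol) ^ card (insert j J)) * Zf I =
      ennreal (ins * vol) * (ennreal ((ins * vol) ^ card J) * Zf I)"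
    using insert ins_pos vol_nonneg by (simp add: ennreal_mult ac_simps)
  also have "\<dots> \<le> ennreal (ins * vol) * Zf (I \<union> J)"
    using insert by (intro mult_left_mono insert.IH) auto
  also have "\<dots> \<le> Zf (insert j (I \<union> J))"
    using insert c by (intro Zf_insert) auto
  finally show ?case by simp
qed simp

lemma Zf_empty: "Zf {} = 1"
proof -
  have "Zf {} = (\<integral>\<^sup>+x. 1 \<partial>Pi\<^sub>M {} (\<lambda>_::nat. M))"
    unfolding Zf_def by (simp add: in\<Lambda>_def boltz_def)
  also have "\<dots> = 1" by (simp add: PiM_empty)
  finally show ?thesis .
qed

lemma boltz_measurable_superset:
  assumes "J \<subseteq> I"
  shows "boltz J \<in> borel_measurable (Pi\<^sub>M I (\<lambda>_. M))"
proof -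
  have "(\<lambda>y. boltz J (restrict y J)) \<in> borel_measurable (Pi\<^sub>M I (\<lambda>_. M))"
    by (rule measurable_compose[OF measurable_restrict_subset boltz_measurable]) (rule assms)
  moreover have "boltz J (restrict y J) = boltz J y" for y
    by (rule boltz_cong) auto
  ultimately show ?thesis by simp
qed

text \<open>After the removal estimate the particles of \<open>S\<close> interact neither with each
  other nor with the rest, so the integral factors into one-particle integrals and a smaller
  partition function.\<close>

lemma Zf_split:
  fixes g :: "'a \<Rightarrow> real"
  assumes Y: "finite Y" "S \<subseteq> Y" and g: "g \<in> borel_measurable M" "\<And>y. 0 \<le> g y"
  shows "(\<integral>\<^sup>+y. in\<Lambda> Y y * (ennreal (\<Prod>i\<in>S. g (y i)) * ennreal (boltz (Y - S) y)) \<partial>Pi\<^sub>M Y (\<lambda>_. M)) =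
    (\<integral>\<^sup>+y. indicator \<Lambda> y * ennreal (g y) \<partial>M) ^ card S * Zf (Y - S)"
proof -
  interpret product_sigma_finite "\<lambda>_::nat. M" by (rule product_sigma_finite_M)
  note g(1)[measurable]
  have finS: "finite S" using Y finite_subset by blast
  have YS: "Y = S \<union> (Y - S)" using Y by auto
  have [measurable]: "(\<lambda>y. boltz (Y - S) y) \<in> borel_measurable (Pi\<^sub>M Y (\<lambda>_. M))"
    by (rule boltz_measurable_superset) auto
  have [measurable]: "(\<lambda>y. \<Prod>i\<in>S. g (y i)) \<in> borel_measurable (Pi\<^sub>M Y (\<lambda>_. M))"
  proof (rule borel_measurable_prod)
    fix i assume "i \<in> S"
    then have [measurable]: "i \<in> Y" using Y by auto
    show "(\<lambda>y. g (y i)) \<in> borel_measurable (Pi\<^sub>M Y (\<lambda>_. M))" by measurable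
  qed
  define h where "h y = in\<Lambda> Y y * (ennreal (\<Prod>i\<in>S. g (y i)) * ennreal (boltz (Y - S) y))" for y
  have [measurable]: "h \<in> borel_measurable (Pi\<^sub>M Y (\<lambda>_. M))" unfolding h_def by measurable
  have "(\<integral>\<^sup>+y. h y \<partial>Pi\<^sub>M Y (\<lambda>_. M)) = (\<integral>\<^sup>+y. h y \<partial>Pi\<^sub>M (S \<union> (Y - S)) (\<lambda>_. M))"
    using YS by simp
  also have "\<dots> = (\<integral>\<^sup>+s. (\<integral>\<^sup>+r. h (merge S (Y - S) (s, r)) \<partial>Pi\<^sub>M (Y - S) (\<lambda>_. M)) \<partial>Pi\<^sub>M S (\<lambda>_. M))"
    using finS Y YS by (intro product_nn_integral_fold) auto
  also have "\<dots> = (\<integral>\<^sup>+s. (\<Prod>i\<in>S. indicator \<Lambda> (s i) * ennreal (g (s i))) * Zf (Y - S) \<partial>Pi\<^sub>M S (\<lambda>_. M))"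
  proof (rule nn_integral_cong)
    fix s
    have "h (merge S (Y - S) (s, r)) = (\<Prod>i\<in>S. indicator \<Lambda> (s i) * ennreal (g (s i))) *
        (in\<Lambda> (Y - S) r * ennreal (boltz (Y - S) r))" for r
    proof -
      let ?m = "merge S (Y - S) (s, r)"
      have "in\<Lambda> Y ?m = in\<Lambda> S s * in\<Lambda> (Y - S) r"
      proof -
        have "in\<Lambda> Y ?m = (\<Prod>i\<in>S. indicator \<Lambda> (?m i)) * (\<Prod>i\<in>Y - S. indicator \<Lambda> (?m i))"
          unfolding in\<Lambda>_def by (subst prod.subset_diff[OF Y(2,1)]) (rule mult.commute)
        also have "(\<Prod>i\<in>S. indicator \<Lambda> (?m i)) = in\<Lambda> S s"
          unfolding in\<Lambda>_def by (intro prod.cong) (auto simp: merge_def)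
        also have "(\<Prod>i\<in>Y - S. indicator \<Lambda> (?m i)) = in\<Lambda> (Y - S) r"
          unfolding in\<Lambda>_def by (intro prod.cong) (auto simp: merge_def)
        finally show ?thesis .
      qed
      moreover have "boltz (Y - S) ?m = boltz (Y - S) r"
        by (rule boltz_cong) (auto simp: merge_def)
      moreover have "ennreal (\<Prod>i\<in>S. g (?m i)) = (\<Prod>i\<in>S. ennreal (g (s i)))"
        using g by (subst prod_ennreal[symmetric]) (auto simp: merge_def intro!: prod.cong)
      ultimately show ?thesis
        unfolding h_def by (simp add: in\<Lambda>_def prod.distrib ac_simps)
    qed
    then show "(\<integral>\<^sup>+r. h (merge S (Y - S) (s, r)) \<partial>Pi\<^sub>M (Y - S) (\<lambda>_. M)) =
        (\<Prod>i\<in>S. indicator \<Lambda> (s i) * ennreal (g (s i))) * Zf (Y - S)"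
      unfolding Zf_def by (simp add: nn_integral_cmult)
  qed
  also have "\<dots> = (\<integral>\<^sup>+s. (\<Prod>i\<in>S. indicator \<Lambda> (s i) * ennreal (g (s i))) \<partial>Pi\<^sub>M S (\<lambda>_. M)) * Zf (Y - S)"
    by (rule nn_integral_multc) measurable
  also have "\<dots> = (\<integral>\<^sup>+y. indicator \<Lambda> y * ennreal (g y) \<partial>M) ^ card S * Zf (Y - S)"
    using finS by (subst product_nn_integral_prod[where f="\<lambda>_ y. indicator \<Lambda> y * ennreal (g y)"]) auto
  finally show ?thesis unfolding h_def .
qed

end

section \<open>Upper bounds\<close>

lemma fact_div_fact_le_power:
  assumes "n \<le> N"
  shows "fact N / fact (N - n) \<le> real N ^ n"
proof -
  have "fact (N - n) dvd (fact N :: nat)" by (rule fact_dvd) simp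
  then have "fact N / fact (N - n) = real (fact N div fact (N - n))"
    by (simp add: real_of_nat_div)
  also have "\<dots> \<le> real (N ^ n)"
    unfolding of_nat_le_iff using assms by (rule fact_div_fact_le_pow)
  finally show ?thesis by simp
qed

context cell_gas
begin

text \<open>The minimum in \<open>weight\<close> is attained at some \<open>p\<close> in
  \<open>X\<close>; bounding its term by the sum over all of \<open>X\<close> makes each
  \<open>p\<close> contribute at most \<open>C * \<sigma>\<close>. Here the volume is traded for the
  number of fixed particles.\<close>

lemma removed_particle_integral:
  assumes X: "finite X" "X \<noteq> {}" "X \<subseteq> K"
    and C: "0 < C" "\<And>z. 1 \<le> z \<Longrightarrow> exp (- (16 * (B * \<sigma>)) * z powr \<eta>) \<le> C * z powr (- 1 - \<eta>)"
  shows "(\<Sum>q\<in>K. ennreal (exp (- (16 * (B * \<sigma>)) * weight X q)) * ennreal v) \<le>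
    ennreal (real (card X) * (C * \<sigma>))"
proof -
  have "(\<Sum>q\<in>K. exp (- (16 * (B * \<sigma>)) * weight X q) * v) \<le>
      (\<Sum>q\<in>K. (\<Sum>p\<in>X. C * P p q powr (- 1 - \<eta>)) * 1)"
  proof (intro sum_mono mult_mono)
    fix q
    obtain p where p: "p \<in> X" "weight X q = P q p powr \<eta>" using weight_props(4)[OF X] by blast
    then have "exp (- (16 * (B * \<sigma>)) * weight X q) \<le> C * P p q powr (- 1 - \<eta>)"
      using C(2)[OF P_ge1[of q p]] by (simp add: P_sym[of p q])
    also have "\<dots> \<le> (\<Sum>p\<in>X. C * P p q powr (- 1 - \<eta>))"
      using X C p by (intro member_le_sum) auto
    finally show "exp (- (16 * (B * \<sigma>)) * weight X q) \<le> (\<Sum>p\<in>X. C * P p q powr (- 1 - \<eta>))" .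
  qed (use v_le v_pos C in \<open>auto intro!: sum_nonneg\<close>)
  also have "\<dots> = (\<Sum>p\<in>X. C * (\<Sum>q\<in>K. P p q powr (- 1 - \<eta>)))"
    by (simp add: sum.swap[of _ K] sum_distrib_left)
  also have "\<dots> \<le> (\<Sum>p\<in>X. C * \<sigma>)"
    using C X by (intro sum_mono mult_left_mono P_sum) auto
  finally show ?thesis
    using v_pos by (subst ennreal_mult[symmetric], simp, simp, subst sum_ennreal) (auto intro!: ennreal_leI)
qed

text \<open>The fixed particles \<open>F\<close> feel the free ones \<open>Y\<close>, and an additional particle in the cell
  \<open>q0\<close> acts by attraction only. Removed particles cost a factor \<open>C * \<sigma>\<close> each, because
  \<open>weight X\<close> grows away from \<open>X\<close>, and reinserting them anywhere gains \<open>ins * vol\<close>.\<close>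

lemma fixed_particles_bound:
  fixes x :: "nat \<Rightarrow> 'a"
  assumes fin: "finite F" "finite Y" and disj: "F \<inter> Y = {}" "k \<notin> F \<union> Y"
    and x: "\<And>i. i \<in> F \<Longrightarrow> x i \<in> \<Lambda>" and q0: "q0 \<in> K"
    and card: "real (card F + 1 + card Y) \<le> \<rho> * vol" and w: "0 \<le> w"
    and C: "0 < C" "\<And>z. 1 \<le> z \<Longrightarrow> exp (- (16 * (B * \<sigma>)) * z powr \<eta>) \<le> C * z powr (- 1 - \<eta>)"
  defines "z y \<equiv> \<lambda>i. if i \<in> F then x i else y i" and "n \<equiv> card F + 1"
  shows "(\<integral>\<^sup>+y. in\<Lambda> Y y * ennreal (w * (boltz (F \<union> Y) (z y) *
        exp (\<Sum>i\<in>F \<union> Y. attr q0 (cell (z y i))))) \<partial>Pi\<^sub>M Y (\<lambda>_. M)) \<le>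
    ennreal w * (ennreal (exp (6 * (B * \<sigma>) * real n) *
      ((1 + real n * (C * \<sigma>) / (ins * vol)) ^ card Y / (ins * vol) ^ n)) * Zf (insert k (F \<union> Y)))"
proof -
  define X where "X = insert q0 ((\<lambda>i. cell (x i)) ` F)"
  have X: "finite X" "X \<noteq> {}" "X \<subseteq> K" using fin x q0 cell_in by (auto simp: X_def)
  have cX: "card X \<le> n"
    unfolding X_def n_def using fin card_image_le[OF fin(1), of "\<lambda>i. cell (x i)"]
    by (simp add: card_insert_if)
  define G where "G = real n * (C * \<sigma>)"
  have G0: "0 \<le> G" using C pos by (simp add: G_def)
  define iv where "iv = ins * vol"
  have "0 < vol" using q0 by (rule vol_pos)
  then have iv: "0 < iv" using ins_pos by (simp add: iv_def)
  define e where "e q = exp (- (16 * (B * \<sigma>)) * weight X q)" for q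
  \<comment> \<open>The factor \<open>e (cell y)\<close> is written as a finite sum of indicators of
    cells, which makes it measurable; it vanishes outside \<open>\<Lambda>\<close>.\<close>
  define g where "g y = (\<Sum>q\<in>K. e q * indicator {x\<in>\<Lambda>. cell x = q} y)" for y
  have g0: "0 \<le> g y" for y unfolding g_def e_def by (intro sum_nonneg) auto
  have g_meas: "g \<in> borel_measurable M"
    unfolding g_def using cell_sets by (intro borel_measurable_sum) auto
  have g_eq: "g y = e (cell y)" if "y \<in> \<Lambda>" for y
  proof -
    have "g y = (\<Sum>q\<in>K. if cell y = q then e q else 0)"
      unfolding g_def using that by (intro sum.cong) (auto simp: indicator_def)
    then show ?thesis using cell_in[OF that] finK by simp
  qed
  have g_int: "(\<integral>\<^sup>+y. indicator \<Lambda> y * ennreal (g y) \<partial>M) \<le> ennreal G"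
  proof -
    have "(\<integral>\<^sup>+y. indicator \<Lambda> y * ennreal (g y) \<partial>M) = (\<integral>\<^sup>+y. indicator \<Lambda> y * ennreal (e (cell y)) \<partial>M)"
      by (intro nn_integral_cong) (auto simp: indicator_def g_eq)
    also have "\<dots> = (\<Sum>q\<in>K. ennreal (e q) * ennreal v)" by (rule nn_integral_cells)
    also have "\<dots> \<le> ennreal (real (card X) * (C * \<sigma>))"
      unfolding e_def by (rule removed_particle_integral[OF X C])
    also have "\<dots> \<le> ennreal G"
      unfolding G_def using cX C pos by (intro ennreal_leI mult_right_mono) auto
    finally show ?thesis .
  qed
  define T where "T S y = ennreal (\<Prod>i\<in>S. g (y i)) * ennreal (boltz (Y - S) y)" for S y
  have ptw: "in\<Lambda> Y y * ennreal (boltz (F \<union> Y) (z y) * exp (\<Sum>i\<in>F \<union> Y. attr q0 (cell (z y i)))) \<le>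
      ennreal (exp (6 * (B * \<sigma>) * real n)) * (\<Sum>S\<in>Pow Y. in\<Lambda> Y y * T S y)" for y
  proof (cases "\<forall>i\<in>Y. y i \<in> \<Lambda>")
    case True
    have zX: "insert q0 ((\<lambda>i. cell (z y i)) ` F) = X" unfolding X_def z_def by simp
    have zL: "z y i \<in> \<Lambda>" if "i \<in> F \<union> Y" for i
      using that x True by (auto simp: z_def)
    have zY: "z y i = y i" if "i \<in> Y" for i using that disj by (auto simp: z_def)
    have "boltz (F \<union> Y) (z y) * exp (\<Sum>i\<in>F \<union> Y. attr q0 (cell (z y i))) \<le>
      exp (6 * (B * \<sigma>) * (real (card F) + 1)) *
      (\<Sum>S\<in>Pow Y. (\<Prod>i\<in>S. e (cell (z y i))) * boltz (Y - S) (z y))"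
      using boltz_removal[OF fin disj(1) _ q0, of "z y", OF zL] unfolding zX e_def .
    also have "\<dots> = exp (6 * (B * \<sigma>) * real n) *
      (\<Sum>S\<in>Pow Y. (\<Prod>i\<in>S. g (y i)) * boltz (Y - S) y)"
    proof -
      have "(\<Prod>i\<in>S. e (cell (z y i))) * boltz (Y - S) (z y) = (\<Prod>i\<in>S. g (y i)) * boltz (Y - S) y"
        if "S \<in> Pow Y" for S
        using that True zY by (intro arg_cong2[where f="(*)"] prod.cong boltz_cong) (auto simp: g_eq subset_iff)
      then show ?thesis by (simp add: n_def add.commute)
    qed
    finally have "ennreal (boltz (F \<union> Y) (z y) * exp (\<Sum>i\<in>F \<union> Y. attr q0 (cell (z y i)))) \<le>
      ennreal (exp (6 * (B * \<sigma>) * real n) * (\<Sum>S\<in>Pow Y. (\<Prod>i\<in>S. g (y i)) * boltz (Y - S) y))"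
      by (rule ennreal_leI)
    also have "\<dots> = ennreal (exp (6 * (B * \<sigma>) * real n)) * (\<Sum>S\<in>Pow Y. T S y)"
      unfolding T_def using g0
      by (simp add: ennreal_mult' sum_ennreal[symmetric] prod_nonneg boltz_nonneg)
    finally show ?thesis using True fin by (simp add: in\<Lambda>_eq)
  next
    case False
    then have "in\<Lambda> Y y = 0" using fin by (simp add: in\<Lambda>_eq)
    then show ?thesis by simp
  qed
  have T_meas: "(\<lambda>y. in\<Lambda> Y y * T S y) \<in> borel_measurable (Pi\<^sub>M Y (\<lambda>_. M))" if S: "S \<subseteq> Y" for S
  proof -
    have [measurable]: "(\<lambda>y. boltz (Y - S) y) \<in> borel_measurable (Pi\<^sub>M Y (\<lambda>_. M))"
      by (rule boltz_measurable_superset) auto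
    note g_meas[measurable]
    have [measurable]: "(\<lambda>y. \<Prod>i\<in>S. g (y i)) \<in> borel_measurable (Pi\<^sub>M Y (\<lambda>_. M))"
    proof (rule borel_measurable_prod)
      fix i assume "i \<in> S"
      then have [measurable]: "i \<in> Y" using S by auto
      show "(\<lambda>y. g (y i)) \<in> borel_measurable (Pi\<^sub>M Y (\<lambda>_. M))" by measurable
    qed
    show ?thesis unfolding T_def by measurable
  qed
  have T_int: "(\<integral>\<^sup>+y. in\<Lambda> Y y * T S y \<partial>Pi\<^sub>M Y (\<lambda>_. M)) \<le>
      ennreal ((G / iv) ^ card S / iv ^ n) * Zf (insert k (F \<union> Y))" if S: "S \<in> Pow Y" for S
  proof -
    have finS: "finite S" "S \<subseteq> Y" using S fin finite_subset by auto
    have "(\<integral>\<^sup>+y. in\<Lambda> Y y * T S y \<partial>Pi\<^sub>M Y (\<lambda>_. M)) =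
        (\<integral>\<^sup>+y. indicator \<Lambda> y * ennreal (g y) \<partial>M) ^ card S * Zf (Y - S)"
      unfolding T_def by (rule Zf_split[OF fin(2) finS(2) g_meas g0])
    also have "\<dots> \<le> ennreal G ^ card S * Zf (Y - S)"
      by (intro mult_right_mono power_mono g_int) auto
    also have "\<dots> = ennreal ((G / iv) ^ card S / iv ^ n) * (ennreal (iv ^ (n + card S)) * Zf (Y - S))"
    proof -
      have "G ^ card S = (G / iv) ^ card S / iv ^ n * iv ^ (n + card S)"
        using iv by (simp add: power_add power_divide)
      then have "ennreal G ^ card S = ennreal ((G / iv) ^ card S / iv ^ n) * ennreal (iv ^ (n + card S))"
        using G0 iv by (simp add: ennreal_power ennreal_mult'[symmetric])
      then show ?thesis by (simp add: mult.assoc)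
    qed
    also have "\<dots> \<le> ennreal ((G / iv) ^ card S / iv ^ n) * Zf (insert k (F \<union> Y))"
    proof (rule mult_left_mono)
      \<comment> \<open>Reinserted are the ghost \<open>k\<close>, the fixed particles and
        \<open>S\<close>. Together with \<open>Y - S\<close> these are all labels of the full
        system.\<close>
      have cJ: "card (insert k F \<union> S) = n + card S"
        using fin finS disj unfolding n_def
        by (subst card_Un_disjoint) auto
      have cY: "card (Y - S) + card S = card Y"
        using fin finS by (simp add: card_Diff_subset card_mono)
      have "ennreal ((ins * vol) ^ card (insert k F \<union> S)) * Zf (Y - S) \<le> Zf ((Y - S) \<union> (insert k F \<union> S))"
      proof (rule Zf_union)
        show "real (card (Y - S) + card (insert k F \<union> S)) \<le> \<rho> * vol"
          using card cY unfolding cJ n_def by linarith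
      qed (use fin finS disj in auto)
      moreover have "(Y - S) \<union> (insert k F \<union> S) = insert k (F \<union> Y)" using finS by auto
      ultimately show "ennreal (iv ^ (n + card S)) * Zf (Y - S) \<le> Zf (insert k (F \<union> Y))"
        by (simp only: cJ iv_def)
    qed auto
    finally show ?thesis .
  qed
  have "(\<integral>\<^sup>+y. in\<Lambda> Y y * ennreal (w * (boltz (F \<union> Y) (z y) *
        exp (\<Sum>i\<in>F \<union> Y. attr q0 (cell (z y i))))) \<partial>Pi\<^sub>M Y (\<lambda>_. M)) \<le>
      (\<integral>\<^sup>+y. ennreal w * (ennreal (exp (6 * (B * \<sigma>) * real n)) *
        (\<Sum>S\<in>Pow Y. in\<Lambda> Y y * T S y)) \<partial>Pi\<^sub>M Y (\<lambda>_. M))"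
    using mult_left_mono[OF ptw, of "ennreal w"] w
    by (intro nn_integral_mono) (simp add: ennreal_mult' mult.left_commute)
  also have "\<dots> = ennreal w * (ennreal (exp (6 * (B * \<sigma>) * real n)) *
      (\<Sum>S\<in>Pow Y. \<integral>\<^sup>+y. in\<Lambda> Y y * T S y \<partial>Pi\<^sub>M Y (\<lambda>_. M)))"
  proof -
    have "(\<integral>\<^sup>+y. (\<Sum>S\<in>Pow Y. in\<Lambda> Y y * T S y) \<partial>Pi\<^sub>M Y (\<lambda>_. M)) =
        (\<Sum>S\<in>Pow Y. \<integral>\<^sup>+y. in\<Lambda> Y y * T S y \<partial>Pi\<^sub>M Y (\<lambda>_. M))"
      using T_meas by (intro nn_integral_sum) auto
    moreover have "(\<lambda>y. \<Sum>S\<in>Pow Y. in\<Lambda> Y y * T S y) \<in> borel_measurable (Pi\<^sub>M Y (\<lambda>_. M))"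
      using T_meas by (intro borel_measurable_sum) auto
    ultimately show ?thesis by (simp add: nn_integral_cmult)
  qed
  also have "\<dots> \<le> ennreal w * (ennreal (exp (6 * (B * \<sigma>) * real n)) *
      (\<Sum>S\<in>Pow Y. ennreal ((G / iv) ^ card S / iv ^ n) * Zf (insert k (F \<union> Y))))"
    by (intro mult_left_mono sum_mono T_int) auto
  also have "\<dots> = ennreal w * (ennreal (exp (6 * (B * \<sigma>) * real n)) *
      (ennreal (\<Sum>S\<in>Pow Y. (G / iv) ^ card S / iv ^ n) * Zf (insert k (F \<union> Y))))"
    using G0 iv by (simp add: sum_distrib_right[symmetric])
  also have "(\<Sum>S\<in>Pow Y. (G / iv) ^ card S / iv ^ n) = (1 + G / iv) ^ card Y / iv ^ n"
    using prod_add[OF fin(2), of "\<lambda>_. G / iv" "\<lambda>_. 1"] by (simp add: sum_divide_distrib add.commute)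
  also have "ennreal (exp (6 * (B * \<sigma>) * real n)) *
      (ennreal ((1 + G / iv) ^ card Y / iv ^ n) * Zf (insert k (F \<union> Y))) =
      ennreal (exp (6 * (B * \<sigma>) * real n) * ((1 + G / iv) ^ card Y / iv ^ n)) * Zf (insert k (F \<union> Y))"
    by (subst ennreal_mult') (simp_all only: mult.assoc exp_ge_zero)
  finally show ?thesis unfolding G_def iv_def .
qed

text \<open>The volume cancels twice, both times by \<open>N \<le> \<rho> * vol\<close>: in
  \<open>(\<rho> * vol) ^ n\<close>, which bounds the quotient of factorials, against the
  \<open>iv ^ n\<close> gained by reinsertion, and in the exponent, which is \<open>n\<close> times
  a constant because \<open>iv\<close> is proportional to \<open>vol\<close>.\<close>

lemma correlation_bound:
  fixes x :: "nat \<Rightarrow> 'a"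
  assumes n: "1 \<le> n" "n \<le> N" and k: "k \<in> {1..n}" and card: "real N \<le> \<rho> * vol"
    and x: "\<And>i. i \<in> {1..n} \<Longrightarrow> x i \<in> \<Lambda>" and w: "0 \<le> w"
    and C: "0 < C" "\<And>z. 1 \<le> z \<Longrightarrow> exp (- (16 * (B * \<sigma>)) * z powr \<eta>) \<le> C * z powr (- 1 - \<eta>)"
  defines "z y \<equiv> \<lambda>i. if i \<le> n then x i else y i"
  shows "ennreal (fact N / fact (N - n)) * (1 / Zf {1..N}) *
      (\<integral>\<^sup>+y. in\<Lambda> {n+1..N} y * ennreal (w * (boltz ({1..N} - {k}) (z y) *
        exp (\<Sum>i\<in>{1..N} - {k}. attr (cell (x k)) (cell (z y i))))) \<partial>Pi\<^sub>M {n+1..N} (\<lambda>_. M)) \<le>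
    ennreal w * ennreal ((\<rho> / ins * exp (C * \<sigma> * \<rho> / ins + 6 * (B * \<sigma>))) ^ n)"
proof -
  define F where "F = {1..n} - {k}"
  define Y where "Y = {n+1..N}"
  define iv where "iv = ins * vol"
  have FY: "finite F" "finite Y" "F \<inter> Y = {}" "k \<notin> F \<union> Y" "F \<union> Y = {1..N} - {k}"
      "insert k (F \<union> Y) = {1..N}" "card F + 1 = n" "card Y = N - n"
    using k n by (auto simp: F_def Y_def)
  have "cell (x k) \<in> K" using k x cell_in by blast
  then have "0 < vol" by (rule vol_pos)
  then have iv: "0 < iv" using ins_pos by (simp add: iv_def)
  \<comment> \<open>Inserting all particles into the empty configuration shows that the partition
    function is positive.\<close>
  have "0 < ennreal (iv ^ N)" using iv by simp
  also have "ennreal (iv ^ N) \<le> Zf {1..N}"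
    using Zf_union[of "{1..N}" "{}"] card by (simp add: Zf_empty iv_def)
  finally have Z0: "Zf {1..N} \<noteq> 0" by simp
  define R where "R = exp (6 * (B * \<sigma>) * real n) *
      ((1 + real n * (C * \<sigma>) / iv) ^ (N - n) / iv ^ n)"
  have R0: "0 \<le> R" using C pos iv by (simp add: R_def)
  have int: "(\<integral>\<^sup>+y. in\<Lambda> Y y * ennreal (w * (boltz (F \<union> Y) (z y) *
        exp (\<Sum>i\<in>F \<union> Y. attr (cell (x k)) (cell (z y i))))) \<partial>Pi\<^sub>M Y (\<lambda>_. M)) \<le>
    ennreal w * (ennreal R * Zf {1..N})" (is "?I \<le> _")
  proof -
    let ?z = "\<lambda>y i. if i \<in> F then x i else y i"
    have zeq: "z y i = ?z y i" if "i \<in> F \<union> Y" for y i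
      using that by (auto simp: z_def F_def Y_def)
    have "?I = (\<integral>\<^sup>+y. in\<Lambda> Y y * ennreal (w * (boltz (F \<union> Y) (?z y) *
        exp (\<Sum>i\<in>F \<union> Y. attr (cell (x k)) (cell (?z y i))))) \<partial>Pi\<^sub>M Y (\<lambda>_. M))"
    proof -
      have "boltz (F \<union> Y) (z y) = boltz (F \<union> Y) (?z y)" for y
        by (rule boltz_cong) (rule zeq)
      moreover have "(\<Sum>i\<in>F \<union> Y. attr (cell (x k)) (cell (z y i))) =
          (\<Sum>i\<in>F \<union> Y. attr (cell (x k)) (cell (?z y i)))" for y
        by (intro sum.cong) (auto simp: zeq)
      ultimately show ?thesis by (simp only:)
    qed
    also have "\<dots> \<le> ennreal w * (ennreal (exp (6 * (B * \<sigma>) * real (card F + 1)) *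
      ((1 + real (card F + 1) * (C * \<sigma>) / (ins * vol)) ^ card Y / (ins * vol) ^ (card F + 1))) *
      Zf (insert k (F \<union> Y)))"
    proof (rule fixed_particles_bound[OF FY(1-4)])
      show "real (card F + 1 + card Y) \<le> \<rho> * vol" using card n FY by simp
      show "cell (x k) \<in> K" by fact
    qed (use x C w in \<open>auto simp: F_def\<close>)
    finally show ?thesis unfolding FY(6-8) R_def iv_def .
  qed
  have "ennreal (fact N / fact (N - n)) * (1 / Zf {1..N}) * ?I \<le>
      ennreal (fact N / fact (N - n)) * (1 / Zf {1..N}) * (ennreal w * (ennreal R * Zf {1..N}))"
    by (intro mult_left_mono int) auto
  also have "\<dots> = ennreal w * (ennreal (fact N / fact (N - n)) * ennreal R) * (1 / Zf {1..N} * Zf {1..N})"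
    by (simp add: ac_simps)
  also have "\<dots> \<le> ennreal w * (ennreal (fact N / fact (N - n)) * ennreal R) * 1"
  proof (rule mult_left_mono)
    show "1 / Zf {1..N} * Zf {1..N} \<le> 1"
    \<comment> \<open>Since \<open>1 / top = 0\<close> in \<open>ennreal\<close>, the inequality
      also covers an infinite partition function.\<close>
    proof (cases "Zf {1..N} = top")
      case False
      then show ?thesis using Z0
        by (simp add: ennreal_divide_times ennreal_divide_self less_top)
    qed simp
  qed simp
  also have "\<dots> = ennreal w * ennreal (fact N / fact (N - n) * R)"
    unfolding mult_1_right using R0 by (subst ennreal_mult) auto
  also have "\<dots> \<le> ennreal w * ennreal ((\<rho> / ins * exp (C * \<sigma> * \<rho> / ins + 6 * (B * \<sigma>))) ^ n)"
  proof (intro mult_left_mono ennreal_leI)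
    have "fact N / fact (N - n) \<le> (\<rho> * vol) ^ n"
      using fact_div_fact_le_power[OF n(2)] power_mono[OF card, of n] by simp
    moreover have "(1 + real n * (C * \<sigma>) / iv) ^ (N - n) \<le> exp (C * \<sigma> * \<rho> / ins) ^ n"
    proof -
      let ?t = "real n * (C * \<sigma>) / iv"
      have t0: "0 \<le> ?t" using C pos iv by simp
      have "(1 + ?t) ^ (N - n) \<le> exp ?t ^ (N - n)"
        using t0 by (intro power_mono) auto
      also have "\<dots> \<le> exp ?t ^ N" using t0 by (intro power_increasing) auto
      also have "\<dots> = exp (real N * ?t)" by (rule exp_of_nat_mult[symmetric])
      also have "\<dots> \<le> exp (\<rho> * vol * ?t)" using card t0 by (simp only: exp_le_cancel_iff mult_right_mono)
      also have "\<rho> * vol * ?t = real n * (C * \<sigma> * \<rho> / ins)"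
        using \<open>0 < vol\<close> ins_pos by (simp add: iv_def field_simps)
      finally show ?thesis unfolding exp_of_nat_mult .
    qed
    ultimately have "fact N / fact (N - n) * R \<le> (\<rho> * vol) ^ n *
        (exp (6 * (B * \<sigma>) * real n) * (exp (C * \<sigma> * \<rho> / ins) ^ n / iv ^ n))"
      unfolding R_def using iv C pos vol_nonneg
      by (intro mult_mono divide_right_mono mult_left_mono) auto
    also have "\<dots> = (\<rho> * vol * (exp (6 * (B * \<sigma>)) * (exp (C * \<sigma> * \<rho> / ins) / iv))) ^ n"
      unfolding power_mult_distrib power_divide exp_of_nat2_mult ..
    also have "\<rho> * vol * (exp (6 * (B * \<sigma>)) * (exp (C * \<sigma> * \<rho> / ins) / iv)) =
        \<rho> / ins * exp (C * \<sigma> * \<rho> / ins + 6 * (B * \<sigma>))"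
      using \<open>0 < vol\<close> ins_pos by (simp add: iv_def exp_add)
    finally show "fact N / fact (N - n) * R \<le>
      (\<rho> / ins * exp (C * \<sigma> * \<rho> / ins + 6 * (B * \<sigma>))) ^ n" .
  qed simp
  finally show ?thesis unfolding Y_def[symmetric] FY(5)[symmetric] .
qed

end

section \<open>Cells and decay on the torus\<close>

lemma sum_powr_bound:
  fixes s :: real
  assumes "s < - 1"
  obtains S where "S > 0" "\<And>n::nat. (\<Sum>t<n. (1 + real t) powr s) \<le> S"
proof -
  have "summable (\<lambda>t. real t powr s)" using assms by (simp add: summable_real_powr_iff)
  then have *: "summable (\<lambda>t. (1 + real t) powr s)"
    by (subst (asm) summable_Suc_iff[symmetric]) (simp add: add.commute)
  show thesis
  proof (rule that[of "(\<Sum>t. (1 + real t) powr s)"])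
    show "(\<Sum>t<n. (1 + real t) powr s) \<le> (\<Sum>t. (1 + real t) powr s)" for n
      using * by (intro sum_le_suminf) auto
    have "0 < (\<Sum>t<1. (1 + real t) powr s)" by simp
    also have "\<dots> \<le> (\<Sum>t. (1 + real t) powr s)" using * by (intro sum_le_suminf) auto
    finally show "(\<Sum>t. (1 + real t) powr s) > 0" .
  qed
qed

text \<open>Among the multiples of \<open>1 / m\<close>, the \<open>m\<close> consecutive ones from
  \<open>j\<close> on are each compared with \<open>j\<close>. The factor \<open>m\<close> in every
  coordinate is the origin of the \<open>m ^ d\<close> that the repulsion has to beat.\<close>

lemma sum_powr_scaled_bound:
  fixes s S :: real
  assumes s: "s \<le> 0" and S: "\<And>n::nat. (\<Sum>t<n. (1 + real t) powr s) \<le> S" and m: "m > 0"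
  shows "(\<Sum>t\<in>{0..k}. (1 + real_of_int t / real m) powr s) \<le> real m * S"
proof -
  define n where "n = nat (k + 1)"
  have "(\<Sum>t\<in>{0..k}. (1 + real_of_int t / real m) powr s) = (\<Sum>t<n. (1 + real t / real m) powr s)"
    by (rule sum.reindex_bij_witness[of _ int nat]) (auto simp: n_def)
  also have "\<dots> \<le> (\<Sum>t<n * m. (1 + real t / real m) powr s)"
    using m by (intro sum_mono2) auto
  also have "\<dots> = (\<Sum>j<n. \<Sum>t\<in>{j * m..<j * m + m}. (1 + real t / real m) powr s)"
    by (rule sum.nat_group[symmetric])
  also have "\<dots> \<le> (\<Sum>j<n. \<Sum>t\<in>{j * m..<j * m + m}. (1 + real j) powr s)"
  proof (intro sum_mono powr_mono2')
    fix j t assume "t \<in> {j * m..<j * m + m}"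
    then have "real (j * m) \<le> real t" unfolding of_nat_le_iff by simp
    then show "1 + real j \<le> 1 + real t / real m" using m by (simp add: field_simps)
  qed (use s in auto)
  also have "\<dots> = real m * (\<Sum>j<n. (1 + real j) powr s)" by (simp add: sum_distrib_left)
  also have "\<dots> \<le> real m * S" using S by (intro mult_left_mono) auto
  finally show ?thesis .
qed

text \<open>Distance on the cyclic group of order \<open>k\<close>, in the representatives
  \<open>1..k\<close>. The outer \<open>max 0\<close> keeps it nonnegative for arguments outside
  that range.\<close>

definition tdist :: "int \<Rightarrow> int \<Rightarrow> int \<Rightarrow> int" where
  "tdist k a b = max 0 (min \<bar>a - b\<bar> (k - \<bar>a - b\<bar>))"

lemma tdist_nonneg [simp]: "0 \<le> tdist k a b"
  and tdist_self [simp]: "tdist k a a = 0"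
  and tdist_sym: "tdist k a b = tdist k b a"
  by (auto simp: tdist_def abs_minus_commute)

lemma tdist_triangle:
  assumes "a \<in> {1..k}" "b \<in> {1..k}" "c \<in> {1..k}"
  shows "tdist k a c \<le> tdist k a b + tdist k b c"
  using assms unfolding tdist_def by (auto simp: max_def min_def abs_if)

text \<open>Each value of the cyclic distance is attained at most four times, twice for either
  branch of the minimum.\<close>

lemma sum_tdist_le:
  fixes h :: "int \<Rightarrow> real"
  assumes h: "\<And>t. 0 \<le> h t" and a: "a \<in> {1..k}"
  shows "(\<Sum>b\<in>{1..k}. h (tdist k a b)) \<le> 4 * (\<Sum>t\<in>{0..k}. h t)"
proof -
  have "(\<Sum>b\<in>{1..k}. h (tdist k a b)) = (\<Sum>t\<in>{0..k}. \<Sum>b\<in>{b\<in>{1..k}. tdist k a b = t}. h (tdist k a b))"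
    by (rule sum.group[symmetric]) (use a in \<open>auto simp: tdist_def\<close>)
  also have "\<dots> \<le> (\<Sum>t\<in>{0..k}. 4 * h t)"
  proof (rule sum_mono)
    fix t
    have "{b\<in>{1..k}. tdist k a b = t} \<subseteq> {a - t, a + t, a - k + t, a + k - t}"
      using a by (auto simp: tdist_def max_def min_def abs_if split: if_splits)
    then have "card {b\<in>{1..k}. tdist k a b = t} \<le> card {a - t, a + t, a - k + t, a + k - t}"
      by (intro card_mono) auto
    also have "\<dots> \<le> 4" by (simp add: card_insert_if)
    finally have "real (card {b\<in>{1..k}. tdist k a b = t}) * h t \<le> 4 * h t"
      using h by (intro mult_right_mono) auto
    then show "(\<Sum>b\<in>{b\<in>{1..k}. tdist k a b = t}. h (tdist k a b)) \<le> 4 * h t" by simp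
  qed
  finally show ?thesis by (simp add: sum_distrib_left)
qed

section \<open>The cells of the torus and their product distance\<close>

definition cells :: "int \<Rightarrow> ('d::finite \<Rightarrow> int) set" where
  "cells k = UNIV \<rightarrow>\<^sub>E {1..k}"

definition cell_dist :: "nat \<Rightarrow> int \<Rightarrow> ('d::finite \<Rightarrow> int) \<Rightarrow> ('d \<Rightarrow> int) \<Rightarrow> real" where
  "cell_dist m k p q = (\<Prod>i\<in>UNIV. 1 + real_of_int (tdist k (p i) (q i)) / real m)"

definition cell_near :: "int \<Rightarrow> ('d::finite \<Rightarrow> int) \<Rightarrow> ('d \<Rightarrow> int) \<Rightarrow> bool" where
  "cell_near k p q \<longleftrightarrow> (\<forall>i. tdist k (p i) (q i) \<le> 1)"

lemma finite_cells: "finite (cells k)"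
  unfolding cells_def by (intro finite_PiE) auto

lemma card_cells: "card (cells k :: ('d::finite \<Rightarrow> int) set) = nat k ^ CARD('d)"
  unfolding cells_def by (simp add: card_PiE)

lemma cells_iff: "q \<in> cells k \<longleftrightarrow> (\<forall>i. q i \<in> {1..k})"
  by (auto simp: cells_def PiE_def Pi_def)

lemma cell_dist_ge1: "1 \<le> cell_dist m k p q"
  unfolding cell_dist_def by (intro prod_ge_1) simp

lemma cell_dist_self: "cell_dist m k q q = 1"
  by (simp add: cell_dist_def)

lemma cell_dist_sym: "cell_dist m k p q = cell_dist m k q p"
  by (simp add: cell_dist_def tdist_sym)

text \<open>In each coordinate \<open>1 + a + b \<le> (1 + a) * (1 + b)\<close> for nonnegative
  \<open>a\<close> and \<open>b\<close>, combined with the cyclic triangle inequality.\<close>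

lemma cell_dist_triangle:
  assumes "p \<in> cells k" "q \<in> cells k" "r \<in> cells k"
  shows "cell_dist m k p r \<le> cell_dist m k p q * cell_dist m k q r"
  unfolding cell_dist_def prod.distrib[symmetric]
proof (intro prod_mono conjI)
  fix i
  have "real_of_int (tdist k (p i) (r i)) \<le> real_of_int (tdist k (p i) (q i) + tdist k (q i) (r i))"
    unfolding of_int_le_iff using assms by (intro tdist_triangle) (auto simp: cells_iff)
  then have "real_of_int (tdist k (p i) (r i)) / real m \<le>
      real_of_int (tdist k (p i) (q i)) / real m + real_of_int (tdist k (q i) (r i)) / real m"
    by (simp add: add_divide_distrib[symmetric] divide_right_mono)
  moreover have "0 \<le> real_of_int (tdist k (p i) (q i)) / real m * (real_of_int (tdist k (q i) (r i)) / real m)"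
    by simp
  ultimately show "1 + real_of_int (tdist k (p i) (r i)) / real m \<le>
      (1 + real_of_int (tdist k (p i) (q i)) / real m) * (1 + real_of_int (tdist k (q i) (r i)) / real m)"
    unfolding distrib_left distrib_right by linarith
qed auto

lemma sum_cells_prod_le:
  fixes h :: "int \<Rightarrow> real" and q :: "'d::finite \<Rightarrow> int"
  assumes h: "\<And>t. 0 \<le> h t" and q: "q \<in> cells k"
  shows "(\<Sum>p\<in>cells k. \<Prod>i\<in>UNIV. h (tdist k (q i) (p i))) \<le> (4 * (\<Sum>t\<in>{0..k}. h t)) ^ CARD('d)"
proof -
  have "(\<Sum>p\<in>cells k. \<Prod>i\<in>UNIV. h (tdist k (q i) (p i))) =
      (\<Prod>i\<in>UNIV. \<Sum>b\<in>{1..k}. h (tdist k (q i) b))"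
    unfolding cells_def by (rule prod_sum_PiE[symmetric]) auto
  also have "\<dots> \<le> (\<Prod>i\<in>(UNIV::'d set). 4 * (\<Sum>t\<in>{0..k}. h t))"
    using q h by (intro prod_mono conjI sum_tdist_le sum_nonneg) (auto simp: cells_iff)
  finally show ?thesis by simp
qed

lemma sum_cell_dist_powr_le:
  fixes q :: "'d::finite \<Rightarrow> int" and s S :: real
  assumes s: "s \<le> 0" and S: "\<And>n::nat. (\<Sum>t<n. (1 + real t) powr s) \<le> S" and m: "m > 0"
    and q: "q \<in> cells k"
  shows "(\<Sum>p\<in>cells k. cell_dist m k q p powr s) \<le> (4 * S) ^ CARD('d) * real m ^ CARD('d)"
proof -
  have "(\<Sum>p\<in>cells k. cell_dist m k q p powr s) =
      (\<Sum>p\<in>cells k. \<Prod>i\<in>UNIV. (\<lambda>t. (1 + real_of_int t / real m) powr s) (tdist k (q i) (p i)))"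
    unfolding cell_dist_def by (intro sum.cong) (auto intro!: prod_powr_distrib)
  also have "\<dots> \<le> (4 * (\<Sum>t\<in>{0..k}. (1 + real_of_int t / real m) powr s)) ^ CARD('d)"
    by (rule sum_cells_prod_le) (use q in auto)
  also have "\<dots> \<le> (4 * (real m * S)) ^ CARD('d)"
    by (intro power_mono mult_left_mono sum_powr_scaled_bound s S m) (auto intro!: sum_nonneg)
  finally show ?thesis by (simp add: power_mult_distrib ac_simps)
qed

text \<open>The count is a sum over cells of products of indicators. The base is
  \<open>8 = 4 * 2\<close>: two admissible distances per coordinate, each attained at most four
  times.\<close>

lemma card_cell_near_le:
  fixes p :: "'d::finite \<Rightarrow> int"
  assumes p: "p \<in> cells k"
  shows "real (card {q\<in>cells k. cell_near k q p}) \<le> 8 ^ CARD('d)"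
proof -
  have "real (card {q\<in>cells k. cell_near k q p}) = (\<Sum>q\<in>cells k. if cell_near k q p then 1 else 0)"
    by (simp add: sum.If_cases[OF finite_cells] Int_def)
  also have "\<dots> = (\<Sum>q\<in>cells k. \<Prod>i\<in>UNIV. (\<lambda>t. if t \<le> 1 then 1 else 0) (tdist k (p i) (q i)))"
    by (intro sum.cong) (auto simp: cell_near_def tdist_sym[of k "p _"] intro: exI)
  also have "\<dots> \<le> (4 * (\<Sum>t\<in>{0..k}. if t \<le> 1 then 1 else 0)) ^ CARD('d)"
    by (rule sum_cells_prod_le) (use p in auto)
  also have "\<dots> \<le> 8 ^ CARD('d)"
  proof (rule power_mono)
    have "(\<Sum>t\<in>{0..k}. if t \<le> 1 then 1 else 0) = real (card {t\<in>{0..k}. t \<le> 1})"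
      by (simp add: sum.If_cases Int_def)
    also have "\<dots> \<le> real (card {0, 1::int})"
      unfolding of_nat_le_iff by (rule card_mono) auto
    finally show "4 * (\<Sum>t\<in>{0..k}. if t \<le> 1 then 1 else 0) \<le> (8::real)" by simp
  qed (auto intro!: sum_nonneg)
  finally show ?thesis .
qed

text \<open>The decay is measured by products over the coordinates instead of a norm, so that
  sums over lattices factor into one-dimensional ones. \<open>tkap\<close> is the analogue of \<open>kap\<close> on the
  torus; it is meaningful only if all coordinates of \<open>y\<close> have modulus at most \<open>2 * L\<close>.\<close>

definition kap :: "real \<Rightarrow> real ^ 'd \<Rightarrow> real" where
  "kap s y = (\<Prod>i\<in>UNIV. (1 + \<bar>y $ i\<bar>) powr s)"

definition tkap :: "real \<Rightarrow> real \<Rightarrow> real ^ 'd \<Rightarrow> real" where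
  "tkap s L y = (\<Prod>i\<in>UNIV. (1 + min \<bar>y $ i\<bar> (2 * L - \<bar>y $ i\<bar>)) powr s)"

section \<open>Decay over periodic images\<close>

lemma kap_pos: "0 < kap s y"
  unfolding kap_def by (intro prod_pos) auto

text \<open>The product form separates \<open>y\<close> from the period \<open>r\<close>. For
  \<open>\<bar>r\<bar> \<le> 1\<close> the factor in \<open>r\<close> is below 1. For larger
  \<open>r\<close> the image is at least \<open>2 * L * (\<bar>r\<bar> - 1)\<close> away,
  \<open>1 + t \<le> 2 * L\<close> by \<open>L \<ge> 1\<close>, and
  \<open>(1 + \<bar>r\<bar>) / 3 \<le> \<bar>r\<bar> - 1\<close>, with equality at 2.\<close>

lemma tdist_periods_le:
  fixes y L :: real and r :: int
  assumes "\<bar>y\<bar> < 2 * L" "1 \<le> L"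
  shows "min \<bar>y\<bar> (2 * L - \<bar>y\<bar>) \<le> \<bar>y + 2 * L * r\<bar>"
    and "(1 + min \<bar>y\<bar> (2 * L - \<bar>y\<bar>)) * ((1 + \<bar>real_of_int r\<bar>) / 3) \<le> 1 + \<bar>y + 2 * L * r\<bar>"
proof -
  define t where "t = min \<bar>y\<bar> (2 * L - \<bar>y\<bar>)"
  have t: "0 \<le> t" "t \<le> L" "t \<le> \<bar>y\<bar>" "t \<le> 2 * L - \<bar>y\<bar>" using assms by (auto simp: t_def)
  have "t \<le> \<bar>y + 2 * L * r\<bar> \<and> (1 + t) * ((1 + \<bar>real_of_int r\<bar>) / 3) \<le> 1 + \<bar>y + 2 * L * r\<bar>"
  proof (cases "\<bar>r\<bar> \<le> 1")
    case True
    then have "r = 0 \<or> r = 1 \<or> r = - 1" by auto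
    then have le: "t \<le> \<bar>y + 2 * L * r\<bar>" using t by auto
    have "\<bar>real_of_int r\<bar> \<le> 1" using True by linarith
    then have "(1 + t) * ((1 + \<bar>real_of_int r\<bar>) / 3) \<le> (1 + t) * 1"
      using t by (intro mult_left_mono) auto
    then show ?thesis using le by simp
  next
    case False
    then have r: "2 \<le> \<bar>real_of_int r\<bar>" by linarith
    have "\<bar>2 * L * real_of_int r\<bar> = 2 * L * \<bar>real_of_int r\<bar>"
      using assms by (simp add: abs_mult)
    moreover have "\<bar>2 * L * real_of_int r\<bar> \<le> \<bar>y + 2 * L * r\<bar> + \<bar>y\<bar>" by simp
    ultimately have *: "2 * L * (\<bar>real_of_int r\<bar> - 1) \<le> \<bar>y + 2 * L * r\<bar>"
      using assms by (simp add: algebra_simps)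
    have "2 * L * 1 \<le> 2 * L * (\<bar>real_of_int r\<bar> - 1)"
      using r assms by (intro mult_left_mono) auto
    moreover have "(1 + t) * ((1 + \<bar>real_of_int r\<bar>) / 3) \<le> 2 * L * (\<bar>real_of_int r\<bar> - 1)"
      using r t assms by (intro mult_mono) auto
    ultimately show ?thesis using * t assms by linarith
  qed
  then show "min \<bar>y\<bar> (2 * L - \<bar>y\<bar>) \<le> \<bar>y + 2 * L * r\<bar>"
    and "(1 + min \<bar>y\<bar> (2 * L - \<bar>y\<bar>)) * ((1 + \<bar>real_of_int r\<bar>) / 3) \<le> 1 + \<bar>y + 2 * L * r\<bar>"
    by (auto simp: t_def)
qed

text \<open>One factor depends on \<open>y\<close> and the box, the others on the period only.
  Summing over images therefore costs a constant that is uniform in \<open>L\<close>.\<close>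

lemma kap_periods_le:
  fixes y r :: "real ^ 'd"
  assumes y: "\<And>i. \<bar>y $ i\<bar> < 2 * L" and L: "1 \<le> L" and r: "r \<in> int_lattice" and s: "s \<le> 0"
  shows "kap s (y + (2 * L) *\<^sub>R r) \<le> tkap s L y * (((1 / 3) powr s) ^ CARD('d) * kap s r)"
proof -
  have "kap s (y + (2 * L) *\<^sub>R r) \<le>
      (\<Prod>i\<in>UNIV. (1 + min \<bar>y $ i\<bar> (2 * L - \<bar>y $ i\<bar>)) powr s * ((1 / 3) powr s * (1 + \<bar>r $ i\<bar>) powr s))"
    unfolding kap_def
  proof (intro prod_mono conjI)
    fix i
    obtain z :: int where z: "r $ i = of_int z" using r by (auto simp: int_lattice_def elim: Ints_cases)
    have m0: "0 \<le> min \<bar>y $ i\<bar> (2 * L - \<bar>y $ i\<bar>)" using y[of i] by auto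
    have "(1 + \<bar>(y + (2 * L) *\<^sub>R r) $ i\<bar>) powr s \<le>
        ((1 + min \<bar>y $ i\<bar> (2 * L - \<bar>y $ i\<bar>)) * ((1 + \<bar>r $ i\<bar>) / 3)) powr s"
      using tdist_periods_le(2)[OF y[of i] L, of z] m0 s z by (intro powr_mono2') auto
    also have "\<dots> = (1 + min \<bar>y $ i\<bar> (2 * L - \<bar>y $ i\<bar>)) powr s * ((1 + \<bar>r $ i\<bar>) / 3) powr s"
      by (rule powr_mult)
    also have "((1 + \<bar>r $ i\<bar>) / 3) powr s = (1 / 3 * (1 + \<bar>r $ i\<bar>)) powr s" by simp
    also have "\<dots> = (1 / 3) powr s * (1 + \<bar>r $ i\<bar>) powr s" by (rule powr_mult)
    finally show "(1 + \<bar>(y + (2 * L) *\<^sub>R r) $ i\<bar>) powr s \<le>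
      (1 + min \<bar>y $ i\<bar> (2 * L - \<bar>y $ i\<bar>)) powr s * ((1 / 3) powr s * (1 + \<bar>r $ i\<bar>) powr s)" .
  qed auto
  also have "\<dots> = tkap s L y * (((1 / 3) powr s) ^ CARD('d) * kap s r)"
    by (simp add: tkap_def kap_def prod.distrib)
  finally show ?thesis .
qed

lemma tkap_bounds:
  assumes "\<And>i. \<bar>y $ i\<bar> < 2 * L" "s \<le> 0"
  shows "0 \<le> tkap s L y" and "tkap s L y \<le> 1"
proof -
  show "0 \<le> tkap s L y" unfolding tkap_def by (intro prod_nonneg) auto
  have "(1 + min \<bar>y $ i\<bar> (2 * L - \<bar>y $ i\<bar>)) powr s \<le> 1 powr s" for i
    using assms(1)[of i] assms(2) by (intro powr_mono2') auto
  then show "tkap s L y \<le> 1" unfolding tkap_def by (intro prod_le_1) auto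
qed

text \<open>A finite set of lattice points lies in a cube with sides \<open>{-T..T}\<close>, over
  which the sum of products is a product of one-dimensional sums, each at most
  \<open>2 * S\<close>.\<close>

lemma sum_kap_lattice_le:
  fixes s S :: real
  assumes S: "\<And>n::nat. (\<Sum>t<n. (1 + real t) powr s) \<le> S"
    and F: "finite F" "F \<subseteq> (int_lattice :: (real ^ 'd) set)"
  shows "(\<Sum>r\<in>F. kap s r) \<le> (2 * S) ^ CARD('d)"
proof -
  define T where "T = (\<Sum>r\<in>F. \<Sum>i\<in>UNIV. \<bar>\<lfloor>r $ i\<rfloor>\<bar>)"
  have T: "\<bar>\<lfloor>r $ i\<rfloor>\<bar> \<le> T" if "r \<in> F" for r i
  proof -
    have "\<bar>\<lfloor>r $ i\<rfloor>\<bar> \<le> (\<Sum>i\<in>UNIV. \<bar>\<lfloor>r $ i\<rfloor>\<bar>)" by (rule member_le_sum) auto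
    also have "\<dots> \<le> T" unfolding T_def
      using F that by (intro member_le_sum) (auto intro!: sum_nonneg)
    finally show ?thesis .
  qed
  have one: "(\<Sum>t\<in>{-T..T}. (1 + \<bar>real_of_int t\<bar>) powr s) \<le> 2 * S"
  proof -
    have "(\<Sum>t\<in>{-T..T}. (1 + \<bar>real_of_int t\<bar>) powr s) \<le>
        (\<Sum>t\<in>{0..T} \<union> uminus ` {0..T}. (1 + \<bar>real_of_int t\<bar>) powr s)"
      by (intro sum_mono2) auto
    also have "\<dots> \<le> (\<Sum>t\<in>{0..T}. (1 + \<bar>real_of_int t\<bar>) powr s) +
        (\<Sum>t\<in>uminus ` {0..T}. (1 + \<bar>real_of_int t\<bar>) powr s)"
      by (subst sum_Un) (auto intro!: sum_nonneg)
    also have "(\<Sum>t\<in>uminus ` {0..T}. (1 + \<bar>real_of_int t\<bar>) powr s) =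
        (\<Sum>t\<in>{0..T}. (1 + \<bar>real_of_int t\<bar>) powr s)"
      by (subst sum.reindex) (auto simp: inj_on_def)
    also have "(\<Sum>t\<in>{0..T}. (1 + \<bar>real_of_int t\<bar>) powr s) = (\<Sum>t<nat (T + 1). (1 + real t) powr s)"
      by (rule sum.reindex_bij_witness[of _ int nat]) auto
    finally show ?thesis using S[of "nat (T + 1)"] by simp
  qed
  define h where "h r = (\<lambda>i. \<lfloor>r $ i\<rfloor>)" for r :: "real ^ 'd"
  have rh: "r $ i = real_of_int (h r i)" if "r \<in> F" for r i
    using that F by (auto simp: h_def int_lattice_def subset_iff elim!: Ints_cases)
  have inj: "inj_on h F"
    by (rule inj_onI) (metis rh vec_eq_iff)
  have "(\<Sum>r\<in>F. kap s r) = (\<Sum>r\<in>F. \<Prod>i\<in>UNIV. (1 + \<bar>real_of_int (h r i)\<bar>) powr s)"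
    by (intro sum.cong) (auto simp: kap_def rh)
  also have "\<dots> = (\<Sum>g\<in>h ` F. \<Prod>i\<in>UNIV. (1 + \<bar>real_of_int (g i)\<bar>) powr s)"
    using inj by (simp add: sum.reindex)
  also have "\<dots> \<le> (\<Sum>g\<in>(UNIV :: 'd set) \<rightarrow>\<^sub>E {-T..T}. \<Prod>i\<in>UNIV. (1 + \<bar>real_of_int (g i)\<bar>) powr s)"
  proof (rule sum_mono2)
    show "h ` F \<subseteq> (UNIV :: 'd set) \<rightarrow>\<^sub>E {-T..T}"
      using T by (force simp: h_def abs_le_iff)
  qed (auto intro!: finite_PiE prod_nonneg)
  also have "\<dots> = (\<Prod>i\<in>(UNIV :: 'd set). \<Sum>t\<in>{-T..T}. (1 + \<bar>real_of_int t\<bar>) powr s)"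
    by (rule prod_sum_PiE[symmetric]) auto
  also have "\<dots> \<le> (\<Prod>i\<in>(UNIV :: 'd set). 2 * S)"
    using one by (intro prod_mono) (auto intro!: sum_nonneg)
  finally show ?thesis by simp
qed

section \<open>The periodized potential\<close>

text \<open>For nonnegative terms an unordered sum in \<open>ereal\<close> is the supremum of its
  finite partial sums. A summable bound \<open>h\<close> on the negative parts reduces to that case,
  infinite terms included, and its real sum is subtracted at the end.\<close>

lemma infsum_ereal_shift:
  fixes g :: "'b \<Rightarrow> ereal" and h :: "'b \<Rightarrow> real"
  assumes h0: "\<And>r. r \<in> A \<Longrightarrow> 0 \<le> h r"
    and hsum: "\<And>F. finite F \<Longrightarrow> F \<subseteq> A \<Longrightarrow> sum h F \<le> H"
    and lower: "\<And>r. r \<in> A \<Longrightarrow> ereal (- h r) \<le> g r"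
  shows "infsum g A =
      (SUP F\<in>{F. finite F \<and> F \<subseteq> A}. \<Sum>r\<in>F. g r + ereal (h r)) - ereal (infsum h A)"
    and "0 \<le> infsum h A" and "infsum h A \<le> H"
    and "\<And>F. finite F \<Longrightarrow> F \<subseteq> A \<Longrightarrow> sum h F \<le> infsum h A"
proof -
  have sh: "h summable_on A"
  proof (rule nonneg_bdd_above_summable_on)
    show "bdd_above (sum h ` {F. F \<subseteq> A \<and> finite F})"
      using hsum by (intro bdd_aboveI[of _ H]) auto
  qed (rule h0)
  show "0 \<le> infsum h A" using h0 by (rule infsum_nonneg)
  show "infsum h A \<le> H" using sh hsum by (rule infsum_le_finite_sums)
  show "sum h F \<le> infsum h A" if "finite F" "F \<subseteq> A" for F
    using sh that h0 by (intro finite_sum_le_infsum) auto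
  define S where "S = (SUP F\<in>{F. finite F \<and> F \<subseteq> A}. \<Sum>r\<in>F. g r + ereal (h r))"
  have nonneg: "0 \<le> g r + ereal (h r)" if "r \<in> A" for r
    using lower[OF that] by (cases "g r") auto
  have "((\<lambda>r. g r + ereal (h r)) has_sum S) A"
    unfolding S_def using nonneg by (rule nonneg_has_sum_complete)
  then have 1: "((\<lambda>F. \<Sum>r\<in>F. g r + ereal (h r)) \<longlongrightarrow> S) (finite_subsets_at_top A)"
    by (simp add: has_sum_def)
  have "(sum h \<longlongrightarrow> infsum h A) (finite_subsets_at_top A)"
    using has_sum_infsum[OF sh] by (simp add: has_sum_def)
  then have 2: "((\<lambda>F. ereal (sum h F)) \<longlongrightarrow> ereal (infsum h A)) (finite_subsets_at_top A)"
    by simp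
  have "((\<lambda>F. (\<Sum>r\<in>F. g r + ereal (h r)) - ereal (sum h F)) \<longlongrightarrow> S - ereal (infsum h A))
      (finite_subsets_at_top A)"
    by (rule tendsto_diff_ereal_general[OF 1 2]) auto
  moreover have "(\<Sum>r\<in>F. g r + ereal (h r)) - ereal (sum h F) = sum g F" for F
  proof -
    have "(\<Sum>r\<in>F. g r + ereal (h r)) = sum g F + ereal (sum h F)"
      by (simp add: sum.distrib)
    then show ?thesis by (cases "sum g F") auto
  qed
  ultimately have "(g has_sum (S - ereal (infsum h A))) A" by (simp add: has_sum_def)
  then show "infsum g A = S - ereal (infsum h A)" by (rule infsumI)
qed

section \<open>Product bounds for the potential\<close>

lemma kap_ge_infnorm:
  fixes x :: "real ^ 'd"
  assumes "s \<le> 0"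
  shows "(1 + infnorm x) powr (s * real CARD('d)) \<le> kap s x"
proof -
  have "(1 + infnorm x) powr (s * real CARD('d)) = ((1 + infnorm x) powr s) ^ CARD('d)"
    using infnorm_pos_le[of x] by (simp add: powr_powr[symmetric] powr_realpow)
  also have "\<dots> = (\<Prod>i\<in>(UNIV :: 'd set). (1 + infnorm x) powr s)" by simp
  also have "\<dots> \<le> kap s x"
    unfolding kap_def
  proof (intro prod_mono conjI powr_mono2' assms)
    show "1 + \<bar>x $ i\<bar> \<le> 1 + infnorm x" for i using component_le_infnorm_cart[of x i] by simp
  qed auto
  finally show ?thesis .
qed

text \<open>The exponent of temperedness is shared equally among the coordinates, each of which
  receives \<open>- 1 - \<epsilon> / d\<close>, still below the critical value. The constants absorb
  the ball of radius \<open>R\<close> and the passage from \<open>infnorm x\<close> to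
  \<open>1 + infnorm x\<close>.\<close>

lemma kap_dominates:
  fixes \<epsilon> R :: real
  assumes "R > 0" "\<epsilon> > 0"
  defines "s \<equiv> - 1 - \<epsilon> / real CARD('d)" and "e \<equiv> - real CARD('d) - \<epsilon>"
  shows "infnorm x \<le> R \<Longrightarrow> 1 \<le> (1 + R) powr (- e) * kap s (x :: real ^ 'd)"
    and "R \<le> infnorm x \<Longrightarrow> infnorm x powr e \<le> (R / (1 + R)) powr e * kap s x"
proof -
  have se: "s * real CARD('d) = e" by (simp add: s_def e_def field_simps)
  have "0 \<le> \<epsilon> / real CARD('d)" using assms(2) by simp
  then have "s \<le> 0" unfolding s_def by linarith
  then have k: "(1 + infnorm x) powr e \<le> kap s x" using kap_ge_infnorm[of s x] se by simp
  have e0: "e \<le> 0" using assms by (simp add: e_def)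
  have n0: "0 \<le> infnorm x" by (rule infnorm_pos_le)
  show "1 \<le> (1 + R) powr (- e) * kap s x" if "infnorm x \<le> R"
  proof -
    have "1 = (1 + R) powr (- e) * (1 + R) powr e"
      using assms by (simp add: powr_add[symmetric])
    also have "\<dots> \<le> (1 + R) powr (- e) * (1 + infnorm x) powr e"
      using that e0 n0 by (intro mult_left_mono powr_mono2') auto
    also have "\<dots> \<le> (1 + R) powr (- e) * kap s x" using k by (intro mult_left_mono) auto
    finally show ?thesis .
  qed
  show "infnorm x powr e \<le> (R / (1 + R)) powr e * kap s x" if "R \<le> infnorm x"
  proof -
    have "R / (1 + R) * (1 + infnorm x) \<le> infnorm x"
      using that assms by (simp add: field_simps)
    then have "infnorm x powr e \<le> (R / (1 + R) * (1 + infnorm x)) powr e"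
      using e0 n0 assms by (intro powr_mono2') auto
    also have "\<dots> = (R / (1 + R)) powr e * (1 + infnorm x) powr e" by (rule powr_mult)
    also have "\<dots> \<le> (R / (1 + R)) powr e * kap s x" using k by (intro mult_left_mono) auto
    finally show ?thesis .
  qed
qed

text \<open>Inside the ball of radius \<open>R\<close> (BB) gives the lower bound and the second
  half of (RP) the upper one; outside, (T) gives both. One formula \<open>B m\<close> serves for
  either constant, its \<open>+ 1\<close> making it positive.\<close>

lemma potential_kap_bounds:
  fixes \<phi> :: "real ^ 'd \<Rightarrow> ereal"
  assumes rep: "strongly_repulsive \<phi>" and low: "lower_bounded_potential \<phi>" and temp: "tempered \<phi>"
  obtains \<theta> B where "\<theta> > 0" "B > 0" "\<And>x. ereal (- (B * kap (- 1 - \<theta>) x)) \<le> \<phi> x"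
    "\<And>r. r > 0 \<Longrightarrow> \<exists>B'\<ge>0. \<forall>x. r \<le> infnorm x \<longrightarrow> \<phi> x \<le> ereal (B' * kap (- 1 - \<theta>) x)"
proof -
  obtain M where M: "\<And>x. ereal (- M) \<le> \<phi> x" using low by (auto simp: lower_bounded_potential_def)
  obtain G R \<epsilon> where G: "R > 0" "\<epsilon> > 0"
      "\<And>x. R \<le> infnorm x \<Longrightarrow> \<bar>\<phi> x\<bar> \<le> ereal (G * infnorm x powr (- real CARD('d) - \<epsilon>))"
    using temp unfolding tempered_def by blast
  define s where "s = - 1 - \<epsilon> / real CARD('d)"
  define e where "e = - real CARD('d) - \<epsilon>"
  define C1 where "C1 = (1 + R) powr (- e)"
  define C2 where "C2 = (R / (1 + R)) powr e"
  note kap = kap_dominates[OF G(1,2), where 'd='d, folded s_def e_def, folded C1_def C2_def]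
  have C: "0 \<le> C1" "0 \<le> C2" by (auto simp: C1_def C2_def)
  define B where "B m = \<bar>m\<bar> * C1 + \<bar>G\<bar> * C2 + 1" for m
  have B0: "0 < B m" for m using C by (simp add: B_def add_nonneg_pos)
  have near: "\<bar>m\<bar> \<le> B m * kap s x" if "infnorm x \<le> R" for m and x :: "real ^ 'd"
  proof -
    have "\<bar>m\<bar> * 1 \<le> \<bar>m\<bar> * (C1 * kap s x)" using kap(1)[OF that] by (intro mult_left_mono) auto
    also have "\<dots> \<le> B m * kap s x"
      using C kap_pos[of s x] by (simp add: B_def algebra_simps)
    finally show ?thesis by simp
  qed
  have far: "\<bar>\<phi> x\<bar> \<le> ereal (B m * kap s x)" if "R \<le> infnorm x" for m and x :: "real ^ 'd"
  proof -
    have "G * infnorm x powr e \<le> \<bar>G\<bar> * (C2 * kap s x)"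
      using kap(2)[OF that] by (intro mult_mono) auto
    also have "\<dots> \<le> B m * kap s x"
      using C kap_pos[of s x] by (simp add: B_def algebra_simps)
    finally show ?thesis using G(3)[OF that] by (simp add: e_def order_trans)
  qed
  show thesis
  proof (rule that[of "\<epsilon> / real CARD('d)" "B M"])
    show "\<epsilon> / real CARD('d) > 0" using G by simp
    show "B M > 0" by (rule B0)
    show "ereal (- (B M * kap (- 1 - \<epsilon> / real CARD('d)) x)) \<le> \<phi> x" for x
      unfolding s_def[symmetric]
    proof (cases "infnorm x \<le> R")
      case True
      then have "ereal (- (B M * kap s x)) \<le> ereal (- M)" using near[of x M] by simp
      then show "ereal (- (B M * kap s x)) \<le> \<phi> x" using M[of x] by (rule order_trans)
    next
      case False
      then show "ereal (- (B M * kap s x)) \<le> \<phi> x" using far[of x M] by (cases "\<phi> x") auto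
    qed
    show "\<exists>B'\<ge>0. \<forall>x. r \<le> infnorm x \<longrightarrow> \<phi> x \<le> ereal (B' * kap (- 1 - \<epsilon> / real CARD('d)) x)"
      if r: "r > 0" for r
    proof -
      obtain b where b: "\<And>x. r \<le> infnorm x \<Longrightarrow> \<phi> x \<le> ereal b"
        using rep r unfolding strongly_repulsive_def by blast
      have "\<phi> x \<le> ereal (B b * kap s x)" if "r \<le> infnorm x" for x
      proof (cases "infnorm x \<le> R")
        case True
        then have "ereal b \<le> ereal (B b * kap s x)" using near[of x b] by simp
        then show ?thesis using b[OF that] by (rule order_trans[rotated])
      next
        case False
        then show ?thesis using far[of x b] by (cases "\<phi> x") auto
      qed
      then show ?thesis unfolding s_def[symmetric] using B0[of b] by (intro exI[of _ "B b"]) auto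
    qed
  qed
qed

section \<open>Symmetry, measurability and bounds of the lattice sum\<close>

lemma lattice_sum_uminus:
  assumes "\<And>x. \<phi> (- x) = \<phi> x"
  shows "lattice_sum \<phi> L (- y) = lattice_sum \<phi> L y"
proof -
  have "(\<Sum>\<^sub>\<infinity>r\<in>int_lattice. \<phi> (- y + (2 * L) *\<^sub>R r)) = (\<Sum>\<^sub>\<infinity>r\<in>int_lattice. \<phi> (- y + (2 * L) *\<^sub>R (- r)))"
    by (rule infsum_reindex_bij_betw[symmetric])
      (rule bij_betwI[where g=uminus], auto simp: int_lattice_def)
  also have "\<dots> = (\<Sum>\<^sub>\<infinity>r\<in>int_lattice. \<phi> (y + (2 * L) *\<^sub>R r))"
  proof (rule infsum_cong)
    fix r
    have "- y + (2 * L) *\<^sub>R (- r) = - (y + (2 * L) *\<^sub>R r)" by simp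
    then show "\<phi> (- y + (2 * L) *\<^sub>R (- r)) = \<phi> (y + (2 * L) *\<^sub>R r)" using assms by metis
  qed
  finally show ?thesis by (simp add: lattice_sum_def)
qed

lemma countable_int_lattice: "countable (int_lattice :: (real ^ 'd) set)"
proof (rule countable_subset)
  show "(int_lattice :: (real ^ 'd) set) \<subseteq> range (\<lambda>g :: 'd \<Rightarrow> int. \<chi> i. real_of_int (g i))"
  proof
    fix r :: "real ^ 'd" assume "r \<in> int_lattice"
    then have "r = (\<chi> i. real_of_int (\<lfloor>r $ i\<rfloor>))"
      by (auto simp: vec_eq_iff int_lattice_def)
    then show "r \<in> range (\<lambda>g :: 'd \<Rightarrow> int. \<chi> i. real_of_int (g i))"
      by (rule image_eqI[where x="\<lambda>i. \<lfloor>r $ i\<rfloor>"]) simp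
  qed
qed auto

text \<open>The shifted sum is a supremum over the countably many finite sets of lattice points. The
  formula is available where all coordinates of \<open>y\<close> are below \<open>2 * L\<close>, so
  the lattice sum is only shown to agree there with a measurable \<open>W\<close>.\<close>

lemma lattice_sum_measurable:
  fixes \<phi> :: "real ^ 'd \<Rightarrow> ereal" and s S B L :: real
  assumes meas [measurable]: "\<phi> \<in> borel_measurable borel"
    and s: "s \<le> 0" and S: "\<And>n::nat. (\<Sum>t<n. (1 + real t) powr s) \<le> S" and B: "0 \<le> B" and L: "1 \<le> L"
    and lower: "\<And>x. ereal (- (B * kap s x)) \<le> \<phi> x"
  shows "\<exists>W\<in>borel_measurable borel. \<forall>y. (\<forall>i. \<bar>y $ i\<bar> < 2 * L) \<longrightarrow> lattice_sum \<phi> L y = W y"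
proof -
  \<comment> \<open>Independent of \<open>y\<close>, by \<open>tkap \<le> 1\<close>, so that the
    same shift can be used at all points.\<close>
  define h :: "real ^ 'd \<Rightarrow> real" where "h r = B * (((1 / 3) powr s) ^ CARD('d) * kap s r)" for r
  define W where "W y = (SUP F\<in>{F. finite F \<and> F \<subseteq> int_lattice}.
      \<Sum>r\<in>F. \<phi> (y + (2 * L) *\<^sub>R r) + ereal (h r)) - ereal (infsum h int_lattice)" for y
  have "lattice_sum \<phi> L y = W y" if y: "\<forall>i. \<bar>y $ i\<bar> < 2 * L" for y
    unfolding lattice_sum_def W_def
  proof (rule infsum_ereal_shift(1))
    show "0 \<le> h r" for r using B kap_pos[of s r] by (simp add: h_def)
    show "sum h F \<le> B * (((1 / 3) powr s) ^ CARD('d) * (2 * S) ^ CARD('d))"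
      if "finite F" "F \<subseteq> int_lattice" for F
      unfolding h_def sum_distrib_left[symmetric]
      by (intro mult_left_mono sum_kap_lattice_le S that B) auto
    show "ereal (- h r) \<le> \<phi> (y + (2 * L) *\<^sub>R r)" if r: "r \<in> int_lattice" for r
    proof -
      have k0: "0 \<le> ((1 / 3) powr s) ^ CARD('d) * kap s r" using kap_pos[of s r] by simp
      have "kap s (y + (2 * L) *\<^sub>R r) \<le> tkap s L y * (((1 / 3) powr s) ^ CARD('d) * kap s r)"
        using y L r s by (intro kap_periods_le) auto
      also have "\<dots> \<le> 1 * (((1 / 3) powr s) ^ CARD('d) * kap s r)"
        using tkap_bounds[of y L s] y s k0 by (intro mult_right_mono) auto
      finally have "B * kap s (y + (2 * L) *\<^sub>R r) \<le> h r"
        unfolding h_def using B by (simp add: mult_left_mono)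
      then have "ereal (- h r) \<le> ereal (- (B * kap s (y + (2 * L) *\<^sub>R r)))" by simp
      then show ?thesis using lower by (rule order_trans)
    qed
  qed
  moreover have "W \<in> borel_measurable borel"
  proof -
    have [measurable]: "(\<lambda>y. SUP F\<in>{F. finite F \<and> F \<subseteq> int_lattice}.
        \<Sum>r\<in>F. \<phi> (y + (2 * L) *\<^sub>R r) + ereal (h r)) \<in> borel_measurable borel"
    proof (rule borel_measurable_SUP)
      show "countable {F. finite F \<and> F \<subseteq> (int_lattice :: (real ^ 'd) set)}"
        by (rule countable_Collect_finite_subset[OF countable_int_lattice])
      show "(\<lambda>y. \<Sum>r\<in>F. \<phi> (y + (2 * L) *\<^sub>R r) + ereal (h r)) \<in> borel_measurable borel" for F
        by measurable
    qed
    show ?thesis unfolding W_def by measurable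
  qed
  ultimately show ?thesis by blast
qed

text \<open>All three are read off the supremum formula: the empty set leaves only the total
  attraction, the singleton \<open>{0}\<close> keeps the repulsive term \<open>\<phi> y\<close>, and
  a bound on all finite sets gives the upper estimate.\<close>

lemma lattice_sum_bounds:
  fixes \<phi> :: "real ^ 'd \<Rightarrow> ereal" and s S B L :: real
  assumes s: "s \<le> 0" and S: "\<And>n::nat. (\<Sum>t<n. (1 + real t) powr s) \<le> S" and B: "0 \<le> B" and L: "1 \<le> L"
    and lower: "\<And>x. ereal (- (B * kap s x)) \<le> \<phi> x" and y: "\<And>i. \<bar>y $ i\<bar> < 2 * L"
  defines "H \<equiv> ((1 / 3) powr s) ^ CARD('d) * (2 * S) ^ CARD('d)"
  shows "ereal (- (B * H * tkap s L y)) \<le> lattice_sum \<phi> L y"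
    and "\<phi> y - ereal (B * H) \<le> lattice_sum \<phi> L y"
    and "\<And>B'. 0 \<le> B' \<Longrightarrow>
      (\<And>r. r \<in> int_lattice \<Longrightarrow> \<phi> (y + (2 * L) *\<^sub>R r) \<le> ereal (B' * kap s (y + (2 * L) *\<^sub>R r))) \<Longrightarrow>
      lattice_sum \<phi> L y \<le> ereal (B' * H * tkap s L y)"
proof -
  define c :: "real ^ 'd \<Rightarrow> real" where "c r = tkap s L y * (((1 / 3) powr s) ^ CARD('d) * kap s r)" for r
  have tk: "0 \<le> tkap s L y" "tkap s L y \<le> 1"
    using tkap_bounds[of y L s] y s by auto
  have c0: "0 \<le> c r" for r using tk kap_pos[of s r] by (simp add: c_def)
  have csum: "sum c F \<le> H * tkap s L y" if "finite F" "F \<subseteq> int_lattice" for F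
  proof -
    have "sum c F \<le> tkap s L y * (((1 / 3) powr s) ^ CARD('d) * (2 * S) ^ CARD('d))"
      unfolding c_def sum_distrib_left[symmetric]
      by (intro mult_left_mono sum_kap_lattice_le S that tk) auto
    then show ?thesis by (simp add: H_def ac_simps)
  qed
  have kc: "kap s (y + (2 * L) *\<^sub>R r) \<le> c r" if "r \<in> int_lattice" for r
    unfolding c_def using y L that s by (intro kap_periods_le) auto
  define h where "h r = B * c r" for r
  have h0: "0 \<le> h r" if "r \<in> int_lattice" for r using B c0 by (simp add: h_def)
  have hsum: "sum h F \<le> B * H * tkap s L y" if "finite F" "F \<subseteq> int_lattice" for F
    using mult_left_mono[OF csum[OF that] B] by (simp add: h_def sum_distrib_left[symmetric] mult.assoc)
  have hlow: "ereal (- h r) \<le> \<phi> (y + (2 * L) *\<^sub>R r)" if "r \<in> int_lattice" for r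
  proof -
    have "ereal (- h r) \<le> ereal (- (B * kap s (y + (2 * L) *\<^sub>R r)))"
      using kc[OF that] B by (simp add: h_def mult_left_mono)
    then show ?thesis using lower by (rule order_trans)
  qed
  note sh = infsum_ereal_shift[of int_lattice h "B * H * tkap s L y"
      "\<lambda>r. \<phi> (y + (2 * L) *\<^sub>R r)", OF h0 hsum hlow]
  define U where "U F = (\<Sum>r\<in>F. \<phi> (y + (2 * L) *\<^sub>R r) + ereal (h r))" for F
  define Q where "Q = {F. finite F \<and> F \<subseteq> (int_lattice :: (real ^ 'd) set)}"
  have eq: "lattice_sum \<phi> L y = (SUP F\<in>Q. U F) - ereal (infsum h int_lattice)"
    unfolding lattice_sum_def U_def Q_def by (rule sh(1))
  have "U {} \<le> (SUP F\<in>Q. U F)" by (rule SUP_upper) (simp add: Q_def)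
  then have "0 \<le> (SUP F\<in>Q. U F)" by (simp add: U_def)
  then have "0 - ereal (infsum h int_lattice) \<le> lattice_sum \<phi> L y"
    unfolding eq by (intro ereal_minus_mono) auto
  moreover have "ereal (- (B * H * tkap s L y)) \<le> 0 - ereal (infsum h int_lattice)"
    using sh(3) by simp
  ultimately show "ereal (- (B * H * tkap s L y)) \<le> lattice_sum \<phi> L y" by (rule order_trans[rotated])
  show "\<phi> y - ereal (B * H) \<le> lattice_sum \<phi> L y"
  proof -
    have "U {0} \<le> (SUP F\<in>Q. U F)" by (rule SUP_upper) (simp add: Q_def int_lattice_def)
    moreover have "\<phi> y \<le> U {0}" using B c0[of 0] by (simp add: U_def h_def ereal_le_add_self)
    ultimately have "\<phi> y \<le> (SUP F\<in>Q. U F)" by (rule order_trans[rotated])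
    moreover have "infsum h int_lattice \<le> B * H"
    proof -
      have "H \<ge> 0"
        using csum[of "{}"] S[of 0] by (simp add: H_def)
      then have "B * H * tkap s L y \<le> B * H * 1" using tk B by (intro mult_left_mono) auto
      then show ?thesis using sh(3) by simp
    qed
    ultimately show ?thesis unfolding eq by (intro ereal_minus_mono) auto
  qed
  show "lattice_sum \<phi> L y \<le> ereal (B' * H * tkap s L y)" if B': "0 \<le> B'"
    and up: "\<And>r. r \<in> int_lattice \<Longrightarrow> \<phi> (y + (2 * L) *\<^sub>R r) \<le> ereal (B' * kap s (y + (2 * L) *\<^sub>R r))" for B'
  proof -
    have "(SUP F\<in>Q. U F) \<le> ereal (B' * H * tkap s L y + infsum h int_lattice)"
    proof (rule SUP_least)
      fix F assume F: "F \<in> Q"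
      have "U F \<le> (\<Sum>r\<in>F. ereal (B' * c r) + ereal (h r))"
        unfolding U_def
      proof (intro sum_mono add_right_mono)
        fix r assume "r \<in> F"
        then have r: "r \<in> int_lattice" using F by (auto simp: Q_def)
        have "ereal (B' * kap s (y + (2 * L) *\<^sub>R r)) \<le> ereal (B' * c r)"
          using kc[OF r] B' by (simp add: mult_left_mono)
        then show "\<phi> (y + (2 * L) *\<^sub>R r) \<le> ereal (B' * c r)" using up[OF r] by (rule order_trans[rotated])
      qed
      also have "\<dots> = ereal (B' * sum c F + sum h F)"
        by (simp add: sum.distrib sum_distrib_left)
      also have "\<dots> \<le> ereal (B' * H * tkap s L y + infsum h int_lattice)"
        using mult_left_mono[OF csum B', of F] sh(4)[of F] F by (simp add: Q_def mult.assoc add_mono)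
      finally show "U F \<le> ereal (B' * H * tkap s L y + infsum h int_lattice)" .
    qed
    then have "lattice_sum \<phi> L y \<le>
        ereal (B' * H * tkap s L y + infsum h int_lattice) - ereal (infsum h int_lattice)"
      unfolding eq by (intro ereal_minus_mono) auto
    then show ?thesis by simp
  qed
qed

section \<open>Cutting the box into cells\<close>

definition box_cell :: "real \<Rightarrow> real \<Rightarrow> real ^ 'd \<Rightarrow> 'd \<Rightarrow> int" where
  "box_cell L \<delta> x = (\<lambda>i. \<lceil>(x $ i + L) / \<delta>\<rceil>)"

text \<open>Strict because the box is half-open. This puts differences of its points into the open
  cube on which \<open>periodized\<close> is the lattice sum.\<close>

lemma box_diff_less:
  assumes "x \<in> box_\<Lambda> L" "y \<in> box_\<Lambda> L"
  shows "\<bar>(x - y) $ i\<bar> < 2 * L"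
proof -
  have "- L < x $ i" "x $ i \<le> L" "- L < y $ i" "y $ i \<le> L"
    using assms by (auto simp: box_\<Lambda>_def)
  then show ?thesis by (simp add: abs_less_iff)
qed

lemma box_cell_in:
  assumes "0 < \<delta>" "real_of_int k * \<delta> = 2 * L" "x \<in> box_\<Lambda> L"
  shows "box_cell L \<delta> x \<in> cells k"
  unfolding cells_iff
proof
  fix i
  have x: "- L < x $ i" "x $ i \<le> L" using assms by (auto simp: box_\<Lambda>_def)
  have "0 < (x $ i + L) / \<delta>" "(x $ i + L) / \<delta> \<le> real_of_int k"
    using x assms by (auto simp: field_simps)
  then show "box_cell L \<delta> x i \<in> {1..k}"
    unfolding box_cell_def by (auto simp: ceiling_le_iff)
qed

text \<open>Rounding up in \<open>box_cell\<close> matches the half-open box: a cell is a product of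
  intervals closed on the right, caught between an open and a closed box of the same volume.\<close>

lemma box_cell_measure:
  fixes q :: "'d::finite \<Rightarrow> int"
  assumes \<delta>: "0 < \<delta>" and k: "real_of_int k * \<delta> = 2 * L" and q: "q \<in> cells k"
  shows "{x \<in> box_\<Lambda> L. box_cell L \<delta> x = q} \<in> sets lborel"
    and "emeasure lborel {x \<in> box_\<Lambda> L. box_cell L \<delta> x = q} = ennreal (\<delta> ^ CARD('d))"
proof -
  define l u :: "real ^ 'd" where "l = (\<chi> i. \<delta> * (real_of_int (q i) - 1) - L)"
    and "u = (\<chi> i. \<delta> * real_of_int (q i) - L)"
  have eq: "{x \<in> box_\<Lambda> L. box_cell L \<delta> x = q} = {x. \<forall>i. l $ i < x $ i \<and> x $ i \<le> u $ i}"
  proof (intro set_eqI)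
    fix x :: "real ^ 'd"
    have c: "\<lceil>(x $ i + L) / \<delta>\<rceil> = q i \<longleftrightarrow> l $ i < x $ i \<and> x $ i \<le> u $ i" for i
      using \<delta> by (simp add: ceiling_eq_iff l_def u_def field_simps)
    have b: "- L < x $ i \<and> x $ i \<le> L" if "l $ i < x $ i \<and> x $ i \<le> u $ i" for i
    proof -
      have "1 \<le> q i" "q i \<le> k" using q by (auto simp: cells_iff)
      then have "\<delta> * 1 \<le> \<delta> * real_of_int (q i)" "\<delta> * real_of_int (q i) \<le> \<delta> * real_of_int k"
        using \<delta> by (auto intro!: mult_left_mono)
      moreover define t where "t = \<delta> * real_of_int (q i)"
      ultimately have "\<delta> \<le> t" "t \<le> 2 * L" using k by (auto simp: mult.commute)
      moreover have "t - \<delta> - L < x $ i" "x $ i \<le> t - L"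
        using that by (auto simp: l_def u_def t_def algebra_simps)
      ultimately show ?thesis by linarith
    qed
    show "x \<in> {x \<in> box_\<Lambda> L. box_cell L \<delta> x = q} \<longleftrightarrow> x \<in> {x. \<forall>i. l $ i < x $ i \<and> x $ i \<le> u $ i}"
      using c b by (auto simp: box_cell_def box_\<Lambda>_def fun_eq_iff)
  qed
  have "{x. \<forall>i. l $ i < x $ i \<and> x $ i \<le> u $ i} \<in> sets (borel :: (real ^ 'd) measure)" by measurable
  then show meas: "{x \<in> box_\<Lambda> L. box_cell L \<delta> x = q} \<in> sets lborel" unfolding eq by simp
  have side: "(u - l) \<bullet> b = \<delta>" "l \<bullet> b \<le> u \<bullet> b" if b: "b \<in> Basis" for b
  proof -
    obtain i where "b = axis i 1" using b by (auto simp: Basis_vec_def)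
    then show "(u - l) \<bullet> b = \<delta>" "l \<bullet> b \<le> u \<bullet> b"
      using \<delta> by (auto simp: inner_axis l_def u_def algebra_simps)
  qed
  have vol: "emeasure lborel (box l u) = ennreal (\<delta> ^ CARD('d))"
    "emeasure lborel (cbox l u) = ennreal (\<delta> ^ CARD('d))"
    using side by (auto simp: emeasure_lborel_box emeasure_lborel_cbox)
  have "box l u \<subseteq> {x. \<forall>i. l $ i < x $ i \<and> x $ i \<le> u $ i}"
    "{x. \<forall>i. l $ i < x $ i \<and> x $ i \<le> u $ i} \<subseteq> cbox l u"
    by (auto simp: mem_box_cart less_imp_le)
  then have "emeasure lborel (box l u) \<le> emeasure lborel {x \<in> box_\<Lambda> L. box_cell L \<delta> x = q}"
    "emeasure lborel {x \<in> box_\<Lambda> L. box_cell L \<delta> x = q} \<le> emeasure lborel (cbox l u)"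
    using meas unfolding eq by (auto intro!: emeasure_mono)
  then show "emeasure lborel {x \<in> box_\<Lambda> L. box_cell L \<delta> x = q} = ennreal (\<delta> ^ CARD('d))"
    unfolding vol by (rule antisym[rotated])
qed

text \<open>Rounding up changes the difference of two coordinates by at most one cell, whichever
  branch of the minimum is taken; hence the \<open>- 1\<close>.\<close>

lemma box_cell_tdist:
  assumes \<delta>: "0 < \<delta>" and k: "real_of_int k * \<delta> = 2 * L"
    and x: "x \<in> box_\<Lambda> L" and y: "y \<in> box_\<Lambda> L"
  shows "\<delta> * (real_of_int (tdist k (box_cell L \<delta> x i) (box_cell L \<delta> y i)) - 1) \<le>
    min \<bar>(x - y) $ i\<bar> (2 * L - \<bar>(x - y) $ i\<bar>)"
proof -
  define a where "a = (x $ i + L) / \<delta>"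
  define b where "b = (y $ i + L) / \<delta>"
  have ab: "\<bar>(x - y) $ i\<bar> = \<delta> * \<bar>a - b\<bar>"
  proof -
    have "(x - y) $ i = \<delta> * (a - b)" using \<delta> by (simp add: a_def b_def field_simps)
    then show ?thesis using \<delta> by (simp add: abs_mult)
  qed
  have d: "\<bar>real_of_int (\<lceil>a\<rceil> - \<lceil>b\<rceil>)\<bar> \<le> \<bar>a - b\<bar> + 1" "\<bar>a - b\<bar> \<le> \<bar>real_of_int (\<lceil>a\<rceil> - \<lceil>b\<rceil>)\<bar> + 1"
    by linarith+
  have "box_cell L \<delta> x i \<in> {1..k}" "box_cell L \<delta> y i \<in> {1..k}"
    using box_cell_in[OF \<delta> k x] box_cell_in[OF \<delta> k y] unfolding cells_iff by blast+
  \<comment> \<open>Makes the \<open>max 0\<close> in \<open>tdist\<close> inactive.\<close>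
  then have kk: "\<bar>\<lceil>a\<rceil> - \<lceil>b\<rceil>\<bar> \<le> k"
    unfolding box_cell_def a_def[symmetric] b_def[symmetric] atLeastAtMost_iff by linarith
  then have t: "real_of_int (tdist k \<lceil>a\<rceil> \<lceil>b\<rceil>) \<le> \<bar>real_of_int (\<lceil>a\<rceil> - \<lceil>b\<rceil>)\<bar>"
    "real_of_int (tdist k \<lceil>a\<rceil> \<lceil>b\<rceil>) \<le> real_of_int k - \<bar>real_of_int (\<lceil>a\<rceil> - \<lceil>b\<rceil>)\<bar>"
    by (auto simp: tdist_def)
  have "real_of_int (tdist k \<lceil>a\<rceil> \<lceil>b\<rceil>) - 1 \<le> \<bar>a - b\<bar>"
    "real_of_int (tdist k \<lceil>a\<rceil> \<lceil>b\<rceil>) - 1 \<le> real_of_int k - \<bar>a - b\<bar>"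
    using d t by linarith+
  then have "\<delta> * (real_of_int (tdist k \<lceil>a\<rceil> \<lceil>b\<rceil>) - 1) \<le> \<delta> * \<bar>a - b\<bar>"
    "\<delta> * (real_of_int (tdist k \<lceil>a\<rceil> \<lceil>b\<rceil>) - 1) \<le> \<delta> * (real_of_int k - \<bar>a - b\<bar>)"
    using \<delta> by (intro mult_left_mono; simp)+
  moreover have "\<delta> * (real_of_int k - \<bar>a - b\<bar>) = 2 * L - \<delta> * \<bar>a - b\<bar>"
    using k by (simp add: algebra_simps)
  ultimately show ?thesis unfolding ab by (simp add: box_cell_def a_def b_def)
qed

text \<open>By \<open>1 / (2 * real m) \<le> \<delta> \<le> 1 / 2\<close>, the number
  \<open>1 + \<delta> * (t - 1)\<close> is at least \<open>1 / 2 + t / (2 * m)\<close>, which leaves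
  room for the factor \<open>1 / 4\<close>.\<close>

lemma tkap_le_cell_dist:
  fixes x y :: "real ^ 'd"
  assumes m: "2 \<le> m" and \<delta>: "1 / (2 * real m) \<le> \<delta>" "\<delta> \<le> 1 / real m" and k: "real_of_int k * \<delta> = 2 * L"
    and x: "x \<in> box_\<Lambda> L" and y: "y \<in> box_\<Lambda> L" and s: "s \<le> 0"
  shows "tkap s L (x - y) \<le> ((1 / 4) powr s) ^ CARD('d) *
    cell_dist m k (box_cell L \<delta> x) (box_cell L \<delta> y) powr s"
proof -
  have \<delta>0: "0 < \<delta>" using m \<delta>(1) by (intro less_le_trans[OF _ \<delta>(1)]) auto
  define t where "t i = real_of_int (tdist k (box_cell L \<delta> x i) (box_cell L \<delta> y i))" for i
  have t0: "0 \<le> t i" for i by (simp add: t_def)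
  have "tkap s L (x - y) \<le> (\<Prod>i\<in>(UNIV :: 'd set). (1 / 4) powr s * (1 + t i / real m) powr s)"
    unfolding tkap_def
  proof (intro prod_mono conjI)
    fix i
    have "1 / real m \<le> 1 / 2" using m by (intro divide_left_mono) auto
    then have "\<delta> \<le> 1 / 2" using \<delta>(2) by linarith
    moreover have "1 / (2 * real m) * t i \<le> \<delta> * t i" using \<delta>(1) t0 by (intro mult_right_mono)
    moreover have "0 \<le> t i / real m" using t0 by simp
    ultimately have "1 / 4 * (1 + t i / real m) \<le> 1 + \<delta> * (t i - 1)"
      by (simp add: algebra_simps)
    also have "\<dots> \<le> 1 + min \<bar>(x - y) $ i\<bar> (2 * L - \<bar>(x - y) $ i\<bar>)"
      using box_cell_tdist[OF \<delta>0 k x y, of i] by (simp add: t_def)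
    finally have "(1 + min \<bar>(x - y) $ i\<bar> (2 * L - \<bar>(x - y) $ i\<bar>)) powr s \<le> (1 / 4 * (1 + t i / real m)) powr s"
      using s \<open>0 \<le> t i / real m\<close> by (intro powr_mono2') auto
    also have "\<dots> = (1 / 4) powr s * (1 + t i / real m) powr s" by (rule powr_mult)
    finally show "(1 + min \<bar>(x - y) $ i\<bar> (2 * L - \<bar>(x - y) $ i\<bar>)) powr s \<le>
      (1 / 4) powr s * (1 + t i / real m) powr s" .
  qed auto
  also have "\<dots> = ((1 / 4) powr s) ^ CARD('d) * cell_dist m k (box_cell L \<delta> x) (box_cell L \<delta> y) powr s"
    by (simp add: prod.distrib cell_dist_def prod_powr_distrib t_def)
  finally show ?thesis .
qed

lemma same_box_cell_infnorm:
  fixes x y :: "real ^ 'd"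
  assumes \<delta>: "0 < \<delta>" and eq: "box_cell L \<delta> x = box_cell L \<delta> y"
  shows "infnorm (x - y) \<le> \<delta>"
proof -
  have "\<bar>(x - y) $ i\<bar> \<le> \<delta>" for i
  proof -
    define a where "a = (x $ i + L) / \<delta>"
    define b where "b = (y $ i + L) / \<delta>"
    have "\<lceil>a\<rceil> = \<lceil>b\<rceil>" using fun_cong[OF eq, of i] by (simp add: box_cell_def a_def b_def)
    then have "\<bar>a - b\<bar> \<le> 1" by linarith
    moreover have "(x - y) $ i = \<delta> * (a - b)" using \<delta> by (simp add: a_def b_def field_simps)
    ultimately show ?thesis using \<delta> by (simp add: abs_mult)
  qed
  then show ?thesis unfolding infnorm_cart by (intro cSup_least) auto
qed

text \<open>Some coordinate has cyclic distance at least 2, of which rounding costs at most 1. The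
  torus distance is below the distance to every periodic image, so the upper bound from (RP) applies
  to all terms of the lattice sum.\<close>

lemma not_near_infnorm:
  fixes x y r :: "real ^ 'd"
  assumes \<delta>: "0 < \<delta>" and k: "real_of_int k * \<delta> = 2 * L" and L: "1 \<le> L"
    and x: "x \<in> box_\<Lambda> L" and y: "y \<in> box_\<Lambda> L" and r: "r \<in> int_lattice"
    and nn: "\<not> cell_near k (box_cell L \<delta> x) (box_cell L \<delta> y)"
  shows "\<delta> \<le> infnorm (x - y + (2 * L) *\<^sub>R r)"
proof -
  obtain i where "\<not> tdist k (box_cell L \<delta> x i) (box_cell L \<delta> y i) \<le> 1"
    using nn by (auto simp: cell_near_def)
  then have i: "2 \<le> tdist k (box_cell L \<delta> x i) (box_cell L \<delta> y i)" by simp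
  obtain z :: int where z: "r $ i = of_int z" using r by (auto simp: int_lattice_def elim: Ints_cases)
  have "2 \<le> real_of_int (tdist k (box_cell L \<delta> x i) (box_cell L \<delta> y i))" using i by linarith
  then have "\<delta> * 1 \<le> \<delta> * (real_of_int (tdist k (box_cell L \<delta> x i) (box_cell L \<delta> y i)) - 1)"
    using \<delta> by (intro mult_left_mono) auto
  also have "\<dots> \<le> min \<bar>(x - y) $ i\<bar> (2 * L - \<bar>(x - y) $ i\<bar>)" by (rule box_cell_tdist[OF \<delta> k x y])
  also have "\<dots> \<le> \<bar>(x - y) $ i + 2 * L * z\<bar>"
    by (rule tdist_periods_le(1)[OF box_diff_less[OF x y] L])
  also have "\<dots> = \<bar>(x - y + (2 * L) *\<^sub>R r) $ i\<bar>" using z by simp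
  also have "\<dots> \<le> infnorm (x - y + (2 * L) *\<^sub>R r)" by (rule component_le_infnorm_cart)
  finally show ?thesis by simp
qed

section \<open>Keeping chosen pair factors of one fixed particle\<close>

context cell_gas
begin

text \<open>The exponent runs over all of \<open>I\<close>: its surplus terms over \<open>J\<close>
  are nonnegative, and the full sum is the ghost term of
  \<open>fixed_particles_bound\<close>.\<close>

lemma prod_f_le:
  assumes I: "finite I" "J \<subseteq> I" and x: "x \<in> \<Lambda>" and z: "\<And>i. i \<in> I \<Longrightarrow> z i \<in> \<Lambda>"
  shows "(\<Prod>i\<in>I. f x (z i)) \<le> (\<Prod>i\<in>J. f x (z i)) * exp (\<Sum>i\<in>I. attr (cell x) (cell (z i)))"
proof -
  have "(\<Prod>i\<in>I. f x (z i)) = (\<Prod>i\<in>J. f x (z i)) * (\<Prod>i\<in>I - J. f x (z i))"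
    using prod.subset_diff[OF I(2,1)] by (simp add: mult.commute)
  also have "\<dots> \<le> (\<Prod>i\<in>J. f x (z i)) * (\<Prod>i\<in>I - J. exp (attr (cell x) (cell (z i))))"
    using x z f_upper f_nonneg unfolding attr_def
    by (intro mult_left_mono prod_mono conjI prod_nonneg) auto
  also have "\<dots> = (\<Prod>i\<in>J. f x (z i)) * exp (\<Sum>i\<in>I - J. attr (cell x) (cell (z i)))"
    using I by (simp add: exp_sum)
  also have "\<dots> \<le> (\<Prod>i\<in>J. f x (z i)) * exp (\<Sum>i\<in>I. attr (cell x) (cell (z i)))"
    using I by (intro mult_left_mono prod_nonneg ballI f_nonneg) (auto intro!: sum_mono2 attr_nonneg)
  finally show ?thesis .
qed

text \<open>The kept factors involve fixed particles only, so they form a constant \<open>w\<close>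
  for the integration over the free ones.\<close>

lemma correlation_bound_prod:
  fixes x :: "nat \<Rightarrow> 'a"
  assumes n: "1 \<le> n" "n \<le> N" and k: "k \<in> {1..n}" and card: "real N \<le> \<rho> * vol"
    and x: "\<And>i. i \<in> {1..n} \<Longrightarrow> x i \<in> \<Lambda>" and J: "J \<subseteq> {1..n} - {k}"
    and C: "0 < C" "\<And>z. 1 \<le> z \<Longrightarrow> exp (- (16 * (B * \<sigma>)) * z powr \<eta>) \<le> C * z powr (- 1 - \<eta>)"
  shows "ennreal (fact N / fact (N - n)) * (1 / Zf {1..N}) *
      (\<integral>\<^sup>+y. in\<Lambda> {n+1..N} y * ennreal (boltz {1..N} (\<lambda>i. if i \<le> n then x i else y i))
        \<partial>Pi\<^sub>M {n+1..N} (\<lambda>_. M)) \<le>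
    ennreal (\<Prod>j\<in>J. f (x k) (x j)) *
      ennreal ((\<rho> / ins * exp (C * \<sigma> * \<rho> / ins + 6 * (B * \<sigma>))) ^ n)"
proof -
  define z where "z y = (\<lambda>i. if i \<le> n then x i else y i)" for y
  define w where "w = (\<Prod>j\<in>J. f (x k) (x j))"
  have w0: "0 \<le> w" unfolding w_def by (intro prod_nonneg) (auto simp: f_nonneg)
  have ptw: "in\<Lambda> {n+1..N} y * ennreal (boltz {1..N} (z y)) \<le>
      in\<Lambda> {n+1..N} y * ennreal (w * (boltz ({1..N} - {k}) (z y) *
        exp (\<Sum>i\<in>{1..N} - {k}. attr (cell (x k)) (cell (z y i)))))" for y
  proof (cases "\<forall>i\<in>{n+1..N}. y i \<in> \<Lambda>")
    case True
    have zL: "z y i \<in> \<Lambda>" if "i \<in> {1..N} - {k}" for i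
      using that x True by (cases "i \<le> n") (auto simp: z_def)
    have kN: "insert k ({1..N} - {k}) = {1..N}" using k n by auto
    have zk: "z y k = x k" using k by (simp add: z_def)
    have "boltz (insert k ({1..N} - {k})) (z y) =
        boltz ({1..N} - {k}) (z y) * (\<Prod>i\<in>{1..N} - {k}. f (z y k) (z y i))"
      by (rule boltz_insert) auto
    then have "boltz {1..N} (z y) = boltz ({1..N} - {k}) (z y) * (\<Prod>i\<in>{1..N} - {k}. f (x k) (z y i))"
      unfolding kN zk .
    also have "\<dots> \<le> boltz ({1..N} - {k}) (z y) * ((\<Prod>i\<in>J. f (x k) (z y i)) *
        exp (\<Sum>i\<in>{1..N} - {k}. attr (cell (x k)) (cell (z y i))))"
      by (intro mult_left_mono prod_f_le boltz_nonneg zL) (use J n k x in auto)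
    also have "(\<Prod>i\<in>J. f (x k) (z y i)) = w"
      unfolding w_def using J by (intro prod.cong) (auto simp: z_def)
    finally show ?thesis by (intro mult_left_mono ennreal_leI) (simp_all add: mult.left_commute)
  next
    case False
    then have "in\<Lambda> {n+1..N} y = 0" by (subst in\<Lambda>_eq) auto
    then show ?thesis by simp
  qed
  have "ennreal (fact N / fact (N - n)) * (1 / Zf {1..N}) *
      (\<integral>\<^sup>+y. in\<Lambda> {n+1..N} y * ennreal (boltz {1..N} (z y)) \<partial>Pi\<^sub>M {n+1..N} (\<lambda>_. M)) \<le>
    ennreal (fact N / fact (N - n)) * (1 / Zf {1..N}) *
      (\<integral>\<^sup>+y. in\<Lambda> {n+1..N} y * ennreal (w * (boltz ({1..N} - {k}) (z y) *
        exp (\<Sum>i\<in>{1..N} - {k}. attr (cell (x k)) (cell (z y i))))) \<partial>Pi\<^sub>M {n+1..N} (\<lambda>_. M))"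
    by (rule mult_left_mono[OF nn_integral_mono[OF ptw]]) simp
  also have "\<dots> \<le> ennreal w * ennreal ((\<rho> / ins * exp (C * \<sigma> * \<rho> / ins + 6 * (B * \<sigma>))) ^ n)"
    unfolding z_def by (rule correlation_bound[OF n k card x w0 C])
  finally show ?thesis unfolding z_def w_def .
qed

end

section \<open>Boltzmann factors of the periodized potential\<close>

text \<open>Real-valued, as logarithms of pair factors are taken. At \<open>- \<infinity>\<close> it
  takes the default value \<open>exp 0 = 1\<close>, so that value is excluded before a comparison
  with \<open>exp_ext\<close>.\<close>

definition boltzmann :: "real \<Rightarrow> ereal \<Rightarrow> real" where
  "boltzmann \<beta> u = (if u = \<infinity> then 0 else exp (- \<beta> * real_of_ereal u))"

lemma boltzmann_nonneg: "0 \<le> boltzmann \<beta> u"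
  by (simp add: boltzmann_def)

lemma exp_ext_boltzmann:
  assumes "\<beta> > 0" "u \<noteq> - \<infinity>"
  shows "exp_ext (ereal (- \<beta>) * u) = ennreal (boltzmann \<beta> u)"
proof (cases u)
  case (real r)
  then show ?thesis by (simp add: exp_ext_def boltzmann_def)
next
  case PInf
  have "exp_ext MInfty = 0" by (simp only: exp_ext_def ereal.case)
  then show ?thesis using PInf assms by (simp add: boltzmann_def)
qed (use assms in simp)

lemma boltzmann_sum:
  assumes "finite A" "\<And>i. i \<in> A \<Longrightarrow> u i \<noteq> - \<infinity>"
  shows "boltzmann \<beta> (\<Sum>i\<in>A. u i) = (\<Prod>i\<in>A. boltzmann \<beta> (u i))" and "(\<Sum>i\<in>A. u i) \<noteq> - \<infinity>"
proof -
  have "boltzmann \<beta> (\<Sum>i\<in>A. u i) = (\<Prod>i\<in>A. boltzmann \<beta> (u i)) \<and> (\<Sum>i\<in>A. u i) \<noteq> - \<infinity>"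
    using assms
  proof (induction A rule: finite_induct)
    case empty
    then show ?case by (simp add: boltzmann_def)
  next
    case (insert a A)
    then have IH: "boltzmann \<beta> (\<Sum>i\<in>A. u i) = (\<Prod>i\<in>A. boltzmann \<beta> (u i))" "(\<Sum>i\<in>A. u i) \<noteq> - \<infinity>"
      and "u a \<noteq> - \<infinity>" by auto
    have "boltzmann \<beta> (u a + (\<Sum>i\<in>A. u i)) = boltzmann \<beta> (u a) * boltzmann \<beta> (\<Sum>i\<in>A. u i)"
      "u a + (\<Sum>i\<in>A. u i) \<noteq> - \<infinity>"
      using IH(2) \<open>u a \<noteq> - \<infinity>\<close>
      by (cases "u a"; cases "\<Sum>i\<in>A. u i"; simp add: boltzmann_def exp_add[symmetric] algebra_simps)+
    then show ?case using insert IH by simp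
  qed
  then show "boltzmann \<beta> (\<Sum>i\<in>A. u i) = (\<Prod>i\<in>A. boltzmann \<beta> (u i))" "(\<Sum>i\<in>A. u i) \<noteq> - \<infinity>" by auto
qed

lemma boltzmann_le:
  assumes "\<beta> > 0" "ereal r \<le> u"
  shows "boltzmann \<beta> u \<le> exp (- \<beta> * r)"
  using assms by (cases u) (auto simp: boltzmann_def)

lemma boltzmann_ge:
  assumes "\<beta> > 0" "u \<le> ereal r" "u \<noteq> - \<infinity>"
  shows "exp (- \<beta> * r) \<le> boltzmann \<beta> u"
  using assms by (cases u) (auto simp: boltzmann_def)

lemma boltzmann_measurable [measurable]: "boltzmann \<beta> \<in> borel_measurable borel"
  unfolding boltzmann_def by measurable

text \<open>The factor is cut off outside the differences of points of the box, where the lattice sum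
  is not known to be measurable from the bounds at hand.\<close>

definition pair_factor :: "(real ^ 'd \<Rightarrow> ereal) \<Rightarrow> real \<Rightarrow> real \<Rightarrow> real ^ 'd \<Rightarrow> real ^ 'd \<Rightarrow> real" where
  "pair_factor \<phi> \<beta> L x y =
    (if \<forall>i. \<bar>(x - y) $ i\<bar> < 2 * L then boltzmann \<beta> (lattice_sum \<phi> L (x - y)) else 0)"

lemma pair_factor_box:
  "x \<in> box_\<Lambda> L \<Longrightarrow> y \<in> box_\<Lambda> L \<Longrightarrow> pair_factor \<phi> \<beta> L x y = boltzmann \<beta> (lattice_sum \<phi> L (x - y))"
  using box_diff_less by (auto simp: pair_factor_def)

text \<open>The superstability hypothesis: with cells of side at most \<open>1 / m\<close>, the repulsion \<open>\<Phi> (1 / m)\<close>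
  inside a cell beats any given multiple of the number \<open>m ^ d\<close> of cells per unit volume.\<close>

lemma repulsion_scale:
  fixes \<phi> :: "real ^ 'd \<Rightarrow> ereal" and \<kappa> b :: real
  assumes "strongly_repulsive \<phi>"
  obtains m :: nat where "2 \<le> m" "b \<le> real m"
    "\<And>x. infnorm x \<le> 1 / real m \<Longrightarrow> ereal (\<kappa> * real m ^ CARD('d)) \<le> \<phi> x"
proof -
  obtain R \<Phi> where R: "R > 0" "antimono_on {0<..} \<Phi>"
      "filterlim (\<lambda>t. \<Phi> t * t ^ CARD('d)) at_top (at_right 0)" "\<phi> 0 = \<infinity>"
      "\<And>x. 0 < infnorm x \<Longrightarrow> infnorm x \<le> R \<Longrightarrow> ereal (\<Phi> (infnorm x)) \<le> \<phi> x"
    using assms unfolding strongly_repulsive_def by blast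
  have lim: "filterlim (\<lambda>n. inverse (real n)) (at_right 0) sequentially"
    by (rule filterlim_compose[OF filterlim_inverse_at_right_top filterlim_real_sequentially])
  have "filterlim (\<lambda>n. \<Phi> (inverse (real n)) * inverse (real n) ^ CARD('d)) at_top sequentially"
    by (rule filterlim_compose[OF R(3) lim])
  then have "\<forall>\<^sub>F n in sequentially. \<kappa> \<le> \<Phi> (inverse (real n)) * inverse (real n) ^ CARD('d)"
    by (simp add: filterlim_at_top)
  moreover have "\<forall>\<^sub>F n in sequentially. inverse (real n) < R"
    using lim R(1) unfolding filterlim_at by (auto dest!: order_tendstoD(2)[of _ 0 _ R])
  moreover have "\<forall>\<^sub>F n in sequentially. max 2 b \<le> real n"
    using filterlim_real_sequentially unfolding filterlim_at_top by blast
  ultimately have "\<forall>\<^sub>F n in sequentially. \<kappa> \<le> \<Phi> (inverse (real n)) * inverse (real n) ^ CARD('d)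
      \<and> inverse (real n) < R \<and> max 2 b \<le> real n"
    by eventually_elim auto
  then obtain m where m: "\<kappa> \<le> \<Phi> (inverse (real m)) * inverse (real m) ^ CARD('d)"
    "inverse (real m) < R" "max 2 b \<le> real m"
    using eventually_happens' by (metis (mono_tags, lifting) sequentially_bot)
  have m0: "0 < real m" using m(3) by simp
  show thesis
  proof (rule that[of m])
    show "2 \<le> m" "b \<le> real m" using m(3) by auto
    show "ereal (\<kappa> * real m ^ CARD('d)) \<le> \<phi> x" if x: "infnorm x \<le> 1 / real m" for x
    proof (cases "x = 0")
      case True
      then show ?thesis using R(4) by simp
    next
      case False
      then have x0: "0 < infnorm x" by (simp add: infnorm_pos_lt)
      have xm: "infnorm x \<le> inverse (real m)" using x by (simp add: inverse_eq_divide)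
      have "\<kappa> * real m ^ CARD('d) \<le> \<Phi> (inverse (real m))"
        using mult_right_mono[OF m(1), of "real m ^ CARD('d)"] m0
        by (simp add: mult.assoc power_mult_distrib[symmetric])
      also have "\<dots> \<le> \<Phi> (infnorm x)"
        using R(2) x0 xm m0 by (auto simp: monotone_on_def)
      finally have "ereal (\<kappa> * real m ^ CARD('d)) \<le> ereal (\<Phi> (infnorm x))" by simp
      also have "\<dots> \<le> \<phi> x" using R(5)[OF x0] xm m(2) by simp
      finally show ?thesis .
    qed
  qed
qed

text \<open>The cells must divide the box exactly, so their side varies with \<open>L\<close>. With
  \<open>k\<close> the ceiling of \<open>2 * L * m\<close>, the bound
  \<open>k \<le> 2 * L * m + 1 \<le> 4 * L * m\<close> keeps it within a factor 2 of
  \<open>1 / m\<close>.\<close>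

lemma box_mesh:
  assumes "2 \<le> m" "1 \<le> L"
  obtains k :: int and \<delta> :: real where "0 < k" "real_of_int k * \<delta> = 2 * L"
    "1 / (2 * real m) \<le> \<delta>" "\<delta> \<le> 1 / real m"
proof -
  define k where "k = \<lceil>2 * L * real m\<rceil>"
  have m0: "0 < real m" using assms(1) by simp
  have Lm: "1 \<le> L * real m" using mult_mono[of 1 L 1 "real m"] assms by simp
  have k: "2 * L * real m \<le> real_of_int k" "real_of_int k \<le> 2 * L * real m + 1"
    unfolding k_def by linarith+
  have k0: "0 < real_of_int k" using k(1) Lm by linarith
  have k2: "real_of_int k \<le> 4 * (L * real m)" using k(2) Lm by linarith
  show thesis
  proof (rule that[of k "2 * L / real_of_int k"])
    show "0 < k" using k0 by simp
    show "real_of_int k * (2 * L / real_of_int k) = 2 * L" using k0 by simp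
    show "1 / (2 * real m) \<le> 2 * L / real_of_int k" using k0 m0 k2 by (simp add: field_simps)
    show "2 * L / real_of_int k \<le> 1 / real m" using k0 m0 k(1) by (simp add: field_simps)
  qed
qed

text \<open>Every constant, \<open>m\<close> included, is fixed before \<open>L\<close>; only the
  mesh \<open>k\<close>, \<open>\<delta>\<close> depends on the box. This is the source of the
  uniformity in \<open>L\<close>.\<close>

lemma lattice_sum_cell_gas:
  fixes \<phi> :: "real ^ 'd \<Rightarrow> ereal" and \<rho> \<beta> :: real
  assumes sym: "\<And>x. \<phi> (- x) = \<phi> x" and meas: "\<phi> \<in> borel_measurable borel"
    and rep: "strongly_repulsive \<phi>" and low: "lower_bounded_potential \<phi>" and temp: "tempered \<phi>"
    and \<rho>: "\<rho> > 0" and \<beta>: "\<beta> > 0"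
  shows "\<exists>\<eta> \<sigma> B B2 C\<^sub>0 m. \<forall>L\<ge>1. (\<forall>y. (\<forall>i. \<bar>y $ i\<bar> < 2 * L) \<longrightarrow> lattice_sum \<phi> L y \<noteq> - \<infinity>) \<and>
    (\<exists>(k :: int) \<delta>. 0 < k \<and> real_of_int k * \<delta> = 2 * L \<and>
      cell_gas lborel (box_\<Lambda> L) (box_cell L \<delta>) (cells k) (cell_dist m k) (cell_near k)
        (pair_factor \<phi> \<beta> L) \<eta> \<sigma> (\<delta> ^ CARD('d)) B B2 \<rho> C\<^sub>0)"
proof -
  obtain \<theta> B\<^sub>0 where \<theta>: "\<theta> > 0" and B\<^sub>0: "B\<^sub>0 > 0"
    and lower: "\<And>x. ereal (- (B\<^sub>0 * kap (- 1 - \<theta>) x)) \<le> \<phi> x"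
    and upper: "\<And>r. r > 0 \<Longrightarrow> \<exists>B'\<ge>0. \<forall>x. r \<le> infnorm x \<longrightarrow> \<phi> x \<le> ereal (B' * kap (- 1 - \<theta>) x)"
    using potential_kap_bounds[OF rep low temp] by blast
  \<comment> \<open>Half of the decay beyond the critical exponent is spent on the weights, the
    other half keeps the sums over cells bounded.\<close>
  define \<eta> where "\<eta> = \<theta> / 2"
  define s where "s = - 1 - 2 * \<eta>"
  have s\<theta>: "- 1 - \<theta> = s" by (simp add: s_def \<eta>_def)
  have \<eta>: "0 < \<eta>" and s: "s \<le> 0" "s < - 1" using \<theta> by (auto simp: \<eta>_def s_def)
  note lower = lower[unfolded s\<theta>] and upper = upper[unfolded s\<theta>]
  obtain S where S: "S > 0" "\<And>n::nat. (\<Sum>t<n. (1 + real t) powr s) \<le> S"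
    using sum_powr_bound[OF s(2)] by blast
  obtain S1 where S1: "S1 > 0" "\<And>n::nat. (\<Sum>t<n. (1 + real t) powr (- 1 - \<eta>)) \<le> S1"
    using sum_powr_bound[of "- 1 - \<eta>"] \<eta> by auto
  define H where "H = ((1 / 3) powr s) ^ CARD('d) * (2 * S) ^ CARD('d)"
  have H: "0 < H" using S by (simp add: H_def)
  define q where "q = ((1 / 4) powr s) ^ CARD('d)"
  have q: "0 < q" by (simp add: q_def)
  define B where "B = \<beta> * B\<^sub>0 * H * q"
  have B: "0 < B" using \<beta> B\<^sub>0 H q by (simp add: B_def)
  define C\<^sub>0 :: real where "C\<^sub>0 = 8 ^ CARD('d)"
  \<comment> \<open>Chosen before \<open>m\<close>: the first summand is
    \<open>16 * B * \<sigma> / \<beta>\<close> without the factor \<open>real m ^ CARD('d)\<close>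
    of \<open>\<sigma>\<close>, the second pays for the attraction of the periodic images.\<close>
  define \<kappa> where "\<kappa> = 16 * B\<^sub>0 * H * q * (4 * S1) ^ CARD('d) + B\<^sub>0 * H"
  \<comment> \<open>The lower bound on \<open>m\<close> yields \<open>near_sparse\<close>, because a
    cell has volume at most \<open>1 / real m\<close>.\<close>
  obtain m :: nat where m: "2 \<le> m" "4 * C\<^sub>0 * \<rho> \<le> real m"
    and rep_m: "\<And>x. infnorm x \<le> 1 / real m \<Longrightarrow> ereal (\<kappa> * real m ^ CARD('d)) \<le> \<phi> x"
    using repulsion_scale[OF rep] by blast
  have m1: "1 \<le> real m" using m(1) by simp
  have md: "1 \<le> real m ^ CARD('d)" "real m \<le> real m ^ CARD('d)"
    using m1 power_increasing[of 1 "CARD('d)" "real m"] by auto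
  define \<sigma> where "\<sigma> = (4 * S1) ^ CARD('d) * real m ^ CARD('d)"
  have \<sigma>: "0 < \<sigma>" using S1 m by (simp add: \<sigma>_def)
  \<comment> \<open>The radius is the lower bound of the cell side for all \<open>L\<close>, hence
    also of the distance between particles whose cells are not near each other.\<close>
  obtain B' where B': "0 \<le> B'" "\<And>x. 1 / (2 * real m) \<le> infnorm x \<Longrightarrow> \<phi> x \<le> ereal (B' * kap s x)"
    using upper[of "1 / (2 * real m)"] m by auto
  define B2 where "B2 = \<beta> * B' * H * q"
  have B2: "0 \<le> B2" using \<beta> B' H q by (simp add: B2_def)
  have same: "16 * B * \<sigma> \<le> \<beta> * (\<kappa> * real m ^ CARD('d) - B\<^sub>0 * H)"
  proof -
    have "B\<^sub>0 * H * 1 \<le> B\<^sub>0 * H * real m ^ CARD('d)"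
      using B\<^sub>0 H md by (intro mult_left_mono) auto
    then have "16 * B\<^sub>0 * H * q * (4 * S1) ^ CARD('d) * real m ^ CARD('d) \<le> \<kappa> * real m ^ CARD('d) - B\<^sub>0 * H"
      unfolding \<kappa>_def by (simp add: algebra_simps)
    then have "\<beta> * (16 * B\<^sub>0 * H * q * (4 * S1) ^ CARD('d) * real m ^ CARD('d)) \<le>
        \<beta> * (\<kappa> * real m ^ CARD('d) - B\<^sub>0 * H)"
      using \<beta> by (intro mult_left_mono) auto
    then show ?thesis by (simp add: B_def \<sigma>_def ac_simps)
  qed
  show ?thesis
  proof (rule exI[of _ \<eta>], rule exI[of _ \<sigma>], rule exI[of _ B], rule exI[of _ B2],
      rule exI[of _ C\<^sub>0], rule exI[of _ m], intro allI impI)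
    fix L :: real assume L: "1 \<le> L"
    note V = lattice_sum_bounds[OF s(1) S(2) less_imp_le[OF B\<^sub>0] L lower, folded H_def]
    obtain k :: int and \<delta> where k0: "0 < k" and k: "real_of_int k * \<delta> = 2 * L"
      and \<delta>: "1 / (2 * real m) \<le> \<delta>" "\<delta> \<le> 1 / real m"
      using box_mesh[OF m(1) L] by blast
    have \<delta>0: "0 < \<delta>" using m \<delta>(1) by (intro less_le_trans[OF _ \<delta>(1)]) auto
    have fin: "lattice_sum \<phi> L y \<noteq> - \<infinity>" if "\<forall>i. \<bar>y $ i\<bar> < 2 * L" for y
      using V(1)[of y] that by auto
    have \<delta>d: "\<delta> ^ CARD('d) \<le> 1 / real m"
    proof -
      have "1 / real m \<le> 1" using m1 by simp
      then have "(1 / real m) ^ CARD('d) \<le> (1 / real m) ^ 1" by (intro power_decreasing) auto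
      moreover have "\<delta> ^ CARD('d) \<le> (1 / real m) ^ CARD('d)" using \<delta> \<delta>0 by (intro power_mono) auto
      ultimately show ?thesis by simp
    qed
    have pf_sym: "pair_factor \<phi> \<beta> L x y = pair_factor \<phi> \<beta> L y x" for x y
    proof -
      have "lattice_sum \<phi> L (x - y) = lattice_sum \<phi> L (y - x)"
        using lattice_sum_uminus[of \<phi>, OF sym, of L "y - x"] by simp
      then show ?thesis by (simp add: pair_factor_def abs_minus_commute)
    qed
    have tk: "tkap s L (x - y) \<le> q * cell_dist m k (box_cell L \<delta> x) (box_cell L \<delta> y) powr s"
      if "x \<in> box_\<Lambda> L" "y \<in> box_\<Lambda> L" for x y :: "real ^ 'd"
      unfolding q_def by (rule tkap_le_cell_dist[OF m(1) \<delta> k that s(1)])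
    have "cell_gas lborel (box_\<Lambda> L) (box_cell L \<delta>) (cells k) (cell_dist m k) (cell_near k)
        (pair_factor \<phi> \<beta> L) \<eta> \<sigma> (\<delta> ^ CARD('d)) B B2 \<rho> C\<^sub>0"
    proof (intro cell_gas.intro cell_gas_axioms.intro)
      show "sigma_finite_measure lborel" by (rule sigma_finite_lborel)
      show "box_\<Lambda> L \<in> sets lborel" unfolding box_\<Lambda>_def by measurable
      show "\<delta> ^ CARD('d) \<le> 1" using \<delta>d m1 by (meson divide_le_eq_1 order_trans less_le_trans zero_less_one)
      show "4 * C\<^sub>0 * \<rho> * \<delta> ^ CARD('d) \<le> 1"
      proof -
        have "4 * C\<^sub>0 * \<rho> * \<delta> ^ CARD('d) \<le> 4 * C\<^sub>0 * \<rho> * (1 / real m)"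
          using \<delta>d \<rho> by (intro mult_left_mono) (auto simp: C\<^sub>0_def)
        also have "\<dots> \<le> 1" using m(2) m1 by (simp add: field_simps)
        finally show ?thesis .
      qed
      show "(\<lambda>(x, y). pair_factor \<phi> \<beta> L x y) \<in> borel_measurable (lborel \<Otimes>\<^sub>M lborel)"
      proof -
        obtain W where W [measurable]: "W \<in> borel_measurable borel"
          and eq: "\<And>y. (\<forall>i. \<bar>y $ i\<bar> < 2 * L) \<Longrightarrow> lattice_sum \<phi> L y = W y"
          using lattice_sum_measurable[OF meas s(1) S(2) less_imp_le[OF B\<^sub>0] L lower] by blast
        have "(\<lambda>y :: real ^ 'd. if \<forall>i. \<bar>y $ i\<bar> < 2 * L then boltzmann \<beta> (W y) else 0) \<in> borel_measurable borel"
          by measurable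
        then have [measurable]: "(\<lambda>y :: real ^ 'd. if \<forall>i. \<bar>y $ i\<bar> < 2 * L
            then boltzmann \<beta> (lattice_sum \<phi> L y) else 0) \<in> borel_measurable borel"
          by (rule measurable_cong[THEN iffD1, rotated]) (simp add: eq)
        have "(\<lambda>p. fst p - snd p) \<in> borel_measurable (lborel \<Otimes>\<^sub>M (lborel :: (real ^ 'd) measure))"
          by measurable
        from measurable_compose[OF this, of "\<lambda>y. if \<forall>i. \<bar>y $ i\<bar> < 2 * L
            then boltzmann \<beta> (lattice_sum \<phi> L y) else 0"]
        show ?thesis by (simp add: pair_factor_def case_prod_unfold)
      qed
      fix x y :: "real ^ 'd"
      show "0 \<le> pair_factor \<phi> \<beta> L x y" by (simp add: pair_factor_def boltzmann_nonneg)
      show "pair_factor \<phi> \<beta> L x y = pair_factor \<phi> \<beta> L y x" by (rule pf_sym)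
      assume xy: "x \<in> box_\<Lambda> L" "y \<in> box_\<Lambda> L"
      have d: "\<And>i. \<bar>(x - y) $ i\<bar> < 2 * L" by (rule box_diff_less[OF xy])
      let ?P = "cell_dist m k (box_cell L \<delta> x) (box_cell L \<delta> y) powr (- 1 - 2 * \<eta>)"
      show "pair_factor \<phi> \<beta> L x y \<le> exp (B * ?P)"
      proof -
        have "pair_factor \<phi> \<beta> L x y \<le> exp (- \<beta> * - (B\<^sub>0 * H * tkap s L (x - y)))"
          unfolding pair_factor_box[OF xy] by (intro boltzmann_le \<beta> V(1) d)
        also have "\<dots> \<le> exp (B * ?P)"
          using mult_left_mono[OF tk[OF xy], of "\<beta> * (B\<^sub>0 * H)"] \<beta> B\<^sub>0 H
          by (simp add: B_def s_def ac_simps)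
        finally show ?thesis .
      qed
      show "pair_factor \<phi> \<beta> L x y \<le> exp (- 16 * B * \<sigma>)" if "box_cell L \<delta> x = box_cell L \<delta> y"
      proof -
        have "infnorm (x - y) \<le> 1 / real m"
          using same_box_cell_infnorm[OF \<delta>0 that] \<delta>(2) by linarith
        then have "ereal (\<kappa> * real m ^ CARD('d)) - ereal (B\<^sub>0 * H) \<le> \<phi> (x - y) - ereal (B\<^sub>0 * H)"
          by (intro ereal_minus_mono rep_m) auto
        also have "\<dots> \<le> lattice_sum \<phi> L (x - y)" by (intro V(2) d)
        finally have "pair_factor \<phi> \<beta> L x y \<le> exp (- \<beta> * (\<kappa> * real m ^ CARD('d) - B\<^sub>0 * H))"
          unfolding pair_factor_box[OF xy] by (intro boltzmann_le \<beta>) simp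
        also have "\<dots> \<le> exp (- 16 * B * \<sigma>)" using same by simp
        finally show ?thesis .
      qed
      show "exp (- B2 * ?P) \<le> pair_factor \<phi> \<beta> L x y"
        if "\<not> cell_near k (box_cell L \<delta> x) (box_cell L \<delta> y)"
      proof -
        have "lattice_sum \<phi> L (x - y) \<le> ereal (B' * H * tkap s L (x - y))"
        proof (rule V(3)[OF d B'(1)])
          fix r :: "real ^ 'd" assume "r \<in> int_lattice"
          then show "\<phi> (x - y + (2 * L) *\<^sub>R r) \<le> ereal (B' * kap s (x - y + (2 * L) *\<^sub>R r))"
            using not_near_infnorm[OF \<delta>0 k L xy _ that] \<delta>(1) by (intro B'(2)) (meson order_trans)
        qed
        then have "exp (- \<beta> * (B' * H * tkap s L (x - y))) \<le> pair_factor \<phi> \<beta> L x y"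
          unfolding pair_factor_box[OF xy] using fin d by (intro boltzmann_ge \<beta>) auto
        moreover have "exp (- B2 * ?P) \<le> exp (- \<beta> * (B' * H * tkap s L (x - y)))"
          using mult_left_mono[OF tk[OF xy], of "\<beta> * (B' * H)"] \<beta> B' H
          by (simp add: B2_def s_def ac_simps)
        ultimately show ?thesis by linarith
      qed
    next
      fix q :: "'d \<Rightarrow> int" assume q: "q \<in> cells k"
      show "{x \<in> box_\<Lambda> L. box_cell L \<delta> x = q} \<in> sets lborel"
        "emeasure lborel {x \<in> box_\<Lambda> L. box_cell L \<delta> x = q} = ennreal (\<delta> ^ CARD('d))"
        by (rule box_cell_measure[OF \<delta>0 k q])+
      show "(\<Sum>p\<in>cells k. cell_dist m k q p powr (- 1 - \<eta>)) \<le> \<sigma>"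
        unfolding \<sigma>_def using \<eta> m q by (intro sum_cell_dist_powr_le S1) auto
      show "real (card {p\<in>cells k. cell_near k p q}) \<le> C\<^sub>0"
        unfolding C\<^sub>0_def by (rule card_cell_near_le[OF q])
    qed (use \<delta>0 k \<eta> \<sigma> B B2 \<rho> in \<open>auto simp: C\<^sub>0_def intro: finite_cells box_cell_in
        cell_dist_ge1 cell_dist_self cell_dist_sym cell_dist_triangle\<close>)
    then show "(\<forall>y. (\<forall>i. \<bar>y $ i\<bar> < 2 * L) \<longrightarrow> lattice_sum \<phi> L y \<noteq> - \<infinity>) \<and>
      (\<exists>(k :: int) \<delta>. 0 < k \<and> real_of_int k * \<delta> = 2 * L \<and>
        cell_gas lborel (box_\<Lambda> L) (box_cell L \<delta>) (cells k) (cell_dist m k) (cell_near k)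
          (pair_factor \<phi> \<beta> L) \<eta> \<sigma> (\<delta> ^ CARD('d)) B B2 \<rho> C\<^sub>0)"
      using fin k0 k by blast
  qed
qed

section \<open>From the infimum to the average, and return to the correlation functions\<close>

lemma INF_eq_member:
  fixes g :: "'a \<Rightarrow> 'b::complete_linorder"
  assumes "finite A" "A \<noteq> {}"
  shows "\<exists>k\<in>A. (INF i\<in>A. g i) = g k"
proof -
  have "Min (g ` A) \<in> g ` A" using assms by (intro Min_in) auto
  then show ?thesis using Min_Inf[of "g ` A"] assms by auto
qed

text \<open>If some pair energy is infinite, a particle of that pair already gives the value 0.
  Otherwise the \<open>n\<close> interaction sums count every pair from both ends, so one of them is
  at least \<open>2 / n\<close> times the pair sum.\<close>

lemma INF_exp_ext_le_average:
  fixes V :: "nat \<Rightarrow> nat \<Rightarrow> ereal"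
  assumes n: "1 \<le> n" and \<beta>: "0 < \<beta>" and sym: "\<And>i j. V i j = V j i"
    and fin: "\<And>i j. i \<in> {1..n} \<Longrightarrow> j \<in> {1..n} \<Longrightarrow> i \<noteq> j \<Longrightarrow> V i j \<noteq> - \<infinity>"
  shows "(INF i\<in>{1..n}. exp_ext (ereal (- \<beta>) * (\<Sum>j\<in>{1..n} - {i}. V i j))) \<le>
    exp_ext (ereal (- (2 * \<beta> / real n)) * (\<Sum>(i, j)\<in>pairs {1..n}. V i j))"
proof -
  have sfin: "(\<Sum>j\<in>{1..n} - {i}. V i j) \<noteq> - \<infinity>" if "i \<in> {1..n}" for i
    using fin that by (intro boltzmann_sum(2)) auto
  have "\<exists>k\<in>{1..n}. exp_ext (ereal (- \<beta>) * (\<Sum>j\<in>{1..n} - {k}. V k j)) \<le>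
    exp_ext (ereal (- (2 * \<beta> / real n)) * (\<Sum>(i, j)\<in>pairs {1..n}. V i j))"
  proof (cases "\<exists>i\<in>{1..n}. \<exists>j\<in>{1..n} - {i}. V i j = \<infinity>")
    case True
    then obtain i j where ij: "i \<in> {1..n}" "j \<in> {1..n} - {i}" "V i j = \<infinity>" by blast
    then have "(\<Sum>j\<in>{1..n} - {i}. V i j) = \<infinity>" by (subst sum_Pinfty) auto
    then have "exp_ext (ereal (- \<beta>) * (\<Sum>j\<in>{1..n} - {i}. V i j)) = 0"
      using \<beta> by (subst exp_ext_boltzmann) (auto simp: boltzmann_def)
    then show ?thesis using ij(1) by (intro bexI[of _ i]) auto
  next
    case False
    define v where "v i j = (if i = j then 0 else real_of_ereal (V i j))" for i j
    have v: "V i j = ereal (v i j)" if "i \<in> {1..n}" "j \<in> {1..n}" "i \<noteq> j" for i j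
    proof -
      have "V i j \<noteq> \<infinity>" using False that by blast
      then show ?thesis using fin[OF that] that by (cases "V i j") (auto simp: v_def)
    qed
    have vsym: "v i j = v j i" for i j using sym[of i j] by (simp add: v_def)
    define s where "s i = (\<Sum>j\<in>{1..n} - {i}. v i j)" for i
    define E where "E = (\<Sum>(i, j)\<in>pairs {1..n}. v i j)"
    have s: "(\<Sum>j\<in>{1..n} - {i}. V i j) = ereal (s i)" if "i \<in> {1..n}" for i
    proof -
      have "(\<Sum>j\<in>{1..n} - {i}. V i j) = (\<Sum>j\<in>{1..n} - {i}. ereal (v i j))"
        using that by (intro sum.cong v) auto
      then show ?thesis by (simp add: s_def)
    qed
    have E: "(\<Sum>(i, j)\<in>pairs {1..n}. V i j) = ereal E"
    proof -
      have "(\<Sum>(i, j)\<in>pairs {1..n}. V i j) = (\<Sum>p\<in>pairs {1..n}. ereal (v (fst p) (snd p)))"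
        by (intro sum.cong) (auto simp: pairs_def intro!: v)
      then show ?thesis by (simp add: E_def case_prod_unfold)
    qed
    have total: "(\<Sum>i\<in>{1..n}. s i) = 2 * E"
      unfolding s_def E_def using sum_offdiag_eq_pairs[of "{1..n}" v] vsym by simp
    have "\<exists>k\<in>{1..n}. 2 * E / real n \<le> s k"
    proof (rule ccontr)
      assume "\<not> (\<exists>k\<in>{1..n}. 2 * E / real n \<le> s k)"
      then have "(\<Sum>i\<in>{1..n}. s i) < (\<Sum>i\<in>{1..n}. 2 * E / real n)"
        using n by (intro sum_strict_mono) (auto simp: not_le)
      then show False using total n by simp
    qed
    then obtain k where k: "k \<in> {1..n}" "2 * E / real n \<le> s k" by blast
    have "\<beta> * (2 * E / real n) \<le> \<beta> * s k" using k(2) \<beta> by (intro mult_left_mono) auto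
    then have "exp_ext (ereal (- \<beta>) * ereal (s k)) \<le> exp_ext (ereal (- (2 * \<beta> / real n)) * ereal E)"
      by (simp add: exp_ext_def field_simps)
    then show ?thesis using k(1) s E by (intro bexI[of _ k]) auto
  qed
  then show ?thesis by (meson INF_lower order_trans)
qed

lemma exp_ext_per_energy:
  assumes \<beta>: "0 < \<beta>" and z: "\<And>i. i \<in> {1..N} \<Longrightarrow> z i \<in> box_\<Lambda> L"
    and fin: "\<And>y :: real ^ 'd. (\<forall>i. \<bar>y $ i\<bar> < 2 * L) \<Longrightarrow> lattice_sum \<phi> L y \<noteq> - \<infinity>"
  shows "exp_ext (ereal (- \<beta>) * per_energy \<phi> L N z) =
    ennreal (\<Prod>(i, j)\<in>pairs {1..N}. pair_factor \<phi> \<beta> L (z i) (z j))"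
proof -
  have ne: "(case p of (i, j) \<Rightarrow> lattice_sum \<phi> L (z i - z j)) \<noteq> - \<infinity>" if "p \<in> pairs {1..N}" for p
  proof -
    obtain i j where p: "p = (i, j)" by (cases p)
    then have "z i \<in> box_\<Lambda> L" "z j \<in> box_\<Lambda> L" using that z by (auto simp: pairs_def)
    then have "\<forall>l. \<bar>(z i - z j) $ l\<bar> < 2 * L" by (intro allI box_diff_less)
    from fin[OF this] show ?thesis unfolding p by simp
  qed
  have "per_energy \<phi> L N z \<noteq> - \<infinity>"
    unfolding per_energy_def index_pairs_eq using ne by (intro boltzmann_sum(2)) auto
  then have "exp_ext (ereal (- \<beta>) * per_energy \<phi> L N z) = ennreal (boltzmann \<beta> (per_energy \<phi> L N z))"
    by (rule exp_ext_boltzmann[OF \<beta>])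
  also have "boltzmann \<beta> (per_energy \<phi> L N z) =
      (\<Prod>p\<in>pairs {1..N}. boltzmann \<beta> (case p of (i, j) \<Rightarrow> lattice_sum \<phi> L (z i - z j)))"
    unfolding per_energy_def index_pairs_eq using ne by (intro boltzmann_sum(1)) auto
  also have "\<dots> = (\<Prod>(i, j)\<in>pairs {1..N}. pair_factor \<phi> \<beta> L (z i) (z j))"
    using z by (intro prod.cong) (auto simp: pairs_def pair_factor_box)
  finally show ?thesis .
qed

lemma indicator_PiE_eq_prod:
  assumes "finite I" "y \<in> space (Pi\<^sub>M I (\<lambda>_. lborel))"
  shows "(indicator (I \<rightarrow>\<^sub>E A) y :: ennreal) = (\<Prod>i\<in>I. indicator A (y i))"
proof -
  have "y \<in> extensional I" using assms(2) by (auto simp: space_PiM PiE_def)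
  then have "y \<in> I \<rightarrow>\<^sub>E A \<longleftrightarrow> (\<forall>i\<in>I. y i \<in> A)" by (auto simp: PiE_def Pi_def)
  moreover have "(\<Prod>i\<in>I. indicator A (y i) :: ennreal) = (if \<forall>i\<in>I. y i \<in> A then 1 else 0)"
    using assms(1) by (induction I rule: finite_induct) (auto simp: indicator_def)
  ultimately show ?thesis by (simp add: indicator_def)
qed

theorem corollary3p17:
  fixes \<phi> :: "real ^ 'd \<Rightarrow> ereal" and \<rho>_max \<beta> :: real
  assumes "\<And>x. \<phi> x \<noteq> -\<infinity>"
    and "\<And>x. \<phi> (- x) = \<phi> x"
    and "\<phi> \<in> borel_measurable borel"
    and "strongly_repulsive \<phi>"
    and "lower_bounded_potential \<phi>"
    and "tempered \<phi>"
    and "\<rho>_max > 0" and "\<beta> > 0"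
  shows "\<exists>(\<xi>::real) (L\<^sub>0::real) (\<zeta>::real). \<xi> > 0 \<and> L\<^sub>0 > 0 \<and> \<zeta> \<ge> \<xi> \<and>
    (\<forall>L\<ge>L\<^sub>0. \<forall>(n::nat) (N::nat).
      1 \<le> N \<and> n \<le> N \<and> real N \<le> \<rho>_max * (2 * L) ^ CARD('d) \<longrightarrow>
      (\<forall>x \<in> {1..n} \<rightarrow> box_\<Lambda> L.
        corr_fun \<phi> \<beta> L n N x \<le> ennreal (\<xi> ^ n) \<and>
        corr_fun \<phi> \<beta> L n N x \<le> ennreal (\<zeta> ^ n) *
          (INF i\<in>{1..n}. exp_ext (ereal (- \<beta>) *
             (\<Sum>j\<in>{1..n} - {i}. periodized \<phi> L (x i - x j)))) \<and>
        (1 \<le> n \<longrightarrow>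
          corr_fun \<phi> \<beta> L n N x \<le> ennreal (\<zeta> ^ n) *
            exp_ext (ereal (- (2 * \<beta> / real n)) *
              (\<Sum>(i, j)\<in>index_pairs n. periodized \<phi> L (x i - x j))) \<and>
          ennreal (\<zeta> ^ n) *
            exp_ext (ereal (- (2 * \<beta> / real n)) *
              (\<Sum>(i, j)\<in>index_pairs n. periodized \<phi> L (x i - x j))) =
          ennreal (\<zeta> ^ n) *
            exp_ext (ereal (- (2 * \<beta> / real n)) * per_energy \<phi> L n x))))"
proof -
  note sym = assms(2) and \<rho> = assms(7) and \<beta> = assms(8)
  obtain \<eta> \<sigma> B B2 C\<^sub>0 m where
    fin: "\<And>L y. 1 \<le> L \<Longrightarrow> (\<forall>i. \<bar>y $ i\<bar> < 2 * L) \<Longrightarrow> lattice_sum \<phi> L y \<noteq> - \<infinity>" and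
    gas: "\<And>L. 1 \<le> L \<Longrightarrow> \<exists>(k :: int) \<delta>. 0 < k \<and> real_of_int k * \<delta> = 2 * L \<and>
      cell_gas lborel (box_\<Lambda> L) (box_cell L \<delta>) (cells k) (cell_dist m k) (cell_near k)
        (pair_factor \<phi> \<beta> L) \<eta> \<sigma> (\<delta> ^ CARD('d)) B B2 \<rho>_max C\<^sub>0"
    using lattice_sum_cell_gas[of \<phi>, OF sym assms(3-6) \<rho> \<beta>] by blast
  \<comment> \<open>The constants do not depend on \<open>L\<close>, so their signs can be read off
    the locale at \<open>L = 1\<close>.\<close>
  have pos: "0 < \<eta>" "0 < 16 * (B * \<sigma>)"
    using gas[of 1] cell_gas.pos[of lborel "box_\<Lambda> 1"] by (auto intro!: mult_pos_pos)
  obtain C where C: "0 < C"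
    "\<And>z. 1 \<le> z \<Longrightarrow> exp (- (16 * (B * \<sigma>)) * z powr \<eta>) \<le> C * z powr (- 1 - \<eta>)"
    using exp_neg_powr_bound[OF pos(2,1)] by blast
  define ins where "ins = exp (- 4 * B2 * \<sigma> * \<rho>_max) / 2"
  define \<zeta> where "\<zeta> = \<rho>_max / ins * exp (C * \<sigma> * \<rho>_max / ins + 6 * (B * \<sigma>))"
  have \<zeta>: "0 < \<zeta>" using \<rho> by (simp add: \<zeta>_def ins_def)
  \<comment> \<open>Used with \<open>J = {}\<close> for the uniform bound and with
    \<open>J = {1..n} - {k}\<close> for the infimum, \<open>k\<close> being an index at which it is
    attained.\<close>
  have main: "corr_fun \<phi> \<beta> L n N x \<le> ennreal (\<Prod>j\<in>J. pair_factor \<phi> \<beta> L (x k) (x j)) * ennreal (\<zeta> ^ n)"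
    if L: "1 \<le> L" and n: "1 \<le> n" "n \<le> N" and N: "real N \<le> \<rho>_max * (2 * L) ^ CARD('d)"
      and x: "x \<in> {1..n} \<rightarrow> box_\<Lambda> L" and k: "k \<in> {1..n}" and J: "J \<subseteq> {1..n} - {k}"
    for L n N x k J
  proof -
    obtain K :: int and \<delta> where K: "0 < K" "real_of_int K * \<delta> = 2 * L" and
      G: "cell_gas lborel (box_\<Lambda> L) (box_cell L \<delta>) (cells K) (cell_dist m K) (cell_near K)
        (pair_factor \<phi> \<beta> L) \<eta> \<sigma> (\<delta> ^ CARD('d)) B B2 \<rho>_max C\<^sub>0"
      using gas[OF L] by blast
    interpret G: cell_gas lborel "box_\<Lambda> L" "box_cell L \<delta>" "cells K" "cell_dist m K" "cell_near K"
      "pair_factor \<phi> \<beta> L" \<eta> \<sigma> "\<delta> ^ CARD('d)" B B2 \<rho>_max C\<^sub>0 by (rule G)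
    have vol: "G.vol = (2 * L) ^ CARD('d)"
    proof -
      have "G.vol = \<delta> ^ CARD('d) * real_of_int K ^ CARD('d)"
        using K(1) by (simp add: G.vol_def card_cells)
      also have "\<dots> = (real_of_int K * \<delta>) ^ CARD('d)" by (simp only: power_mult_distrib mult.commute)
      finally show ?thesis unfolding K(2) .
    qed
    \<comment> \<open>One identity for both integrals: \<open>I = {1..N}\<close> with
      \<open>z = y\<close> for the partition function, and \<open>I = {n+1..N}\<close> with the
      other coordinates fixed for the correlation function. If a coordinate in \<open>I\<close>
      leaves the box, both sides vanish.\<close>
    have ind: "exp_ext (ereal (- \<beta>) * per_energy \<phi> L N z) * indicator (I \<rightarrow>\<^sub>E box_\<Lambda> L) y =
        G.in\<Lambda> I y * ennreal (G.boltz {1..N} z)"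
      if "y \<in> space (Pi\<^sub>M I (\<lambda>_. lborel))" "finite I" "\<And>i. i \<in> {1..N} - I \<Longrightarrow> z i \<in> box_\<Lambda> L"
        "\<And>i. i \<in> I \<Longrightarrow> z i = y i" for I y z
    proof (cases "\<forall>i\<in>I. y i \<in> box_\<Lambda> L")
      case True
      have "z i \<in> box_\<Lambda> L" if "i \<in> {1..N}" for i
        using True that \<open>\<And>i. i \<in> {1..N} - I \<Longrightarrow> z i \<in> box_\<Lambda> L\<close> \<open>\<And>i. i \<in> I \<Longrightarrow> z i = y i\<close>
        by (cases "i \<in> I") auto
      from exp_ext_per_energy[OF \<beta> this fin[OF L]]
      have "exp_ext (ereal (- \<beta>) * per_energy \<phi> L N z) = ennreal (G.boltz {1..N} z)"
        unfolding G.boltz_def by simp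
      then show ?thesis
        unfolding indicator_PiE_eq_prod[OF that(2,1)] G.in\<Lambda>_def by (simp only: mult.commute)
    next
      case False
      then have "G.in\<Lambda> I y = 0" using that(2) by (subst G.in\<Lambda>_eq) auto
      then show ?thesis
        unfolding indicator_PiE_eq_prod[OF that(2,1)] G.in\<Lambda>_def
        by (simp only: mult_zero_left mult_zero_right)
    qed
    have "partition_fun \<phi> \<beta> L N = G.Zf {1..N}"
      unfolding partition_fun_def G.Zf_def by (intro nn_integral_cong ind) auto
    moreover have "(\<integral>\<^sup>+y\<in>({n+1..N} \<rightarrow>\<^sub>E box_\<Lambda> L).
          exp_ext (ereal (- \<beta>) * per_energy \<phi> L N (\<lambda>i. if i \<le> n then x i else y i))
          \<partial>(\<Pi>\<^sub>M i\<in>{n+1..N}. lborel)) =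
        (\<integral>\<^sup>+y. G.in\<Lambda> {n+1..N} y * ennreal (G.boltz {1..N} (\<lambda>i. if i \<le> n then x i else y i))
          \<partial>Pi\<^sub>M {n+1..N} (\<lambda>_. lborel))"
      using x by (intro nn_integral_cong ind) auto
    ultimately have "corr_fun \<phi> \<beta> L n N x = ennreal (fact N / fact (N - n)) * (1 / G.Zf {1..N}) *
        (\<integral>\<^sup>+y. G.in\<Lambda> {n+1..N} y * ennreal (G.boltz {1..N} (\<lambda>i. if i \<le> n then x i else y i))
          \<partial>Pi\<^sub>M {n+1..N} (\<lambda>_. lborel))"
      using n by (simp add: corr_fun_def)
    also have "\<dots> \<le> ennreal (\<Prod>j\<in>J. pair_factor \<phi> \<beta> L (x k) (x j)) *
        ennreal ((\<rho>_max / G.ins * exp (C * \<sigma> * \<rho>_max / G.ins + 6 * (B * \<sigma>))) ^ n)"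
      using N x by (intro G.correlation_bound_prod n k J C) (auto simp: vol)
    finally show ?thesis unfolding G.ins_def \<zeta>_def ins_def .
  qed
  show ?thesis
  proof (rule exI[of _ \<zeta>], rule exI[of _ 1], rule exI[of _ \<zeta>], intro conjI allI impI ballI)
    show "0 < \<zeta>" "\<zeta> \<le> \<zeta>" "(0 :: real) < 1" using \<zeta> by auto
    fix L :: real and n N :: nat and x :: "nat \<Rightarrow> real ^ 'd"
    assume L: "1 \<le> L" and nN: "1 \<le> N \<and> n \<le> N \<and> real N \<le> \<rho>_max * (2 * L) ^ CARD('d)"
      and x: "x \<in> {1..n} \<rightarrow> box_\<Lambda> L"
    have per: "periodized \<phi> L (x i - x j) = lattice_sum \<phi> L (x i - x j)"
      if "i \<in> {1..n}" "j \<in> {1..n}" for i j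
    proof -
      have "x i \<in> box_\<Lambda> L" "x j \<in> box_\<Lambda> L" using x that by auto
      from box_diff_less[OF this] show ?thesis
        by (simp add: periodized_def indicator_def abs_less_iff minus_less_iff)
    qed
    have persym: "periodized \<phi> L (x i - x j) = periodized \<phi> L (x j - x i)" for i j
    proof -
      have "lattice_sum \<phi> L (x i - x j) = lattice_sum \<phi> L (x j - x i)"
        using lattice_sum_uminus[of \<phi>, OF sym, of L "x j - x i"] by simp
      then show ?thesis by (simp add: periodized_def indicator_def) (auto simp: algebra_simps)
    qed
    have perfin: "periodized \<phi> L (x i - x j) \<noteq> - \<infinity>" if "i \<in> {1..n}" "j \<in> {1..n}" for i j
      unfolding per[OF that] using x that by (intro fin L allI box_diff_less) auto
    show first: "corr_fun \<phi> \<beta> L n N x \<le> ennreal (\<zeta> ^ n)"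
    proof (cases "n = 0")
      case False
      then show ?thesis using main[OF L, of n N x 1 "{}"] nN x by simp
    qed (simp add: corr_fun_def)
    show second: "corr_fun \<phi> \<beta> L n N x \<le> ennreal (\<zeta> ^ n) *
      (INF i\<in>{1..n}. exp_ext (ereal (- \<beta>) * (\<Sum>j\<in>{1..n} - {i}. periodized \<phi> L (x i - x j))))"
    \<comment> \<open>For \<open>n = 0\<close> the infimum over the empty set is \<open>top\<close>,
      while the correlation function is 1.\<close>
    proof (cases "n = 0")
      case False
      then obtain k where k: "k \<in> {1..n}"
        and INF: "(INF i\<in>{1..n}. exp_ext (ereal (- \<beta>) * (\<Sum>j\<in>{1..n} - {i}. periodized \<phi> L (x i - x j)))) =
          exp_ext (ereal (- \<beta>) * (\<Sum>j\<in>{1..n} - {k}. periodized \<phi> L (x k - x j)))"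
        using INF_eq_member[of "{1..n}"] by (metis (no_types, lifting) atLeastatMost_empty_iff2 finite_atLeastAtMost less_one not_le)
      have "exp_ext (ereal (- \<beta>) * (\<Sum>j\<in>{1..n} - {k}. periodized \<phi> L (x k - x j))) =
          ennreal (\<Prod>j\<in>{1..n} - {k}. boltzmann \<beta> (periodized \<phi> L (x k - x j)))"
      proof -
        have f: "finite ({1..n} - {k})" by simp
        have ne: "periodized \<phi> L (x k - x j) \<noteq> - \<infinity>" if "j \<in> {1..n} - {k}" for j
          using perfin k that by blast
        have "(\<Sum>j\<in>{1..n} - {k}. periodized \<phi> L (x k - x j)) \<noteq> - \<infinity>"
          using f ne by (rule boltzmann_sum(2))
        moreover have "boltzmann \<beta> (\<Sum>j\<in>{1..n} - {k}. periodized \<phi> L (x k - x j)) =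
            (\<Prod>j\<in>{1..n} - {k}. boltzmann \<beta> (periodized \<phi> L (x k - x j)))"
          using f ne by (rule boltzmann_sum(1))
        ultimately show ?thesis by (metis exp_ext_boltzmann[OF \<beta>])
      qed
      also have "(\<Prod>j\<in>{1..n} - {k}. boltzmann \<beta> (periodized \<phi> L (x k - x j))) =
          (\<Prod>j\<in>{1..n} - {k}. pair_factor \<phi> \<beta> L (x k) (x j))"
        using x k by (intro prod.cong refl) (subst pair_factor_box, auto simp: per)
      finally show ?thesis
        using main[OF L, of n N x k "{1..n} - {k}"] nN x k False
        unfolding INF by (simp add: mult.commute)
    qed (simp add: corr_fun_def)
    show "corr_fun \<phi> \<beta> L n N x \<le> ennreal (\<zeta> ^ n) *
      exp_ext (ereal (- (2 * \<beta> / real n)) * (\<Sum>(i, j)\<in>index_pairs n. periodized \<phi> L (x i - x j)))"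
      if n: "1 \<le> n"
      using second INF_exp_ext_le_average[OF n \<beta>, of "\<lambda>i j. periodized \<phi> L (x i - x j)"] persym perfin
      unfolding index_pairs_eq by (meson mult_left_mono order_trans zero_le)
    show "ennreal (\<zeta> ^ n) *
        exp_ext (ereal (- (2 * \<beta> / real n)) * (\<Sum>(i, j)\<in>index_pairs n. periodized \<phi> L (x i - x j))) =
      ennreal (\<zeta> ^ n) * exp_ext (ereal (- (2 * \<beta> / real n)) * per_energy \<phi> L n x)"
    proof -
      have "(\<Sum>(i, j)\<in>index_pairs n. periodized \<phi> L (x i - x j)) = per_energy \<phi> L n x"
        unfolding per_energy_def by (intro sum.cong) (auto simp: index_pairs_def intro!: per)
      then show ?thesis by simp
    qed
  qed
qed

end
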